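(* Let $l,n,m,r,p_1,\ldots,p_l$ be positive integers, let $A\in\mathbb{R}^{n\times n}$, $B\in\mathbb{R}^{n\times m}$, $C_i\in\mathbb{R}^{p_i\times n}$, $D_i\in\mathbb{R}^{p_i\times m}$ ($i=1,\ldots,l$), $K\in\mathbb{R}^{r\times n}$, and consider the distributed system $$\dot x(t)=Ax(t)+Bu(t),\qquad y_i(t)=C_ix(t)+D_iu(t)\ (i=1,\ldots,l),\qquad z(t)=Kx(t).\qquad (\mathrm{S})$$ Let $\mathcal{G}$ be an unweighted communication graph on the nodes $\{1,\ldots,l\}$ with adjacency matrix $[\gamma_{ij}]\in\{0,1\}^{l\times l}$, and assume that $\mathcal{G}$ is either directed, balanced and strongly connected, or undirected and connected. Then there exists a distributed partial state estimator for (S) that achieves omniscience asymptotically and is of the form $$\dot w_i(t)=N_iw_i(t)+H_iu(t)+L_iy_i(t)+\gamma M_i\sum_{j=1}^{l}\gamma_{ij}\,(w_j(t)-w_i(t)),\qquad z_i(t)=R_iw_i(t),\qquad i=1,\ldots,l,\qquad (\mathrm{E})$$ with $\gamma>0$ and, for some $l_i\in\mathbb{N}\cup\{0\}$, matrices $N_i\in\mathbb{R}^{l_i\times l_i}$, $H_i\in\mathbb{R}^{l_i\times m}$, $L_i\in\mathbb{R}^{l_i\times p_i}$, $M_i\in\mathbb{R}^{l_i\times l_i}$, $R_i\in\mathbb{R}^{r\times l_i}$ (where $l_i=l_j$ whenever $\gamma_{ij}=1$), if and only if system (S) is jointly partially detectable with respect to $K$.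
   Context: Graph conventions: $\gamma_{ij}=1$ if node $j$ sends information to node $i$, and $\gamma_{ij}=0$ otherwise. For an undirected graph $[\gamma_{ij}]$ is symmetric. A directed graph is strongly connected if there is a directed path from every node to every other node; an undirected graph is connected if there is an undirected path between every pair of distinct nodes. A graph is balanced if $\sum_{j=1}^l\gamma_{ij}=\sum_{j=1}^l\gamma_{ji}$ for all $i=1,\ldots,l$. Solutions: $\mathscr{L}^1_{loc}(\mathbb{R};\mathbb{R}^k)$ is the set of locally Lebesgue integrable $\mathbb{R}^k$-valued functions on $\mathbb{R}$. Solutions of the systems are tuples of such functions satisfying the equations almost everywhere, derivatives being understood in the weak sense (so the differentiated variables are locally absolutely continuous). "$z(t)\to 0$ as $t\to\infty$" means $\lim_{t\to\infty}\operatorname{ess\,sup}_{s\ge t}\|z(s)\|=0$. Put $\tilde y=[y_1^\top\ \cdots\ y_l^\top]^\top$, $\tilde C=[C_1^\top\ \cdots\ C_l^\top]^\top$, $\tilde p=\sum_i p_i$, $\tilde w=[w_1^\top\ \cdots\ w_l^\top]^\top$, $\hat z=[z_1^\top\ \cdots\ z_l^\top]^\top$, $\tilde l=\sum_i l_i$. Partial detectability: for matrices $A\in\mathbb{R}^{n\times n}$, $C\in\mathbb{R}^{p\times n}$, $K\in\mathbb{R}^{r\times n}$ (and $B,D$ of suitable sizes), the pair $(A,C)$ is partially detectable with respect to $K$ if for all solutions $(x_1,u,y,z_1),(x_2,u,y,z_2)\in\mathscr{L}^1_{loc}(\mathbb{R};\mathbb{R}^{n+m+p+r})$ of $\dot x=Ax+Bu$,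 $y=Cx+Du$, $z=Kx$ (with the same $u$ and $y$) we have $z_1(t)-z_2(t)\to0$ as $t\to\infty$; equivalently, every solution of the form $(x,0,0,z)$ satisfies $z(t)\to0$ as $t\to\infty$. Joint partial detectability: system (S) is jointly partially detectable with respect to $K$ if the pair $(A,\tilde C)$ is partially detectable with respect to $K$. Distributed partial state estimator: a system of the form (E) is a distributed partial state estimator for (S) that achieves omniscience asymptotically if for every solution $(x,u,\tilde y,z)\in\mathscr{L}^1_{loc}(\mathbb{R};\mathbb{R}^{n+m+\tilde p+r})$ of (S) and every solution $(\tilde w,[u^\top\ \tilde y^\top]^\top,\hat z)\in\mathscr{L}^1_{loc}(\mathbb{R};\mathbb{R}^{\tilde l+m+\tilde p+lr})$ of (E) with the same $u,\tilde y$, we have $z_i(t)-z(t)\to0$ as $t\to\infty$ for all $i\in\{1,\ldots,l\}$. *)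

theory Defs
  imports
    "HOL-Probability.Essential_Supremum"
    "Jordan_Normal_Form.Matrix"
    "Graph_Theory.Digraph_Component"
begin

section \<open>Signals\<close>

text \<open>
  Since the dimensions \<open>p\<^sub>i\<close> and \<open>l\<^sub>i\<close> depend on an index, and the \<open>l\<^sub>i\<close> are existentially
  quantified, all vectors and matrices carry their dimensions explicitly. An \<open>\<real>\<^sup>k\<close>-valued signal
  is a function of type \<^typ>\<open>real \<Rightarrow> real vec\<close>; nodes are numbered from 0.
\<close>

definition L1_loc :: "nat \<Rightarrow> (real \<Rightarrow> real vec) set" where
  "L1_loc k = {f. (\<forall>t. f t \<in> carrier_vec k) \<and>
     (\<forall>i<k. \<forall>S. compact S \<longrightarrow> (\<lambda>t. f t $ i) absolutely_integrable_on S)}"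

definition test_function :: "(real \<Rightarrow> real) \<Rightarrow> bool" where
  "test_function \<phi> \<longleftrightarrow> (\<forall>k t. ((deriv ^^ k) \<phi>) differentiable (at t)) \<and>
     compact (closure {t. \<phi> t \<noteq> 0})"

definition has_weak_deriv :: "nat \<Rightarrow> (real \<Rightarrow> real vec) \<Rightarrow> (real \<Rightarrow> real vec) \<Rightarrow> bool" where
  "has_weak_deriv k f g \<longleftrightarrow> f \<in> L1_loc k \<and> g \<in> L1_loc k \<and>
     (\<forall>\<phi>. test_function \<phi> \<longrightarrow> (\<forall>i<k.
        (LINT t|lebesgue. f t $ i * deriv \<phi> t) = - (LINT t|lebesgue. g t $ i * \<phi> t)))"

definition eucl_norm :: "real vec \<Rightarrow> real" where
  "eucl_norm v = L2_set (\<lambda>i. v $ i) {..<dim_vec v}"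

definition ess_tendsto_zero :: "(real \<Rightarrow> real vec) \<Rightarrow> bool" where
  "ess_tendsto_zero z \<longleftrightarrow>
     ((\<lambda>t. esssup (restrict_space lebesgue {t..}) (\<lambda>s. ereal (eucl_norm (z s)))) \<longlongrightarrow> 0) at_top"


section \<open>Partial detectability\<close>

text \<open>
  In the solution predicates below the signal dimensions are read off from the matrices. A
  differential equation holds almost everywhere in the weak sense iff its right-hand side is a weak
  derivative of the left-hand variable, as weak derivatives are determined up to null sets.
\<close>

definition lti_solution ::
  "real mat \<Rightarrow> real mat \<Rightarrow> real mat \<Rightarrow> real mat \<Rightarrow> real mat \<Rightarrow>
   (real \<Rightarrow> real vec) \<Rightarrow> (real \<Rightarrow> real vec) \<Rightarrow> (real \<Rightarrow> real vec) \<Rightarrow> (real \<Rightarrow> real vec) \<Rightarrow> bool" where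
  "lti_solution A B C D K x u y z \<longleftrightarrow>
     x \<in> L1_loc (dim_row A) \<and> u \<in> L1_loc (dim_col B) \<and>
     y \<in> L1_loc (dim_row C) \<and> z \<in> L1_loc (dim_row K) \<and>
     has_weak_deriv (dim_row A) x (\<lambda>t. A *\<^sub>v x t + B *\<^sub>v u t) \<and>
     (AE t in lebesgue. y t = C *\<^sub>v x t + D *\<^sub>v u t) \<and>
     (AE t in lebesgue. z t = K *\<^sub>v x t)"

definition partially_detectable ::
  "real mat \<Rightarrow> real mat \<Rightarrow> real mat \<Rightarrow> real mat \<Rightarrow> real mat \<Rightarrow> bool" where
  "partially_detectable A B C D K \<longleftrightarrow>
     (\<forall>x1 x2 u y z1 z2. lti_solution A B C D K x1 u y z1 \<longrightarrow> lti_solution A B C D K x2 u y z2 \<longrightarrow>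
        ess_tendsto_zero (\<lambda>t. z1 t - z2 t))"

text \<open>\<open>stack_mats l k M\<close> is \<open>[M\<^sub>0\<^sup>T \<dots> M\<^sub>l\<^sub>-\<^sub>1\<^sup>T]\<^sup>T\<close> for matrices with \<open>k\<close> columns.\<close>

definition stack_mats :: "nat \<Rightarrow> nat \<Rightarrow> (nat \<Rightarrow> real mat) \<Rightarrow> real mat" where
  "stack_mats l k M = mat_of_rows k (concat (map (\<lambda>i. rows (M i)) [0..<l]))"

definition jointly_partially_detectable ::
  "nat \<Rightarrow> real mat \<Rightarrow> real mat \<Rightarrow> (nat \<Rightarrow> real mat) \<Rightarrow> (nat \<Rightarrow> real mat) \<Rightarrow> real mat \<Rightarrow> bool" where
  "jointly_partially_detectable l A B C D K \<longleftrightarrow>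
     partially_detectable A B (stack_mats l (dim_row A) C) (stack_mats l (dim_col B) D) K"


section \<open>Communication graph\<close>

text \<open>\<open>\<Gamma> $$ (i, j) = 1\<close> means that node \<open>j\<close> sends to node \<open>i\<close>, so the arc runs from \<open>j\<close> to \<open>i\<close>.\<close>

definition comm_graph :: "nat \<Rightarrow> real mat \<Rightarrow> (nat, nat \<times> nat) pre_digraph" where
  "comm_graph l \<Gamma> = \<lparr>verts = {..<l}, arcs = {(j, i). j < l \<and> i < l \<and> \<Gamma> $$ (i, j) = 1},
     tail = fst, head = snd\<rparr>"

definition balanced_graph :: "nat \<Rightarrow> real mat \<Rightarrow> bool" where
  "balanced_graph l \<Gamma> \<longleftrightarrow> (\<forall>i<l. (\<Sum>j<l. \<Gamma> $$ (i, j)) = (\<Sum>j<l. \<Gamma> $$ (j, i)))"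


section \<open>Distributed system and estimator\<close>

text \<open>The stacked signals \<open>y\<close>, \<open>w\<close> and \<open>zh\<close> are kept as families indexed by the node.\<close>

definition distributed_solution ::
  "nat \<Rightarrow> real mat \<Rightarrow> real mat \<Rightarrow> (nat \<Rightarrow> real mat) \<Rightarrow> (nat \<Rightarrow> real mat) \<Rightarrow> real mat \<Rightarrow>
   (real \<Rightarrow> real vec) \<Rightarrow> (real \<Rightarrow> real vec) \<Rightarrow> (nat \<Rightarrow> real \<Rightarrow> real vec) \<Rightarrow> (real \<Rightarrow> real vec) \<Rightarrow> bool" where
  "distributed_solution l A B C D K x u y z \<longleftrightarrow>
     x \<in> L1_loc (dim_row A) \<and> u \<in> L1_loc (dim_col B) \<and>
     (\<forall>i<l. y i \<in> L1_loc (dim_row (C i))) \<and> z \<in> L1_loc (dim_row K) \<and>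
     has_weak_deriv (dim_row A) x (\<lambda>t. A *\<^sub>v x t + B *\<^sub>v u t) \<and>
     (\<forall>i<l. AE t in lebesgue. y i t = C i *\<^sub>v x t + D i *\<^sub>v u t) \<and>
     (AE t in lebesgue. z t = K *\<^sub>v x t)"

text \<open>
  The coupling term is written componentwise: \<open>w\<^sub>j\<close> and \<open>w\<^sub>i\<close> need to have the same dimension only
  where \<open>\<gamma>\<^sub>i\<^sub>j = 1\<close>; the other summands are zero whatever the value of \<open>w\<^sub>j\<close>.
\<close>

definition coupling ::
  "nat \<Rightarrow> real mat \<Rightarrow> (nat \<Rightarrow> nat) \<Rightarrow> (nat \<Rightarrow> real \<Rightarrow> real vec) \<Rightarrow> nat \<Rightarrow> real \<Rightarrow> real vec" where
  "coupling l \<Gamma> ls w i t = vec (ls i) (\<lambda>k. \<Sum>j<l. \<Gamma> $$ (i, j) * (w j t $ k - w i t $ k))"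

definition estimator_solution ::
  "nat \<Rightarrow> real mat \<Rightarrow> real \<Rightarrow> (nat \<Rightarrow> nat) \<Rightarrow> (nat \<Rightarrow> real mat) \<Rightarrow> (nat \<Rightarrow> real mat) \<Rightarrow>
   (nat \<Rightarrow> real mat) \<Rightarrow> (nat \<Rightarrow> real mat) \<Rightarrow> (nat \<Rightarrow> real mat) \<Rightarrow>
   (nat \<Rightarrow> real \<Rightarrow> real vec) \<Rightarrow> (real \<Rightarrow> real vec) \<Rightarrow> (nat \<Rightarrow> real \<Rightarrow> real vec) \<Rightarrow>
   (nat \<Rightarrow> real \<Rightarrow> real vec) \<Rightarrow> bool" where
  "estimator_solution l \<Gamma> g ls N H L M R w u y zh \<longleftrightarrow>
     (\<forall>i<l. w i \<in> L1_loc (ls i) \<and> u \<in> L1_loc (dim_col (H i)) \<and>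
        y i \<in> L1_loc (dim_col (L i)) \<and> zh i \<in> L1_loc (dim_row (R i)) \<and>
        has_weak_deriv (ls i) (w i)
          (\<lambda>t. N i *\<^sub>v w i t + H i *\<^sub>v u t + L i *\<^sub>v y i t + g \<cdot>\<^sub>v (M i *\<^sub>v coupling l \<Gamma> ls w i t)) \<and>
        (AE t in lebesgue. zh i t = R i *\<^sub>v w i t))"

definition achieves_omniscience ::
  "nat \<Rightarrow> real mat \<Rightarrow> real mat \<Rightarrow> (nat \<Rightarrow> real mat) \<Rightarrow> (nat \<Rightarrow> real mat) \<Rightarrow> real mat \<Rightarrow> real mat \<Rightarrow>
   real \<Rightarrow> (nat \<Rightarrow> nat) \<Rightarrow> (nat \<Rightarrow> real mat) \<Rightarrow> (nat \<Rightarrow> real mat) \<Rightarrow> (nat \<Rightarrow> real mat) \<Rightarrow>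
   (nat \<Rightarrow> real mat) \<Rightarrow> (nat \<Rightarrow> real mat) \<Rightarrow> bool" where
  "achieves_omniscience l A B C D K \<Gamma> g ls N H L M R \<longleftrightarrow>
     (\<forall>x u y z w zh. distributed_solution l A B C D K x u y z \<longrightarrow>
        estimator_solution l \<Gamma> g ls N H L M R w u y zh \<longrightarrow>
        (\<forall>i<l. ess_tendsto_zero (\<lambda>t. zh i t - z t)))"

end

theory Submission
  imports Defs "HOL-Library.Function_Algebras" "HOL-Real_Asymp.Real_Asymp"
begin

text \<open>
  Every node runs a copy of the plant with output injection and plain diffusive coupling, so that
  \<open>l\<^sub>i = n\<close>, \<open>M\<^sub>i = I\<close>, \<open>R\<^sub>i = K\<close>, \<open>N\<^sub>i = A - L\<^sub>i C\<^sub>i\<close> and \<open>H\<^sub>i = B - L\<^sub>i D\<^sub>i\<close>. Partial detectability yields a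
  positive semidefinite form \<open>X\<close> with \<open>2 X(x, A x) \<le> -\<epsilon> X(x, x) + \<kappa> |C x|\<^sup>2\<close> that dominates both
  \<open>|C x|\<^sup>2\<close> and \<open>|K x|\<^sup>2\<close>; the gains solve \<open>X L\<^sub>i = \<kappa> l C\<^sub>i\<^sup>T\<close>. For the errors \<open>e\<^sub>i = w\<^sub>i - x\<close> the function
  \<open>V = \<Sum>\<^sub>i X(e\<^sub>i, e\<^sub>i)\<close> satisfies \<open>V' \<le> -\<epsilon> V\<close>: balancedness turns the coupling into
  \<open>-\<gamma> \<Sum>\<^sub>i\<^sub>j \<gamma>\<^sub>i\<^sub>j X(e\<^sub>i - e\<^sub>j, e\<^sub>i - e\<^sub>j)\<close>, which by connectivity and for large \<open>\<gamma>\<close> absorbs the disagreement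
  made when the local injections \<open>|C\<^sub>i e\<^sub>i|\<^sup>2\<close> are compared with the full ones \<open>|C e\<^sub>i|\<^sup>2\<close>. As \<open>X\<close> may be
  degenerate, the errors themselves need not converge, only the \<open>K e\<^sub>i\<close>.

  The form \<open>X\<close> is the sum of a Gramian of the backward, exponentially damped flow for \<open>C\<close>, whose
  kernel is the unobservable subspace, and a long-horizon Gramian for \<open>K\<close>, which decreases on that
  subspace. Weak solutions reduce to classical ones by mollification. For the converse, the
  difference of two plant solutions with the same input and output is compared with the zero
  solution of the estimator.
\<close>

text \<open>Detectability only says that \<open>K x\<close> tends to 0 along trajectories with zero
  output, without a rate and without a claim on \<open>x\<close> itself, whereas the network needs a
  strict quadratic decrease. Finite dimension supplies the uniformity: on the unobservable subspace
  the Gramian for \<open>K\<close> tends to 0 along the flow of finitely many vectors, hence in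
  trace, so a single horizon reduces it to a small fraction. Off that subspace the flow may enlarge
  this Gramian; the growth is paid for by a large multiple of the Gramian for \<open>C\<close>,
  whose Lyapunov inequality holds for every \<open>A\<close>, since backward damped flow produces
  \<open>- P + |C x|^2\<close> up to a boundary term of the right sign. Subspaces occur as kernels
  of semidefinite forms: a form that vanishes on the kernel of another is bounded by a multiple of
  it. This takes the place of adapted coordinates, and the same kernel inclusion makes the equation
  for the gains solvable. The factor \<open>l\<close> in the gains arises because each of the
  \<open>l\<close> errors is measured against the outputs of all nodes, while a node injects only
  its own.\<close>

text \<open>
  As the dimension \<open>n\<close> is a term, vectors of \<open>\<real>\<^sup>n\<close> are modelled as functions \<^typ>\<open>nat \<Rightarrow> real\<close> of which
  only the entries below \<open>n\<close> matter.
\<close>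

instantiation "fun" :: (type, real_vector) real_vector
begin
definition "c *\<^sub>R f = (\<lambda>x. c *\<^sub>R f x)"
instance by standard (auto simp: scaleR_fun_def fun_eq_iff scaleR_add_right scaleR_add_left)
end
lemma scaleR_fun_apply [simp]: "(c *\<^sub>R f) x = c *\<^sub>R f x"
  by (simp add: scaleR_fun_def)

section \<open>Positive semidefinite forms\<close>

definition dot :: "nat \<Rightarrow> (nat \<Rightarrow> real) \<Rightarrow> (nat \<Rightarrow> real) \<Rightarrow> real" where
  "dot n x y = (\<Sum>i<n. x i * y i)"

definition unit_fun :: "nat \<Rightarrow> nat \<Rightarrow> real" where
  "unit_fun i = (\<lambda>j. if j = i then 1 else 0)"

definition agree :: "nat \<Rightarrow> (nat \<Rightarrow> real) \<Rightarrow> (nat \<Rightarrow> real) \<Rightarrow> bool" where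
  "agree n x y \<longleftrightarrow> (\<forall>i<n. x i = y i)"

text \<open>The last clause makes \<open>q\<close> a form on \<real>^n although its arguments are
  infinite sequences. Linearity and congruence in the second argument follow by symmetry.\<close>

definition psd_form :: "nat \<Rightarrow> ((nat \<Rightarrow> real) \<Rightarrow> (nat \<Rightarrow> real) \<Rightarrow> real) \<Rightarrow> bool" where
  "psd_form n q \<longleftrightarrow> (\<forall>y. linear (\<lambda>x. q x y)) \<and> (\<forall>x y. q x y = q y x) \<and> (\<forall>x. 0 \<le> q x x) \<and>
     (\<forall>x x' y. agree n x x' \<longrightarrow> q x y = q x' y)"

text \<open>Serves as a norm on semidefinite forms. It involves only diagonal entries, so
  convergence on the unit vectors already makes it tend to 0.\<close>

definition trace_form :: "nat \<Rightarrow> ((nat \<Rightarrow> real) \<Rightarrow> (nat \<Rightarrow> real) \<Rightarrow> real) \<Rightarrow> real" where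
  "trace_form n q = (\<Sum>i<n. q (unit_fun i) (unit_fun i))"

lemma sum_fun_apply: "(\<Sum>i\<in>S. f i) x = (\<Sum>i\<in>S. f i x)" for f :: "'a \<Rightarrow> 'b \<Rightarrow> real"
  by (induction S rule: infinite_finite_induct) auto

lemma dot_commute: "dot n x y = dot n y x"
  by (simp add: dot_def mult.commute)

lemma linear_dot: "linear (dot n x)"
  by (rule linearI) (simp_all add: dot_def algebra_simps sum.distrib sum_distrib_left)

lemma linear_dot_left: "linear (\<lambda>x. dot n x y)"
  using linear_dot by (simp add: dot_commute[of n _ y])

lemma dot_self_eq_0: "dot n x x = 0 \<longleftrightarrow> (\<forall>i<n. x i = 0)"
  by (auto simp: dot_def sum_nonneg_eq_0_iff)

lemma dot_self_nonneg: "0 \<le> dot n x x"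
  by (simp add: dot_def sum_nonneg)

lemma agree_unit_sum: "agree n x (\<Sum>i<n. x i *\<^sub>R unit_fun i)"
  by (auto simp: agree_def sum_fun_apply unit_fun_def if_distrib cong: if_cong)

lemma dot_unit: "i < n \<Longrightarrow> dot n (unit_fun i) x = x i"
  by (simp add: dot_def unit_fun_def if_distrib[where f="\<lambda>t. t * _"] cong: if_cong)

lemma psd_formI:
  assumes "\<And>y. linear (\<lambda>x. q x y)" "\<And>x y. q x y = q y x" "\<And>x. 0 \<le> q x x"
    "\<And>x x' y. agree n x x' \<Longrightarrow> q x y = q x' y"
  shows "psd_form n q"
  unfolding psd_form_def using assms by blast

context
  fixes n q assumes q: "psd_form n q"
begin

lemma psd_linear: "linear (\<lambda>x. q x y)"
  using q by (simp add: psd_form_def)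

lemma psd_commute: "q x y = q y x"
  using q by (simp add: psd_form_def)

lemma psd_nonneg: "0 \<le> q x x"
  using q by (simp add: psd_form_def)

lemma psd_cong: "agree n x x' \<Longrightarrow> q x y = q x' y"
  using q unfolding psd_form_def by blast

lemma psd_linear_right: "linear (q x)"
  using psd_linear[of x] by (subst (asm) psd_commute)

lemma psd_cong2: "agree n x x' \<Longrightarrow> agree n y y' \<Longrightarrow> q x y = q x' y'"
  by (metis psd_cong psd_commute)

lemma psd_add: "q (x + x') y = q x y + q x' y" "q y (x + x') = q y x + q y x'"
  using linear_add[OF psd_linear] linear_add[OF psd_linear_right] by auto

lemma psd_diff: "q (x - x') y = q x y - q x' y" "q y (x - x') = q y x - q y x'"
  using linear_diff[OF psd_linear] linear_diff[OF psd_linear_right] by auto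

lemma psd_scaleR: "q (c *\<^sub>R x) y = c * q x y" "q y (c *\<^sub>R x) = c * q y x"
  using linear_scale[OF psd_linear] linear_scale[OF psd_linear_right] by auto

lemma psd_zero: "q 0 y = 0" "q y 0 = 0"
  using linear_0[OF psd_linear] linear_0[OF psd_linear_right] by auto

lemma psd_expand: "q x y = (\<Sum>i<n. x i * q (unit_fun i) y)"
proof -
  have "q x y = q (\<Sum>i<n. x i *\<^sub>R unit_fun i) y"
    by (rule psd_cong[OF agree_unit_sum])
  also have "\<dots> = (\<Sum>i<n. q (x i *\<^sub>R unit_fun i) y)"
    by (rule linear_sum[OF psd_linear])
  finally show ?thesis by (simp add: psd_scaleR)
qed

text \<open>The discriminant argument for a possibly degenerate form: if \<open>q y y = 0\<close>,
  the quadratic in \<open>t\<close> is affine and nonnegative, so its slope vanishes.\<close>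

lemma psd_Cauchy_Schwarz: "(q x y)\<^sup>2 \<le> q x x * q y y"
proof -
  have *: "0 \<le> q x x + 2 * t * q x y + t\<^sup>2 * q y y" for t
  proof -
    have "q (x + t *\<^sub>R y) (x + t *\<^sub>R y) = q x x + 2 * t * q x y + t\<^sup>2 * q y y"
      by (simp add: psd_add psd_scaleR psd_commute[of y x] algebra_simps power2_eq_square)
    then show ?thesis using psd_nonneg[of "x + t *\<^sub>R y"] by simp
  qed
  show ?thesis
  proof (cases "q y y = 0")
    case True
    have "q x y = 0"
    proof (rule ccontr)
      assume "q x y \<noteq> 0"
      then show False
        using *[of "- (q x x + 1) / (2 * q x y)"] True by (simp add: field_simps)
    qed
    then show ?thesis using True by simp
  next
    case False
    then have pos: "q y y > 0" using psd_nonneg[of y] by simp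
    have "0 \<le> q x x - (q x y)\<^sup>2 / q y y"
      using *[of "- q x y / q y y"] False by (simp add: field_simps power2_eq_square)
    then show ?thesis using pos by (simp add: field_simps)
  qed
qed

text \<open>Isotropic vectors lie in the radical, so \<open>q x x = 0\<close> describes a
  subspace.\<close>

lemma psd_ker: "q x x = 0 \<Longrightarrow> q x y = 0"
  using psd_Cauchy_Schwarz[of x y] by simp

lemma psd_ker_add: "q z z = 0 \<Longrightarrow> q (x + z) (x + z) = q x x"
  using psd_ker[of z x] psd_commute[of x z] by (simp add: psd_add)

lemma psd_parallelogram: "q (x + y) (x + y) + q (x - y) (x - y) = 2 * q x x + 2 * q y y"
  by (simp add: psd_add psd_diff)

lemma psd_add_le: "q (x + y) (x + y) \<le> 2 * q x x + 2 * q y y"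
  using psd_parallelogram[of x y] psd_nonneg[of "x - y"] by simp

lemma psd_diff_commute: "q (x - y) (x - y) = q (y - x) (y - x)"
  by (simp add: psd_diff)

lemma trace_form_nonneg: "0 \<le> trace_form n q"
  by (simp add: trace_form_def sum_nonneg psd_nonneg)

lemma psd_rows_le: "(\<Sum>i<n. (q (unit_fun i) x)\<^sup>2) \<le> trace_form n q * q x x"
  unfolding trace_form_def sum_distrib_right by (rule sum_mono) (rule psd_Cauchy_Schwarz)

text \<open>Cauchy-Schwarz for the coordinate expansion, and again for each row, leaves
  \<open>q x x\<close> on both sides; one factor is cancelled.\<close>

lemma psd_le_trace: "q x x \<le> trace_form n q * dot n x x"
proof -
  have "(q x x)\<^sup>2 \<le> (\<Sum>i<n. (x i)\<^sup>2) * (\<Sum>i<n. (q (unit_fun i) x)\<^sup>2)"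
    by (subst psd_expand) (rule Cauchy_Schwarz_ineq_sum)
  also have "\<dots> \<le> dot n x x * (trace_form n q * q x x)"
    by (intro mult_mono psd_rows_le sum_nonneg dot_self_nonneg)
       (auto simp: dot_def power2_eq_square)
  finally have "q x x * q x x \<le> (trace_form n q * dot n x x) * q x x"
    by (simp add: power2_eq_square algebra_simps)
  then show ?thesis
    using psd_nonneg[of x] mult_nonneg_nonneg[OF trace_form_nonneg dot_self_nonneg[of n x]]
    by (cases "q x x = 0") auto
qed

end

lemma psd_form_add:
  assumes "psd_form n q" "psd_form n q'"
  shows "psd_form n (\<lambda>x y. q x y + q' x y)"
  using assms unfolding psd_form_def by (auto intro: linear_compose_add)

lemma psd_form_scale:
  assumes "psd_form n q" "0 \<le> c"
  shows "psd_form n (\<lambda>x y. c * q x y)"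
proof -
  have "linear (\<lambda>x. c * q x y)" for y
    using linear_compose_scale_right[OF psd_linear[OF assms(1)], of c y] by simp
  moreover have "agree n x x' \<Longrightarrow> c * q x y = c * q x' y" for x x' y
    using psd_cong[OF assms(1)] by metis
  ultimately show ?thesis
    by (intro psd_formI) (simp_all add: psd_commute[OF assms(1)] psd_nonneg[OF assms(1)] assms(2))
qed

lemma psd_form_sum:
  assumes "\<And>a. a \<in> S \<Longrightarrow> psd_form n (q a)"
  shows "psd_form n (\<lambda>x y. \<Sum>a\<in>S. q a x y)"
  using assms
proof (induction S rule: infinite_finite_induct)
  case (insert a S)
  then show ?case using psd_form_add[of n "q a" "\<lambda>x y. \<Sum>a\<in>S. q a x y"] by simp
qed (auto simp: psd_form_def intro: module_hom_zero linear_zero)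

lemma psd_form_square: "psd_form n (\<lambda>x y. dot n c x * dot n c y)"
proof -
  have "linear (\<lambda>x. dot n c x * dot n c y)" for y
    by (rule linearI) (simp_all add: linear_add[OF linear_dot] linear_scale[OF linear_dot] algebra_simps)
  then show ?thesis unfolding psd_form_def
    by (auto simp: agree_def dot_def)
qed

lemma psd_form_pullback:
  assumes "psd_form n q" "linear f" "\<And>x y. agree n x y \<Longrightarrow> agree n (f x) (f y)"
  shows "psd_form n (\<lambda>x y. q (f x) (f y))"
proof -
  have "linear (\<lambda>x. q (f x) z)" for z
    using linear_compose[OF assms(2) psd_linear[OF assms(1), of z]] by (simp add: o_def)
  then show ?thesis
    using assms(1,3) unfolding psd_form_def by blast
qed

text \<open>A functional that vanishes on the common kernel of finitely many functionals is a
  combination of them. This duality is what solves linear systems below, both for the projection and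
  for the gains.\<close>

lemma dual_span:
  assumes "finite J" "\<And>x. (\<forall>j\<in>J. dot n (f j) x = 0) \<Longrightarrow> dot n g x = 0"
  shows "\<exists>c. \<forall>i<n. g i = (\<Sum>j\<in>J. c j * f j i)"
  using assms
proof (induction J arbitrary: g rule: finite_induct)
  case empty
  then have "g i = 0" if "i < n" for i
    using empty[of "unit_fun i"] dot_unit[OF that] by (simp add: dot_commute)
  then show ?case by simp
next
  case (insert k J)
  show ?case
  proof (cases "\<forall>x. (\<forall>j\<in>J. dot n (f j) x = 0) \<longrightarrow> dot n (f k) x = 0")
    case True
    then obtain c where c: "\<forall>i<n. g i = (\<Sum>j\<in>J. c j * f j i)"
      using insert.IH[of g] insert.prems by auto
    show ?thesis using insert.hyps c
      by (intro exI[of _ "c(k := 0)"]) (auto intro!: sum.cong)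
  next
    case False
    then obtain x where x: "\<forall>j\<in>J. dot n (f j) x = 0" "dot n (f k) x \<noteq> 0" by blast
    \<comment> \<open>The coefficient of \<open>f k\<close> is forced: at \<open>x\<close> all other
      functionals vanish.\<close>
    define a where "a = dot n g x / dot n (f k) x"
    have "dot n (g - a *\<^sub>R f k) y = 0" if y: "\<forall>j\<in>J. dot n (f j) y = 0" for y
    proof -
      \<comment> \<open>Moving \<open>y\<close> along \<open>x\<close> annihilates
        \<open>f k\<close> without disturbing the functionals in \<open>J\<close>.\<close>
      define z where "z = y - (dot n (f k) y / dot n (f k) x) *\<^sub>R x"
      have z: "dot n h z = dot n h y - dot n (f k) y / dot n (f k) x * dot n h x" for h
        unfolding z_def linear_diff[OF linear_dot] linear_scale[OF linear_dot] by simp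
      have "\<forall>j\<in>insert k J. dot n (f j) z = 0"
        using x y by (simp add: z)
      then have "dot n g z = 0" by (rule insert.prems)
      moreover have "dot n (g - a *\<^sub>R f k) y = dot n g y - a * dot n (f k) y"
        unfolding linear_diff[OF linear_dot_left] linear_scale[OF linear_dot_left] by simp
      ultimately show ?thesis using z[of g] by (simp add: a_def)
    qed
    then obtain c where c: "\<forall>i<n. (g - a *\<^sub>R f k) i = (\<Sum>j\<in>J. c j * f j i)"
      using insert.IH by blast
    have "(\<Sum>j\<in>J. (c(k := a)) j * f j i) = (\<Sum>j\<in>J. c j * f j i)" for i
      using insert.hyps by (intro sum.cong) auto
    then show ?thesis using insert.hyps c
      by (intro exI[of _ "c(k := a)"]) (simp add: algebra_simps)
  qed
qed

text \<open>
  With \<open>G\<close> the matrix of \<open>q\<close>, \<open>ker G\<^sup>2 = ker G\<close> gives \<open>G = \<Lambda> G\<^sup>2\<close> for some \<open>\<Lambda>\<close>; then \<open>E = \<Lambda> G\<close> is the orthogonal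
  projection onto the range of \<open>G\<close>.
\<close>

lemma ker_projection:
  assumes q: "psd_form n q"
  shows "\<exists>E c. linear E \<and> (\<forall>x y. agree n x y \<longrightarrow> agree n (E x) (E y)) \<and>
    (\<forall>x. q (x - E x) (x - E x) = 0) \<and> 0 \<le> c \<and> (\<forall>x. dot n (E x) (E x) \<le> c * q x x)"
proof -
  define G where "G x = (\<lambda>i. q (unit_fun i) x)" for x
  have dotG: "dot n (G x) y = q y x" for x y
    by (subst psd_expand[OF q]) (simp add: dot_def G_def mult.commute)
  have GG: "q x (G y) = dot n (G x) (G y)" for x y
    by (simp add: dotG psd_commute[OF q, of x])
  have "\<exists>c. \<forall>j<n. q (unit_fun k) (unit_fun j) = (\<Sum>i<n. c i * q (unit_fun i) (G (unit_fun j)))" for k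
  proof (rule dual_span[where f = "\<lambda>i j. q (unit_fun i) (G (unit_fun j))"])
    fix x assume *: "\<forall>i\<in>{..<n}. dot n (\<lambda>j. q (unit_fun i) (G (unit_fun j))) x = 0"
    have "dot n (\<lambda>j. q (unit_fun i) (G (unit_fun j))) x = q (unit_fun i) (G x)" for i
    proof -
      have "q (unit_fun i) (G x) = q x (G (unit_fun i))"
        unfolding GG by (rule dot_commute)
      also have "\<dots> = (\<Sum>j<n. x j * q (unit_fun j) (G (unit_fun i)))"
        by (rule psd_expand[OF q])
      also have "\<dots> = (\<Sum>j<n. x j * q (unit_fun i) (G (unit_fun j)))"
        unfolding GG by (subst dot_commute) (rule refl)
      finally show ?thesis by (simp add: dot_def mult.commute)
    qed
    with * have "q (unit_fun i) (G x) = 0" if "i < n" for i using that by simp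
    then have "q x (G x) = 0" by (subst psd_expand[OF q]) simp
    then have "dot n (G x) (G x) = 0" by (simp add: GG)
    then have Gx: "\<forall>i<n. G x i = 0" by (simp add: dot_self_eq_0)
    have "dot n (\<lambda>j. q (unit_fun k) (unit_fun j)) x = q x (unit_fun k)"
      by (subst psd_expand[OF q]) (simp add: dot_def psd_commute[OF q, of _ "unit_fun k"] mult.commute)
    also have "\<dots> = dot n (G x) (unit_fun k)" by (simp add: dotG psd_commute[OF q, of x])
    also have "\<dots> = 0" using Gx by (simp add: dot_def)
    finally show "dot n (\<lambda>j. q (unit_fun k) (unit_fun j)) x = 0" .
  qed simp
  then obtain \<Lambda> where \<Lambda>: "\<And>k j. j < n \<Longrightarrow>
      q (unit_fun k) (unit_fun j) = (\<Sum>i<n. \<Lambda> k i * q (unit_fun i) (G (unit_fun j)))"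
    by metis
  define E where "E x = (\<lambda>k. \<Sum>i<n. \<Lambda> k i * G x i)" for x
  define T where "T y = (\<lambda>i. \<Sum>k<n. \<Lambda> k i * y k)" for y
  have linG: "linear G"
    by (rule linearI) (auto simp: G_def fun_eq_iff psd_add[OF q] psd_scaleR[OF q])
  have linE: "linear E"
    by (rule linearI) (auto simp: E_def fun_eq_iff linear_add[OF linG] linear_scale[OF linG]
        algebra_simps sum.distrib sum_distrib_left)
  have agreeG: "agree n x y \<Longrightarrow> G x = G y" for x y
    unfolding G_def by (rule ext, rule psd_cong2[OF q]) (simp_all add: agree_def)
  have GGsum: "q (unit_fun i) (G y) = (\<Sum>j<n. y j * q (unit_fun i) (G (unit_fun j)))" for i y
  proof -
    have "G y = G (\<Sum>j<n. y j *\<^sub>R unit_fun j)" by (rule agreeG[OF agree_unit_sum])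
    also have "\<dots> = (\<Sum>j<n. y j *\<^sub>R G (unit_fun j))"
      by (simp add: linear_sum[OF linG] linear_scale[OF linG])
    finally have "q (unit_fun i) (G y) = q (unit_fun i) (\<Sum>j<n. y j *\<^sub>R G (unit_fun j))" by simp
    also have "\<dots> = (\<Sum>j<n. y j * q (unit_fun i) (G (unit_fun j)))"
      by (simp add: linear_sum[OF psd_linear_right[OF q]] psd_scaleR[OF q])
    finally show ?thesis .
  qed
  have EG: "E (G y) k = G y k" for y k
  proof -
    have "G y k = (\<Sum>j<n. y j * q (unit_fun k) (unit_fun j))"
      unfolding G_def by (subst psd_commute[OF q], subst psd_expand[OF q]) (simp add: psd_commute[OF q, of _ "unit_fun k"])
    also have "\<dots> = (\<Sum>j<n. \<Sum>i<n. \<Lambda> k i * (y j * q (unit_fun i) (G (unit_fun j))))"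
      by (simp add: \<Lambda> sum_distrib_left algebra_simps)
    also have "\<dots> = (\<Sum>i<n. \<Lambda> k i * q (unit_fun i) (G y))"
      by (subst sum.swap) (simp add: GGsum[of _ y] sum_distrib_left)
    finally show ?thesis by (simp add: E_def G_def)
  qed
  have dotE: "dot n (E x) y = dot n (G x) (T y)" for x y
    unfolding dot_def E_def T_def sum_distrib_left sum_distrib_right
    by (subst sum.swap) (simp add: algebra_simps)
  \<comment> \<open>The right-hand side is symmetric in \<open>x\<close> and \<open>y\<close>, so
    \<open>E\<close> is self-adjoint; it arises by inserting \<open>E G = G\<close> between two uses
    of the transpose \<open>T\<close> of \<Lambda>.\<close>
  have "dot n (E x) y = dot n (G (T x)) (G (T y))" for x y
  proof -
    have "dot n (E x) y = dot n (G (T y)) x"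
      unfolding dotE dotG by (rule psd_commute[OF q])
    also have "\<dots> = dot n (E (G (T y))) x" using EG by (simp add: dot_def)
    also have "\<dots> = dot n (G (G (T y))) (T x)" by (rule dotE)
    also have "\<dots> = dot n (G (T x)) (G (T y))"
      by (simp add: dotG GG psd_commute[OF q, of "T x"] dot_commute[of n "G (T y)"])
    finally show ?thesis .
  qed
  then have Esym: "dot n (E x) y = dot n (E y) x" for x y
    by (simp add: dot_commute[of n "G (T x)"])
  have "q z (x - E x) = 0" for x z
  proof -
    have "q z (E x) = dot n (E x) (G z)" by (simp add: dotG psd_commute[OF q, of z] dot_commute[of n "E x"])
    also have "\<dots> = dot n (E (G z)) x" by (rule Esym)
    also have "\<dots> = dot n (G z) x" using EG by (simp add: dot_def)
    also have "\<dots> = q z x" by (simp add: dotG psd_commute[OF q, of z])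
    finally show ?thesis by (simp add: psd_diff[OF q])
  qed
  \<comment> \<open>The squared Frobenius norm of \<Lambda> bounds \<open>E x\<close> by
    \<open>G x\<close>, and the trace bounds \<open>G x\<close> by \<open>q x x\<close>.\<close>
  moreover define c where "c = (\<Sum>k<n. \<Sum>i<n. (\<Lambda> k i)\<^sup>2) * trace_form n q"
  have "dot n (E x) (E x) \<le> c * q x x" for x
  proof -
    have "dot n (E x) (E x) = (\<Sum>k<n. (\<Sum>i<n. \<Lambda> k i * G x i)\<^sup>2)"
      by (simp add: dot_def E_def power2_eq_square)
    also have "\<dots> \<le> (\<Sum>k<n. (\<Sum>i<n. (\<Lambda> k i)\<^sup>2) * (\<Sum>i<n. (G x i)\<^sup>2))"
      by (intro sum_mono Cauchy_Schwarz_ineq_sum)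
    also have "\<dots> \<le> (\<Sum>k<n. (\<Sum>i<n. (\<Lambda> k i)\<^sup>2) * (trace_form n q * q x x))"
      using psd_rows_le[OF q] by (intro sum_mono mult_left_mono sum_nonneg) (auto simp: G_def)
    also have "\<dots> = c * q x x" by (simp only: c_def sum_distrib_right mult.assoc)
    finally show ?thesis .
  qed
  moreover have "0 \<le> c" by (auto simp: c_def intro!: mult_nonneg_nonneg sum_nonneg trace_form_nonneg[OF q])
  moreover have "agree n x y \<Longrightarrow> agree n (E x) (E y)" for x y
    using agreeG[of x y] by (simp add: E_def agree_def)
  ultimately show ?thesis using linE by blast
qed

text \<open>Modulo the kernel of \<open>q\<close> one may replace \<open>x\<close> by
  \<open>E x\<close>, whose length \<open>q\<close> controls. The constant is chosen before
  \<open>f\<close>, so forms with trace tending to 0 are eventually below any small multiple of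
  \<open>q\<close>.\<close>

lemma psd_dominate:
  assumes q: "psd_form n q"
  shows "\<exists>c\<ge>0. \<forall>f. psd_form n f \<longrightarrow> (\<forall>x. q x x = 0 \<longrightarrow> f x x = 0) \<longrightarrow>
    (\<forall>x. f x x \<le> c * trace_form n f * q x x)"
proof -
  obtain E c where E: "\<And>x. q (x - E x) (x - E x) = 0" "0 \<le> c" "\<And>x. dot n (E x) (E x) \<le> c * q x x"
    using ker_projection[OF q] by blast
  have "f x x \<le> c * trace_form n f * q x x"
    if f: "psd_form n f" and ker: "\<forall>x. q x x = 0 \<longrightarrow> f x x = 0" for f x
  proof -
    have "f (E x + (x - E x)) (E x + (x - E x)) = f (E x) (E x)"
      using E(1) ker by (intro psd_ker_add[OF f]) auto
    then have "f x x = f (E x) (E x)" by simp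
    also have "\<dots> \<le> trace_form n f * dot n (E x) (E x)" by (rule psd_le_trace[OF f])
    also have "\<dots> \<le> trace_form n f * (c * q x x)"
      by (rule mult_left_mono[OF E(3) trace_form_nonneg[OF f]])
    finally show ?thesis by (simp add: algebra_simps)
  qed
  then show ?thesis using E(2) by blast
qed

section \<open>The flow of a linear system and its Gramians\<close>

text \<open>The value 0 from index \<open>n\<close> on makes arguments that agree below
  \<open>n\<close> have equal images, not merely agreeing ones.\<close>

definition mat_act :: "nat \<Rightarrow> (nat \<Rightarrow> nat \<Rightarrow> real) \<Rightarrow> (nat \<Rightarrow> real) \<Rightarrow> nat \<Rightarrow> real" where
  "mat_act n a x = (\<lambda>i. if i < n then \<Sum>j<n. a i j * x j else 0)"

text \<open>The matrix exponential applied to \<open>x\<close>. Entries from index \<open>n\<close>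
  on stay constant, because only the term with \<open>k = 0\<close> survives there.\<close>

definition flow :: "nat \<Rightarrow> (nat \<Rightarrow> nat \<Rightarrow> real) \<Rightarrow> real \<Rightarrow> (nat \<Rightarrow> real) \<Rightarrow> nat \<Rightarrow> real" where
  "flow n a t x = (\<lambda>i. \<Sum>k. (mat_act n a ^^ k) x i / fact k * t ^ k)"

lemma linear_mat_act: "linear (mat_act n a)"
  by (rule linearI) (auto simp: mat_act_def fun_eq_iff algebra_simps sum.distrib sum_distrib_left)

lemma linear_mat_act_pow: "linear (mat_act n a ^^ k)"
proof (induction k)
  case 0
  show ?case by (simp add: linear_id[unfolded id_def] id_def)
next
  case (Suc k)
  show ?case using linear_compose[OF Suc linear_mat_act] by (simp only: funpow.simps)
qed

lemma mat_act_cong: "agree n x y \<Longrightarrow> mat_act n a x = mat_act n a y"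
  by (auto simp: mat_act_def agree_def)

lemma mat_act_pow_bound:
  "(\<Sum>i<n. \<bar>(mat_act n a ^^ k) x i\<bar>) \<le> (\<Sum>i<n. \<Sum>j<n. \<bar>a i j\<bar>) ^ k * (\<Sum>i<n. \<bar>x i\<bar>)"
proof (induction k)
  case (Suc k)
  let ?M = "\<Sum>i<n. \<Sum>j<n. \<bar>a i j\<bar>" and ?v = "(mat_act n a ^^ k) x"
  have "(\<Sum>i<n. \<bar>(mat_act n a ^^ Suc k) x i\<bar>) = (\<Sum>i<n. \<bar>\<Sum>j<n. a i j * ?v j\<bar>)"
    by (simp add: mat_act_def)
  also have "\<dots> \<le> (\<Sum>i<n. \<Sum>j<n. \<bar>a i j\<bar> * (\<Sum>j<n. \<bar>?v j\<bar>))"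
  proof (rule sum_mono)
    fix i
    have "\<bar>\<Sum>j<n. a i j * ?v j\<bar> \<le> (\<Sum>j<n. \<bar>a i j * ?v j\<bar>)" by (rule sum_abs)
    also have "\<dots> \<le> (\<Sum>j<n. \<bar>a i j\<bar> * (\<Sum>j<n. \<bar>?v j\<bar>))"
      unfolding abs_mult by (intro sum_mono mult_left_mono member_le_sum) auto
    finally show "\<bar>\<Sum>j<n. a i j * ?v j\<bar> \<le> (\<Sum>j<n. \<bar>a i j\<bar> * (\<Sum>j<n. \<bar>?v j\<bar>))" .
  qed
  also have "\<dots> = ?M * (\<Sum>j<n. \<bar>?v j\<bar>)" by (simp add: sum_distrib_right)
  also have "\<dots> \<le> ?M * (?M ^ k * (\<Sum>i<n. \<bar>x i\<bar>))"
    by (intro mult_left_mono Suc.IH sum_nonneg) auto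
  finally show ?case by (simp add: algebra_simps)
qed simp

lemma summable_flow: "summable (\<lambda>k. (mat_act n a ^^ k) x i / fact k * t ^ k)"
proof -
  \<comment> \<open>The extra \<open>\<bar>x i\<bar>\<close> in \<open>?C\<close> covers indices
    from \<open>n\<close> on, where the zeroth coefficient is not part of the sum over
    \<open>i < n\<close>.\<close>
  let ?M = "\<Sum>i<n. \<Sum>j<n. \<bar>a i j\<bar>" and ?C = "(\<Sum>i<n. \<bar>x i\<bar>) + \<bar>x i\<bar>"
  have M: "0 \<le> ?M" by (intro sum_nonneg) auto
  have b: "\<bar>(mat_act n a ^^ k) x i\<bar> \<le> ?C * ?M ^ k" for k
  proof (cases "i < n \<or> k = 0")
    case True
    show ?thesis
    proof (cases "i < n")
      case True
      then have "\<bar>(mat_act n a ^^ k) x i\<bar> \<le> (\<Sum>i<n. \<bar>(mat_act n a ^^ k) x i\<bar>)"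
        by (intro member_le_sum) auto
      also have "\<dots> \<le> ?M ^ k * (\<Sum>i<n. \<bar>x i\<bar>)" by (rule mat_act_pow_bound)
      also have "\<dots> \<le> ?M ^ k * ?C" using M by (intro mult_left_mono) auto
      finally show ?thesis by (simp add: mult.commute)
    next
      case False
      then show ?thesis using True sum_nonneg[of "{..<n}" "\<lambda>i. \<bar>x i\<bar>"] by auto
    qed
  next
    case False
    then obtain k' where "k = Suc k'" using not0_implies_Suc by blast
    then have "(mat_act n a ^^ k) x i = 0" using False by (simp add: mat_act_def)
    then show ?thesis using M by (auto intro!: mult_nonneg_nonneg add_nonneg_nonneg sum_nonneg)
  qed
  show ?thesis
  proof (rule summable_comparison_test'[OF summable_mult[OF summable_exp[of "?M * \<bar>t\<bar>"], of ?C]])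
    fix k
    show "norm ((mat_act n a ^^ k) x i / fact k * t ^ k) \<le> ?C * (inverse (fact k) * (?M * \<bar>t\<bar>) ^ k)"
      using mult_right_mono[OF b[of k], of "\<bar>t\<bar> ^ k / fact k"]
      by (simp add: abs_mult power_abs power_mult_distrib field_simps)
  qed
qed

lemma flow_sums: "(\<lambda>k. (mat_act n a ^^ k) x i / fact k * t ^ k) sums flow n a t x i"
  using summable_flow by (simp add: flow_def summable_sums)

lemma mat_act_flow_sums:
  "(\<lambda>k. (mat_act n a ^^ Suc k) x i / fact k * t ^ k) sums mat_act n a (flow n a t x) i"
proof (cases "i < n")
  case True
  have "(\<lambda>k. \<Sum>j<n. a i j * ((mat_act n a ^^ k) x j / fact k * t ^ k)) sums (\<Sum>j<n. a i j * flow n a t x j)"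
    by (intro sums_sum sums_mult flow_sums)
  moreover have "(mat_act n a ^^ Suc k) x i / fact k * t ^ k
      = (\<Sum>j<n. a i j * ((mat_act n a ^^ k) x j / fact k * t ^ k))" for k
  proof -
    have "(mat_act n a ^^ Suc k) x i = (\<Sum>j<n. a i j * (mat_act n a ^^ k) x j)"
      using True by (simp add: mat_act_def)
    then have "(mat_act n a ^^ Suc k) x i / fact k * t ^ k
        = (\<Sum>j<n. a i j * (mat_act n a ^^ k) x j / fact k * t ^ k)"
      by (simp only: sum_distrib_right sum_divide_distrib)
    then show ?thesis by (simp only: mult.assoc times_divide_eq_right times_divide_eq_left)
  qed
  ultimately show ?thesis using True by (simp only: mat_act_def if_True)
next
  case False
  then have "(mat_act n a ^^ Suc k) x i = 0" for k by (simp add: mat_act_def)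
  then show ?thesis using False by (simp only: mat_act_def if_False) simp
qed

lemma flow_mat_act: "flow n a t (mat_act n a x) = mat_act n a (flow n a t x)"
proof
  fix i
  have "flow n a t (mat_act n a x) i = (\<Sum>k. (mat_act n a ^^ Suc k) x i / fact k * t ^ k)"
    by (simp only: flow_def funpow_Suc_right o_apply)
  then show "flow n a t (mat_act n a x) i = mat_act n a (flow n a t x) i"
    using sums_unique[OF mat_act_flow_sums] by metis
qed

lemma flow_deriv: "((\<lambda>t. flow n a t x i) has_real_derivative mat_act n a (flow n a t x) i) (at t)"
proof -
  let ?c = "\<lambda>k. (mat_act n a ^^ k) x i / fact k"
  have "((\<lambda>t. \<Sum>k. ?c k * t ^ k) has_real_derivative (\<Sum>k. diffs ?c k * t ^ k)) (at t)"
    by (rule termdiffs_strong_converges_everywhere) (rule summable_flow)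
  moreover have "diffs ?c = (\<lambda>k. (mat_act n a ^^ Suc k) x i / fact k)"
    by (auto simp: diffs_def fun_eq_iff field_simps simp del: funpow.simps of_nat_Suc)
  ultimately show ?thesis
    using sums_unique[OF mat_act_flow_sums] unfolding flow_def by metis
qed

lemma flow_0: "flow n a 0 x = x"
proof
  show "flow n a 0 x i = x i" for i
    unfolding flow_def by (subst powser_zero) simp
qed

lemma linear_flow: "linear (flow n a t)"
proof (rule linearI)
  show "flow n a t (x + y) = flow n a t x + flow n a t y" for x y
  proof
    fix i
    have "(\<lambda>k. (mat_act n a ^^ k) x i / fact k * t ^ k + (mat_act n a ^^ k) y i / fact k * t ^ k)
        sums (flow n a t x i + flow n a t y i)"
      by (intro sums_add flow_sums)
    then have "(\<lambda>k. (mat_act n a ^^ k) (x + y) i / fact k * t ^ k) sums (flow n a t x i + flow n a t y i)"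
      by (simp add: linear_add[OF linear_mat_act_pow] algebra_simps add_divide_distrib)
    then show "flow n a t (x + y) i = (flow n a t x + flow n a t y) i"
      using sums_unique2[OF flow_sums] by simp
  qed
  show "flow n a t (c *\<^sub>R x) = c *\<^sub>R flow n a t x" for c x
  proof
    fix i
    have "(\<lambda>k. c * ((mat_act n a ^^ k) x i / fact k * t ^ k)) sums (c * flow n a t x i)"
      by (intro sums_mult flow_sums)
    then have "(\<lambda>k. (mat_act n a ^^ k) (c *\<^sub>R x) i / fact k * t ^ k) sums (c * flow n a t x i)"
      by (simp add: linear_scale[OF linear_mat_act_pow] algebra_simps)
    then show "flow n a t (c *\<^sub>R x) i = (c *\<^sub>R flow n a t x) i"
      using sums_unique2[OF flow_sums] by simp
  qed
qed

lemma flow_agree: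
  assumes "agree n x y"
  shows "agree n (flow n a t x) (flow n a t y)"
proof -
  have "(mat_act n a ^^ k) x i = (mat_act n a ^^ k) y i" if "i < n" for k i
  proof (cases k)
    case 0
    then show ?thesis using assms that by (simp add: agree_def)
  next
    case (Suc k')
    show ?thesis unfolding Suc funpow_Suc_right o_apply mat_act_cong[OF assms] ..
  qed
  then show ?thesis by (simp add: agree_def flow_def)
qed

lemma flow_expand:
  assumes "i < n"
  shows "flow n a t x i = (\<Sum>j<n. x j * flow n a t (unit_fun j) i)"
proof -
  have "flow n a t x i = flow n a t (\<Sum>j<n. x j *\<^sub>R unit_fun j) i"
    using flow_agree[OF agree_unit_sum] assms unfolding agree_def by blast
  then show ?thesis
    by (simp add: linear_sum[OF linear_flow] linear_scale[OF linear_flow] sum_fun_apply)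
qed

text \<open>Along a solution \<open>x\<close>, the curve \<open>s \<mapsto> flow (t - s) (x s)\<close> is constant.\<close>

lemma solution_eq_flow:
  assumes "\<And>t i. i < n \<Longrightarrow> ((\<lambda>t. x t i) has_real_derivative mat_act n a (x t) i) (at t)"
  shows "agree n (x t) (flow n a t (x 0))"
  unfolding agree_def
proof (intro allI impI)
  fix i assume i: "i < n"
  \<comment> \<open>Expansion in unit vectors turns the curve into a finite sum of products of real
    functions, so the product rule applies; the two halves of the derivative cancel since the flow
    commutes with \<open>mat_act\<close>.\<close>
  define h where "h s = (\<Sum>j<n. x s j * flow n a (t - s) (unit_fun j) i)" for s
  have h: "h s = flow n a (t - s) (x s) i" for s
    unfolding h_def by (rule flow_expand[OF i, symmetric])
  have "(h has_real_derivative 0) (at s)" for s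
  proof -
    have "((\<lambda>s. flow n a (t - s) (unit_fun j) i) has_real_derivative
        mat_act n a (flow n a (t - s) (unit_fun j)) i * (0 - 1)) (at s)" for j
      by (rule DERIV_chain2[OF flow_deriv]) (auto intro!: derivative_eq_intros)
    then have "(h has_real_derivative (\<Sum>j<n. mat_act n a (x s) j * flow n a (t - s) (unit_fun j) i
        + mat_act n a (flow n a (t - s) (unit_fun j)) i * (0 - 1) * x s j)) (at s)"
      unfolding h_def by (intro DERIV_sum DERIV_mult assms) auto
    moreover have "(\<Sum>j<n. mat_act n a (x s) j * flow n a (t - s) (unit_fun j) i
        + mat_act n a (flow n a (t - s) (unit_fun j)) i * (0 - 1) * x s j)
      = flow n a (t - s) (mat_act n a (x s)) i
        - (\<Sum>j<n. x s j * flow n a (t - s) (mat_act n a (unit_fun j)) i)"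
      by (subst flow_expand[OF i, of a "t - s" "mat_act n a (x s)"])
        (simp add: sum_subtractf flow_mat_act algebra_simps)
    moreover have "(\<Sum>j<n. x s j * flow n a (t - s) (mat_act n a (unit_fun j)) i)
      = flow n a (t - s) (mat_act n a (x s)) i"
    proof -
      have "mat_act n a (x s) = mat_act n a (\<Sum>j<n. x s j *\<^sub>R unit_fun j)"
        by (rule mat_act_cong[OF agree_unit_sum])
      then show ?thesis
        by (simp add: linear_sum[OF linear_mat_act] linear_scale[OF linear_mat_act]
            linear_sum[OF linear_flow] linear_scale[OF linear_flow] sum_fun_apply)
    qed
    ultimately show ?thesis by simp
  qed
  then have "h t = h 0" using DERIV_isconst_all by blast
  then show "x t i = flow n a t (x 0) i" by (simp add: h flow_0)
qed

text \<open>As a function of \<open>s\<close>, the left-hand side solves the system with value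
  \<open>flow n a t x\<close> at 0; uniqueness does the rest.\<close>

lemma flow_add: "agree n (flow n a (s + t) x) (flow n a s (flow n a t x))"
  using solution_eq_flow[of n "\<lambda>s. flow n a (s + t) x" a s] flow_deriv[THEN DERIV_shift[THEN iffD1]]
  by simp

lemma psd_deriv:
  assumes q: "psd_form n q"
    and "\<And>i. i < n \<Longrightarrow> ((\<lambda>s. X s i) has_real_derivative X' i) (at s)"
    and "\<And>i. i < n \<Longrightarrow> ((\<lambda>s. Y s i) has_real_derivative Y' i) (at s)"
  shows "((\<lambda>s. q (X s) (Y s)) has_real_derivative (q X' (Y s) + q (X s) Y')) (at s)"
proof -
  define M where "M i j = q (unit_fun j) (unit_fun i)" for i j
  have ex: "q x y = (\<Sum>i<n. \<Sum>j<n. x i * y j * M i j)" for x y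
  proof -
    have "q x y = (\<Sum>i<n. x i * q y (unit_fun i))"
      by (subst psd_expand[OF q]) (simp add: psd_commute[OF q, of y])
    also have "\<dots> = (\<Sum>i<n. x i * (\<Sum>j<n. y j * M i j))"
      unfolding M_def psd_expand[OF q, of y] by (rule refl)
    finally show ?thesis by (simp add: sum_distrib_left mult.assoc)
  qed
  have "((\<lambda>s. q (X s) (Y s)) has_real_derivative
    (\<Sum>i<n. \<Sum>j<n. (X' i * Y s j + Y' j * X s i) * M i j)) (at s)"
    unfolding ex by (intro DERIV_sum DERIV_cmult_right DERIV_mult assms) auto
  also have "(\<Sum>i<n. \<Sum>j<n. (X' i * Y s j + Y' j * X s i) * M i j) = q X' (Y s) + q (X s) Y'"
    unfolding ex by (simp add: algebra_simps sum.distrib)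
  finally show ?thesis .
qed

lemma flow_form_deriv:
  assumes "psd_form n q"
  shows "((\<lambda>s. q (flow n a s x) (flow n a s y)) has_real_derivative
    (q (flow n a s (mat_act n a x)) (flow n a s y) + q (flow n a s x) (flow n a s (mat_act n a y)))) (at s)"
  unfolding flow_mat_act by (rule psd_deriv[OF assms flow_deriv flow_deriv])

lemma flow_form_continuous:
  assumes "psd_form n q"
  shows "continuous_on S (\<lambda>s. q (flow n a s x) (flow n a s y))"
  using DERIV_isCont[OF flow_form_deriv[OF assms]] by (simp add: continuous_at_imp_continuous_on)

section \<open>Observability Gramians over a finite horizon\<close>

definition gramian :: "nat \<Rightarrow> (nat \<Rightarrow> nat \<Rightarrow> real) \<Rightarrow> real \<Rightarrow> ((nat \<Rightarrow> real) \<Rightarrow> (nat \<Rightarrow> real) \<Rightarrow> real) \<Rightarrow>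
    (nat \<Rightarrow> real) \<Rightarrow> (nat \<Rightarrow> real) \<Rightarrow> real" where
  "gramian n a T q x y = integral {0..T} (\<lambda>s. q (flow n a s x) (flow n a s y))"

lemma gramian_integrable:
  assumes "psd_form n q"
  shows "(\<lambda>s. q (flow n a s x) (flow n a s y)) integrable_on {0..T}"
  by (rule integrable_continuous_interval[OF flow_form_continuous[OF assms]])

lemma psd_form_gramian:
  assumes q: "psd_form n q"
  shows "psd_form n (gramian n a T q)"
proof -
  have "linear (\<lambda>x. gramian n a T q x y)" for y
    by (rule linearI)
      (simp_all add: gramian_def linear_add[OF linear_flow] linear_scale[OF linear_flow]
        psd_add[OF q] psd_scaleR[OF q] integral_add[OF gramian_integrable[OF q] gramian_integrable[OF q]])
  moreover have "gramian n a T q x y = gramian n a T q x' y" if "agree n x x'" for x x' y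
    using psd_cong[OF q flow_agree[OF that]] by (simp add: gramian_def)
  ultimately show ?thesis
    unfolding psd_form_def
    by (auto simp: gramian_def psd_commute[OF q] intro!: integral_nonneg gramian_integrable[OF q] psd_nonneg[OF q])
qed

text \<open>The derivative of \<open>q\<close> along the flow is integrated over the horizon. A
  finite horizon makes the integral exist for every \<open>a\<close>, at the price of the boundary
  term at \<open>T\<close>.\<close>

lemma gramian_lyapunov:
  assumes q: "psd_form n q" and "0 \<le> T"
  shows "2 * gramian n a T q x (mat_act n a x) = q (flow n a T x) (flow n a T x) - q x x"
proof -
  let ?f = "\<lambda>s. q (flow n a s x) (flow n a s (mat_act n a x))"
  have "((\<lambda>s. 2 * ?f s) has_integral q (flow n a T x) (flow n a T x) - q (flow n a 0 x) (flow n a 0 x)) {0..T}"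
  proof (rule fundamental_theorem_of_calculus[OF assms(2)])
    fix s
    have "((\<lambda>s. q (flow n a s x) (flow n a s x)) has_real_derivative 2 * ?f s) (at s)"
      using flow_form_deriv[OF q, of a x x s] by (simp add: psd_commute[OF q])
    then show "((\<lambda>s. q (flow n a s x) (flow n a s x)) has_vector_derivative 2 * ?f s) (at s within {0..T})"
      by (simp add: has_real_derivative_iff_has_vector_derivative has_vector_derivative_at_within)
  qed
  then show ?thesis
    by (simp add: gramian_def flow_0 integral_unique flip: integral_mult_right)
qed

text \<open>A continuous nonnegative integrand with integral 0 vanishes, so the kernel consists of
  the \<open>x\<close> whose trajectory stays in the kernel of \<open>q\<close> on the horizon.
  Differentiating this condition shows invariance.\<close>

lemma gramian_ker:
  assumes q: "psd_form n q" and "0 < T" and 0: "gramian n a T q x x = 0"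
  shows "q x x = 0" "gramian n a T q (mat_act n a x) (mat_act n a x) = 0"
proof -
  have z: "q (flow n a s x) (flow n a s x) = 0" if "s \<in> {0..T}" for s
  proof (rule has_integral_0_cbox_imp_0[where a=0 and b=T and f="\<lambda>s. q (flow n a s x) (flow n a s x)"])
    show "((\<lambda>s. q (flow n a s x) (flow n a s x)) has_integral 0) (cbox 0 T)"
      using integrable_integral[OF gramian_integrable[OF q, where x=x and y=x]] 0
      by (simp add: gramian_def) metis
  qed (use that flow_form_continuous[OF q] psd_nonneg[OF q] assms(2) in auto)
  show "q x x = 0" using z[of 0] assms(2) by (simp add: flow_0)
  have "q (flow n a s (mat_act n a x)) (flow n a s (mat_act n a x)) = 0" if s: "s \<in> {0<..<T}" for s
  proof -
    \<comment> \<open>The second argument is held fixed: differentiating the diagonal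
      \<open>q (flow n a s x) (flow n a s x)\<close> would only give a pairing with a kernel vector,
      which is 0 anyway.\<close>
    have "q (flow n a s (mat_act n a x)) y = 0" for y
    proof -
      have "((\<lambda>s. q (flow n a s x) y) has_real_derivative q (flow n a s (mat_act n a x)) y + q (flow n a s x) 0) (at s)"
        unfolding flow_mat_act by (rule psd_deriv[OF q flow_deriv]) (auto)
      moreover have "((\<lambda>s. q (flow n a s x) y) has_real_derivative 0) (at s)"
      proof (rule DERIV_cong_ev[THEN iffD2])
        show "\<forall>\<^sub>F s in nhds s. q (flow n a s x) y = 0"
          using s psd_ker[OF q z] by (intro eventually_nhds_in_open[of "{0<..<T}", THEN eventually_mono]) auto
      qed auto
      ultimately show ?thesis
        using DERIV_unique by (fastforce simp: psd_zero[OF q])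
    qed
    then show ?thesis by blast
  qed
  \<comment> \<open>Two-sided differentiation works in the open interval only; the integral ignores
    the end points.\<close>
  then have "integral {0<..<T} (\<lambda>s. q (flow n a s (mat_act n a x)) (flow n a s (mat_act n a x))) = 0"
    by (subst integral_cong[where g="\<lambda>_. 0"]) auto
  then show "gramian n a T q (mat_act n a x) (mat_act n a x) = 0"
    by (simp add: gramian_def integral_open_interval_real)
qed

text \<open>All coefficients of the power series lie in the kernel. Pairing with the fixed vector
  \<open>?y\<close> is a finite combination of entries, so it can be carried out term by
  term.\<close>

lemma flow_ker:
  assumes q: "psd_form n q"
    and inv: "\<And>x. q x x = 0 \<Longrightarrow> q (mat_act n a x) (mat_act n a x) = 0" and x: "q x x = 0"
  shows "q (flow n a t x) (flow n a t x) = 0"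
proof -
  have pow: "q ((mat_act n a ^^ k) x) ((mat_act n a ^^ k) x) = 0" for k
    by (induction k) (auto simp: x inv)
  let ?y = "flow n a t x"
  have "(\<lambda>k. \<Sum>i<n. (mat_act n a ^^ k) x i / fact k * t ^ k * q (unit_fun i) ?y) sums
      (\<Sum>i<n. flow n a t x i * q (unit_fun i) ?y)"
    by (intro sums_sum sums_mult2 flow_sums)
  moreover have "(\<Sum>i<n. (mat_act n a ^^ k) x i / fact k * t ^ k * q (unit_fun i) ?y) = 0" for k
  proof -
    have "(\<Sum>i<n. (mat_act n a ^^ k) x i / fact k * t ^ k * q (unit_fun i) ?y)
      = t ^ k / fact k * (\<Sum>i<n. (mat_act n a ^^ k) x i * q (unit_fun i) ?y)"
      by (simp add: sum_distrib_left algebra_simps)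
    also have "\<dots> = t ^ k / fact k * q ((mat_act n a ^^ k) x) ?y"
      by (subst psd_expand[OF q, of _ ?y]) simp
    finally show ?thesis using psd_ker[OF q pow] by simp
  qed
  ultimately have "(\<Sum>i<n. flow n a t x i * q (unit_fun i) ?y) = 0"
    using sums_unique2[OF _ sums_zero] by simp
  then show ?thesis by (subst psd_expand[OF q])
qed

section \<open>A Lyapunov form for partially detectable pairs\<close>

text \<open>By the semigroup law, the Gramian at \<open>flow n a t x\<close> integrates
  \<open>q\<close> along the trajectory over the window from \<open>t\<close> to
  \<open>t + T\<close>.\<close>

lemma gramian_flow_decay:
  assumes q: "psd_form n q" and "0 \<le> T"
    and lim: "((\<lambda>t. q (flow n a t x) (flow n a t x)) \<longlongrightarrow> 0) at_top"
  shows "((\<lambda>t. gramian n a T q (flow n a t x) (flow n a t x)) \<longlongrightarrow> 0) at_top"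
proof (rule tendstoI)
  fix e :: real assume e: "e > 0"
  \<comment> \<open>The \<open>+ 1\<close> admits \<open>T = 0\<close> and keeps
    \<open>d * T\<close> strictly below \<open>e\<close>.\<close>
  define d where "d = e / (T + 1)"
  have d: "d > 0" "d * T < e" using e assms(2) by (auto simp: d_def field_simps)
  have "\<forall>\<^sub>F t in at_top. dist (q (flow n a t x) (flow n a t x)) 0 < d"
    by (rule tendstoD[OF lim d(1)])
  then obtain t0 where t0: "\<And>t. t \<ge> t0 \<Longrightarrow> q (flow n a t x) (flow n a t x) < d"
    using psd_nonneg[OF q] by (auto simp: eventually_at_top_linorder dist_real_def)
  have "dist (gramian n a T q (flow n a t x) (flow n a t x)) 0 < e" if t: "t \<ge> t0" for t
  proof -
    have eq: "q (flow n a s (flow n a t x)) (flow n a s (flow n a t x)) = q (flow n a (s + t) x) (flow n a (s + t) x)" for s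
      by (rule psd_cong2[OF q, symmetric]) (rule flow_add)+
    have "gramian n a T q (flow n a t x) (flow n a t x) \<le> integral {0..T} (\<lambda>s. d)"
      unfolding gramian_def
    proof (rule integral_le[OF gramian_integrable[OF q]])
      show "q (flow n a s (flow n a t x)) (flow n a s (flow n a t x)) \<le> d" if "s \<in> {0..T}" for s
        unfolding eq using t0[of "s + t"] that t by (intro less_imp_le) auto
    qed (rule integrable_const_ivl)
    also have "\<dots> = d * T" using assms(2) by simp
    finally show ?thesis using d psd_nonneg[OF psd_form_gramian[OF q]] by (simp add: dist_real_def)
  qed
  then show "\<forall>\<^sub>F t in at_top. dist (gramian n a T q (flow n a t x) (flow n a t x)) 0 < e"
    by (auto simp: eventually_at_top_linorder)
qed

text \<open>\<open>P\<close> decreases up to the output term \<open>qc\<close> but says nothing on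
  its own kernel. There \<open>det\<close> makes \<open>G\<close> decay, and \<open>Z\<close>, the
  Gramian of \<open>G\<close> over a long horizon, converts the decay into a decrease. Bounding
  \<open>X\<close> by a multiple of \<open>S\<close> finally turns the decrease into a rate.\<close>

lemma lyapunov_form:
  assumes qc: "psd_form n qc" and qk: "psd_form n qk"
    and det: "\<And>x. (\<And>k. qc ((mat_act n a ^^ k) x) ((mat_act n a ^^ k) x) = 0) \<Longrightarrow>
      ((\<lambda>t. qk (flow n a t x) (flow n a t x)) \<longlongrightarrow> 0) at_top"
  shows "\<exists>X \<epsilon> \<kappa> \<beta>. psd_form n X \<and> 0 < \<epsilon> \<and> 0 \<le> \<kappa> \<and> 0 \<le> \<beta> \<and>
    (\<forall>x. 2 * X x (mat_act n a x) \<le> - \<epsilon> * X x x + \<kappa> * qc x x) \<and>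
    (\<forall>x. qc x x \<le> \<beta> * X x x) \<and> (\<forall>x. qk x x \<le> \<beta> * X x x)"
proof -
  \<comment> \<open>The shift by \<open>1/2\<close> in \<open>a' = -a - 1/2\<close> produces the term \<open>-P x x\<close> in \<open>P_lyap\<close>.\<close>
  define a' where "a' i j = - a i j - (if i = j then 1 / 2 else 0)" for i j
  have a': "agree n (mat_act n a x) (- mat_act n a' x - (1 / 2) *\<^sub>R x)" for x
  proof -
    have "(\<Sum>j<n. (- a i j - (if i = j then 1 / 2 else 0)) * x j) = - (\<Sum>j<n. a i j * x j) - x i / 2" if "i < n" for i
    proof -
      have "(- a i j - (if i = j then 1 / 2 else 0)) * x j = - (a i j * x j) - (if j = i then x j / 2 else 0)" for j
        by (auto simp: algebra_simps)
      then show ?thesis using that by (simp add: sum_subtractf sum_negf)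
    qed
    then show ?thesis by (simp add: agree_def mat_act_def a'_def)
  qed
  define P where "P = gramian n a' 1 qc"
  \<comment> \<open>The kernel of \<open>qk\<close> need not be invariant under \<open>a\<close>;
    that of its Gramian is, which \<open>F_ker\<close> relies on.\<close>
  define G where "G = gramian n a 1 qk"
  \<comment> \<open>Its kernel is the intersection of the kernels of \<open>G\<close> and
    \<open>P\<close>, the largest subspace that the final form may ignore.\<close>
  define S where "S x y = G x y + P x y" for x y
  have P: "psd_form n P" and G: "psd_form n G"
    unfolding P_def G_def using psd_form_gramian qc qk by auto
  have S: "psd_form n S" using psd_form_add[OF G P] by (simp add: S_def[abs_def])
  have P_lyap: "2 * P x (mat_act n a x) \<le> - P x x + qc x x" for x
  proof -
    have "2 * P x (mat_act n a' x) = qc (flow n a' 1 x) (flow n a' 1 x) - qc x x"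
      unfolding P_def by (rule gramian_lyapunov[OF qc]) simp
    moreover have "P x (mat_act n a x) = - P x (mat_act n a' x) - P x x / 2"
    proof -
      have "P x (mat_act n a x) = P x (- mat_act n a' x - (1 / 2) *\<^sub>R x)"
        by (rule psd_cong2[OF P _ a']) (simp add: agree_def)
      then show ?thesis
        unfolding psd_diff[OF P] psd_scaleR[OF P] linear_neg[OF psd_linear_right[OF P]] by simp
    qed
    ultimately show ?thesis using psd_nonneg[OF qc, of "flow n a' 1 x"] by simp
  qed
  have P_ker: "qc x x = 0" "P (mat_act n a x) (mat_act n a x) = 0" if "P x x = 0" for x
  proof -
    have *: "qc x x = 0" "P (mat_act n a' x) (mat_act n a' x) = 0"
      using gramian_ker[OF qc, of 1 a' x] that by (auto simp: P_def)
    show "qc x x = 0" by fact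
    have "P (mat_act n a x) y = 0" for y
    proof -
      have "P (mat_act n a x) y = P (- mat_act n a' x - (1 / 2) *\<^sub>R x) y"
        by (rule psd_cong[OF P a'])
      also have "\<dots> = 0"
        unfolding psd_diff[OF P] psd_scaleR[OF P] linear_neg[OF psd_linear[OF P]]
        using psd_ker[OF P] that * by simp
      finally show ?thesis .
    qed
    then show "P (mat_act n a x) (mat_act n a x) = 0" .
  qed
  have G_ker: "qk x x = 0" "G (mat_act n a x) (mat_act n a x) = 0" if "G x x = 0" for x
    using gramian_ker[OF qk, of 1 a x] that by (auto simp: G_def)
  have S0: "G x x = 0 \<and> P x x = 0" if "S x x = 0" for x
    using that psd_nonneg[OF G, of x] psd_nonneg[OF P, of x] by (simp add: S_def)
  have decay: "((\<lambda>t. G (flow n a t x) (flow n a t x)) \<longlongrightarrow> 0) at_top" if x: "P x x = 0" for x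
  proof -
    have "P ((mat_act n a ^^ k) x) ((mat_act n a ^^ k) x) = 0" for k
      by (induction k) (auto simp: x P_ker(2))
    then have "((\<lambda>t. qk (flow n a t x) (flow n a t x)) \<longlongrightarrow> 0) at_top"
      using P_ker(1) by (intro det) blast
    then show ?thesis unfolding G_def by (intro gramian_flow_decay qk) auto
  qed
  obtain E c1 where E: "linear E" "\<And>x y. agree n x y \<Longrightarrow> agree n (E x) (E y)"
      "\<And>x. P (x - E x) (x - E x) = 0" "0 \<le> c1" "\<And>x. dot n (E x) (E x) \<le> c1 * P x x"
    using ker_projection[OF P] by blast
  have Gflow_ker: "G (flow n a t x) (flow n a t x) = 0" if "G x x = 0" for t x
    by (rule flow_ker[OF G G_ker(2) that])
  \<comment> \<open>\<open>x - E x\<close> is the component in the kernel of \<open>P\<close>, so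
    \<open>decay\<close> applies to each unit vector and the trace of \<open>F t\<close> tends to 0.
    This makes the pointwise decay uniform.\<close>
  define F where "F t x y = G (flow n a t (x - E x)) (flow n a t (y - E y))" for t x y
  have lin: "linear (\<lambda>x. flow n a t (x - E x))" for t
    using linear_compose[OF linear_compose_sub[OF linear_id E(1)] linear_flow[of n a t]]
    by (simp add: o_def)
  have F: "psd_form n (F t)" for t
    unfolding F_def[abs_def]
  proof (rule psd_form_pullback[OF G lin])
    show "agree n (flow n a t (x - E x)) (flow n a t (y - E y))" if "agree n x y" for x y
      using that E(2)[OF that] by (intro flow_agree) (simp add: agree_def)
  qed
  \<comment> \<open>On the kernel of \<open>S\<close> the projection \<open>E\<close> vanishes below
    \<open>n\<close>, and the flow preserves the kernel of \<open>G\<close>.\<close>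
  have F_ker: "F t x x = 0" if "S x x = 0" for t x
  proof -
    have "dot n (E x) (E x) \<le> 0" using E(5)[of x] S0[OF that] by simp
    then have "dot n (E x) (E x) = 0" using dot_self_nonneg[of n "E x"] by simp
    then have "agree n (x - E x) x" by (simp add: dot_self_eq_0 agree_def)
    then have "F t x x = G (flow n a t x) (flow n a t x)"
      unfolding F_def by (intro psd_cong2[OF G] flow_agree)
    then show ?thesis using Gflow_ker S0[OF that] by simp
  qed
  obtain c2 where c2: "0 \<le> c2" "\<And>f x. psd_form n f \<Longrightarrow> (\<And>x. S x x = 0 \<Longrightarrow> f x x = 0) \<Longrightarrow>
      f x x \<le> c2 * trace_form n f * S x x"
    using psd_dominate[OF S] by blast
  have "((\<lambda>t. trace_form n (F t)) \<longlongrightarrow> (\<Sum>i<n. 0)) at_top"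
    unfolding trace_form_def F_def by (intro tendsto_sum decay E)
  then have "((\<lambda>t. c2 * trace_form n (F t)) \<longlongrightarrow> 0) at_top"
    using tendsto_mult_right_zero by auto
  \<comment> \<open>The parallelogram bound in \<open>H_le\<close> doubles 1/8 to 1/4, leaving 3/4
    of \<open>G\<close> as decrease in \<open>Z_lyap\<close>.\<close>
  then have "\<forall>\<^sub>F t in at_top. c2 * trace_form n (F t) < 1 / 8"
    by (rule order_tendstoD) simp
  then have "\<forall>\<^sub>F t in at_top. c2 * trace_form n (F t) < 1 / 8 \<and> 0 < t"
    using eventually_gt_at_top eventually_conj by blast
  then obtain T where T: "c2 * trace_form n (F T) < 1 / 8" "0 < T"
    by (auto dest: eventually_happens)
  have FT: "F T x x \<le> S x x / 8" for x
  proof -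
    have "F T x x \<le> c2 * trace_form n (F T) * S x x" by (rule c2(2)[OF F F_ker])
    also have "\<dots> \<le> 1 / 8 * S x x"
      using T(1) psd_nonneg[OF S] by (intro mult_right_mono) auto
    finally show ?thesis by simp
  qed
  define H where "H x y = G (flow n a T x) (flow n a T y)" for x y
  have H: "psd_form n H"
    unfolding H_def[abs_def] by (rule psd_form_pullback[OF G linear_flow flow_agree])
  \<comment> \<open>1/4 is the share of \<open>P\<close> in \<open>S x x / 4\<close>; the other
    summand bounds \<open>H\<close> on the component \<open>E x\<close>.\<close>
  define b where "b = 1 / 4 + 2 * trace_form n H * c1"
  have b: "0 \<le> b" by (simp add: b_def trace_form_nonneg[OF H] E(4))
  have H_le: "H x x \<le> G x x / 4 + b * P x x" for x
  proof -
    have "H x x = H ((x - E x) + E x) ((x - E x) + E x)" by simp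
    also have "\<dots> \<le> 2 * H (x - E x) (x - E x) + 2 * H (E x) (E x)" by (rule psd_add_le[OF H])
    also have "H (x - E x) (x - E x) \<le> S x x / 8" using FT[of x] by (simp add: H_def F_def)
    also have "H (E x) (E x) \<le> trace_form n H * (c1 * P x x)"
      using psd_le_trace[OF H, of "E x"] mult_left_mono[OF E(5)[of x] trace_form_nonneg[OF H]] by simp
    finally show ?thesis by (simp add: b_def S_def field_simps)
  qed
  define Z where "Z = gramian n a T G"
  have Z: "psd_form n Z" unfolding Z_def by (rule psd_form_gramian[OF G])
  have Z_lyap: "2 * Z x (mat_act n a x) \<le> - 3 / 4 * G x x + b * P x x" for x
  proof -
    have "2 * Z x (mat_act n a x) = H x x - G x x"
      unfolding Z_def H_def using T(2) by (intro gramian_lyapunov[OF G]) simp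
    then show ?thesis using H_le[of x] by simp
  qed
  have Z_ker: "Z x x = 0" if "G x x = 0" for x
    using Gflow_ker[OF that] by (simp add: Z_def gramian_def)
  have Z_le: "Z x x \<le> c2 * trace_form n Z * S x x" for x
    using Z_ker S0 by (intro c2(2)[OF Z]) auto
  \<comment> \<open>\<open>b\<close> copies of \<open>P\<close> offset its positive contribution in
    \<open>Z_lyap\<close>; one further copy remains as decrease.\<close>
  define X where "X x y = Z x y + (b + 1) * P x y" for x y
  have X: "psd_form n X"
    unfolding X_def[abs_def] using b by (intro psd_form_add psd_form_scale Z P) auto
  have X_ker: "G x x = 0 \<and> P x x = 0" if "X x x = 0" for x
  proof -
    have "0 \<le> Z x x" "0 \<le> (b + 1) * P x x" using psd_nonneg[OF Z] psd_nonneg[OF P] b by auto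
    then have "Z x x = 0 \<and> (b + 1) * P x x = 0" using that unfolding X_def by linarith
    moreover have "b + 1 \<noteq> 0" using b by simp
    ultimately have "Z x x = 0" "P x x = 0" by auto
    then show ?thesis using gramian_ker(1)[OF G T(2), of a x] by (simp add: Z_def)
  qed
  define c where "c = c2 * trace_form n Z + (b + 1)"
  have c: "0 < c" using c2(1) trace_form_nonneg[OF Z] b by (simp add: c_def add_nonneg_pos)
  have X_le: "X x x \<le> c * S x x" for x
  proof -
    have "(b + 1) * P x x \<le> (b + 1) * S x x"
      using b psd_nonneg[OF G] by (intro mult_left_mono) (auto simp: S_def)
    then show ?thesis using Z_le[of x] by (simp add: X_def c_def algebra_simps)
  qed
  obtain d where d: "0 \<le> d" "\<And>f x. psd_form n f \<Longrightarrow> (\<And>x. X x x = 0 \<Longrightarrow> f x x = 0) \<Longrightarrow>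
      f x x \<le> d * trace_form n f * X x x"
    using psd_dominate[OF X] by blast
  define \<beta> where "\<beta> = d * (trace_form n qc + trace_form n qk)"
  have tr: "0 \<le> trace_form n qc" "0 \<le> trace_form n qk"
    using trace_form_nonneg qc qk by auto
  have "qc x x \<le> \<beta> * X x x" for x
  proof -
    have "qc x x \<le> d * trace_form n qc * X x x"
      using X_ker P_ker(1) by (intro d(2) qc) blast
    also have "\<dots> \<le> \<beta> * X x x"
      unfolding \<beta>_def using d(1) tr psd_nonneg[OF X] by (intro mult_right_mono mult_left_mono) auto
    finally show ?thesis .
  qed
  moreover have "qk x x \<le> \<beta> * X x x" for x
  proof -
    have "qk x x \<le> d * trace_form n qk * X x x"
      using X_ker G_ker(1) by (intro d(2) qk) blast
    also have "\<dots> \<le> \<beta> * X x x"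
      unfolding \<beta>_def using d(1) tr psd_nonneg[OF X] by (intro mult_right_mono mult_left_mono) auto
    finally show ?thesis .
  qed
  \<comment> \<open>The decrease is at least \<open>3 / 4 * S x x\<close>, and
    \<open>X x x \<le> c * S x x\<close> yields the rate \<open>3 / (4 * c)\<close>.\<close>
  moreover have "2 * X x (mat_act n a x) \<le> - (3 / (4 * c)) * X x x + (b + 1) * qc x x" for x
  proof -
    have "(b + 1) * (2 * P x (mat_act n a x)) \<le> (b + 1) * (- P x x + qc x x)"
      using b P_lyap by (intro mult_left_mono) auto
    then have "2 * X x (mat_act n a x) \<le> - 3 / 4 * G x x - P x x + (b + 1) * qc x x"
      using Z_lyap[of x] by (simp add: X_def algebra_simps)
    also have "\<dots> \<le> - (3 / 4) * S x x + (b + 1) * qc x x"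
      using psd_nonneg[OF P, of x] by (simp add: S_def field_simps)
    also have "- (3 / 4) * S x x \<le> - (3 / (4 * c)) * X x x"
      using X_le[of x] c by (simp add: field_simps)
    finally show ?thesis by simp
  qed
  moreover have "0 \<le> \<beta>" using d(1) tr by (simp add: \<beta>_def)
  moreover have "0 < 3 / (4 * c)" "0 \<le> b + 1" using c b by auto
  ultimately show ?thesis using X by blast
qed

section \<open>Smooth bump functions and mollification\<close>

text \<open>
  An algebra of functions that is closed under differentiation, so that its members are smooth;
  the functions \<open>exp(-1/t) / t^m\<close> are included for all \<open>m\<close> because they occur in the derivatives of
  \<open>exp(-1/t)\<close>.
\<close>

inductive bump_alg :: "(real \<Rightarrow> real) \<Rightarrow> bool" where
  flat: "bump_alg (\<lambda>t. if 0 < t then exp (- 1 / t) / t ^ m else 0)"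
| add: "bump_alg f \<Longrightarrow> bump_alg g \<Longrightarrow> bump_alg (\<lambda>t. f t + g t)"
| scale: "bump_alg f \<Longrightarrow> bump_alg (\<lambda>t. c * f t)"
| mult: "bump_alg f \<Longrightarrow> bump_alg g \<Longrightarrow> bump_alg (\<lambda>t. f t * g t)"
| affine: "bump_alg f \<Longrightarrow> bump_alg (\<lambda>t. f (c * t + d))"

lemma flat_deriv:
  "((\<lambda>t. if 0 < t then exp (- 1 / t) / t ^ m else 0) has_real_derivative
    (if 0 < t then exp (- 1 / t) / t ^ (m + 2) else 0) - real m * (if 0 < t then exp (- 1 / t) / t ^ (m + 1) else 0)) (at t)"
    (is "(?f has_real_derivative _) _")
proof -
  consider "t > 0" | "t < 0" | "t = 0" by linarith
  then show ?thesis
  proof cases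
    case 1
    have "((\<lambda>t. exp (- 1 / t) / t ^ m) has_real_derivative
        exp (- 1 / t) / t ^ (m + 2) - real m * (exp (- 1 / t) / t ^ (m + 1))) (at t)"
    proof -
      have "((\<lambda>t. exp (- 1 / t)) has_real_derivative exp (- 1 / t) / t ^ 2) (at t)"
        using 1 by (auto intro!: derivative_eq_intros simp: power2_eq_square)
      moreover have "((\<lambda>t. t ^ m) has_real_derivative real m * t ^ (m - 1)) (at t)"
        using DERIV_pow[of m t UNIV] by simp
      moreover have "t ^ m \<noteq> 0" using 1 by simp
      ultimately have "((\<lambda>t. exp (- 1 / t) / t ^ m) has_real_derivative
          (exp (- 1 / t) / t ^ 2 * t ^ m - exp (- 1 / t) * (real m * t ^ (m - 1))) / (t ^ m * t ^ m)) (at t)"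
        by (rule DERIV_divide)
      moreover have "(exp (- 1 / t) / t ^ 2 * t ^ m - exp (- 1 / t) * (real m * t ^ (m - 1))) / (t ^ m * t ^ m)
          = exp (- 1 / t) / t ^ (m + 2) - real m * (exp (- 1 / t) / t ^ (m + 1))"
        using 1 by (cases m) (simp_all add: field_simps power2_eq_square)
      ultimately show ?thesis by simp
    qed
    moreover have "\<forall>\<^sub>F u in nhds t. ?f u = exp (- 1 / u) / u ^ m"
      using eventually_nhds_in_open[of "{0<..}" t] 1 by (auto elim!: eventually_mono)
    ultimately show ?thesis using 1 by (subst DERIV_cong_ev[OF refl _ refl]) auto
  next
    case 2
    have "\<forall>\<^sub>F u in nhds t. ?f u = 0"
      using eventually_nhds_in_open[of "{..<0}" t] 2 by (auto elim!: eventually_mono)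
    then show ?thesis using 2 by (subst DERIV_cong_ev[OF refl _ refl]) auto
  next
    case 3
    \<comment> \<open>With \<open>1 / h\<close> as variable this is a power divided by the
      exponential at infinity.\<close>
    have "((\<lambda>h. ?f h / h) \<longlongrightarrow> 0) (at_right 0)"
    proof (rule Lim_transform_eventually)
      show "((\<lambda>h::real. (inverse h) ^ (m + 1) / exp (inverse h)) \<longlongrightarrow> 0) (at_right 0)"
        by (rule filterlim_compose[OF tendsto_power_div_exp_0 filterlim_inverse_at_top_right])
      show "\<forall>\<^sub>F h in at_right 0. (inverse h) ^ (m + 1) / exp (inverse h) = ?f h / h"
        by (auto simp: eventually_at_right_field exp_minus field_simps intro!: exI[of _ 1])
    qed
    moreover have "((\<lambda>h. ?f h / h) \<longlongrightarrow> 0) (at_left 0)"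
      by (rule tendsto_eventually) (auto simp: eventually_at_left_field intro!: exI[of _ "-1"])
    ultimately have "((\<lambda>h. ?f h / h) \<longlongrightarrow> 0) (at 0)"
      by (intro filterlim_split_at)
    then show ?thesis using 3 by (simp add: DERIV_def cong: if_cong)
  qed
qed

lemma bump_alg_deriv:
  assumes "bump_alg f"
  shows "\<exists>g. bump_alg g \<and> (\<forall>t. (f has_real_derivative g t) (at t))"
  using assms
proof induction
  case (flat m)
  have "bump_alg (\<lambda>t. (if 0 < t then exp (- 1 / t) / t ^ (m + 2) else 0)
      + (- real m) * (if 0 < t then exp (- 1 / t) / t ^ (m + 1) else 0))"
    by (intro bump_alg.add bump_alg.scale bump_alg.flat)
  then show ?case using flat_deriv[of m] by (intro exI conjI) (assumption, simp)
next
  case (add f g)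
  then obtain f' g' where "bump_alg f'" "bump_alg g'" "\<forall>t. (f has_real_derivative f' t) (at t)"
    "\<forall>t. (g has_real_derivative g' t) (at t)" by blast
  then show ?case by (intro exI[of _ "\<lambda>t. f' t + g' t"]) (auto intro: bump_alg.add DERIV_add)
next
  case (scale f c)
  then obtain f' where "bump_alg f'" "\<forall>t. (f has_real_derivative f' t) (at t)" by blast
  then show ?case by (intro exI[of _ "\<lambda>t. c * f' t"]) (auto intro: bump_alg.scale DERIV_cmult)
next
  case (mult f g)
  then obtain f' g' where "bump_alg f'" "bump_alg g'" "\<forall>t. (f has_real_derivative f' t) (at t)"
    "\<forall>t. (g has_real_derivative g' t) (at t)" by blast
  then show ?case using mult.hyps
    by (intro exI[of _ "\<lambda>t. f' t * g t + g' t * f t"]) (auto intro!: bump_alg.add bump_alg.mult DERIV_mult)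
next
  case (affine f c d)
  then obtain f' where f': "bump_alg f'" "\<forall>t. (f has_real_derivative f' t) (at t)" by blast
  have "((\<lambda>t. f (c * t + d)) has_real_derivative c * f' (c * t + d)) (at t)" for t
  proof -
    have "((\<lambda>t. f (c * t + d)) has_real_derivative f' (c * t + d) * c) (at t)"
      by (rule DERIV_chain2[OF f'(2)[rule_format]]) (auto intro!: derivative_eq_intros)
    then show ?thesis by (simp add: mult.commute)
  qed
  then show ?case using f'(1)
    by (intro exI[of _ "\<lambda>t. c * f' (c * t + d)"]) (auto intro: bump_alg.scale bump_alg.affine)
qed

lemma bump_alg_deriv_fun: "bump_alg f \<Longrightarrow> bump_alg (deriv f)"
  using bump_alg_deriv[of f] DERIV_imp_deriv[of f] by (metis ext)

lemma bump_alg_has_deriv: "bump_alg f \<Longrightarrow> (f has_real_derivative deriv f t) (at t)"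
  using bump_alg_deriv[of f] DERIV_imp_deriv[of f] by metis

lemma bump_alg_continuous: "bump_alg f \<Longrightarrow> continuous_on S f"
  by (meson DERIV_isCont bump_alg_has_deriv continuous_at_imp_continuous_on)

lemma bump_alg_test_function:
  assumes "bump_alg f" and supp: "\<And>t. t \<notin> {a..b} \<Longrightarrow> f t = 0"
  shows "test_function f"
proof -
  have "bump_alg ((deriv ^^ k) f)" for k
    by (induction k) (auto simp: assms(1) bump_alg_deriv_fun)
  then have "((deriv ^^ k) f) differentiable (at t)" for k t
    using bump_alg_has_deriv real_differentiable_def by blast
  moreover have "closure {t. f t \<noteq> 0} \<subseteq> {a..b}"
    using supp by (intro closure_minimal closed_real_atLeastAtMost) blast
  then have "compact (closure {t. f t \<noteq> 0})"
    by (meson bounded_closed_interval bounded_subset closed_closure compact_eq_bounded_closed)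
  ultimately show ?thesis by (simp add: test_function_def)
qed

text \<open>Not a Dirac sequence: the support stays in \<open>{0..\<tau>}\<close>, and the functions
  tend to the indicator of the open interval. Mollified functions therefore converge at every point,
  to integrals over windows of length \<tau>.\<close>

definition bump :: "real \<Rightarrow> nat \<Rightarrow> real \<Rightarrow> real" where
  "bump \<tau> k x = (if 0 < x \<and> x < \<tau> then exp (- 1 / (real (Suc k) * x)) * exp (- 1 / (real (Suc k) * (\<tau> - x))) else 0)"

lemma bump_alg_bump: "bump_alg (bump \<tau> k)"
proof -
  let ?th = "\<lambda>t::real. if 0 < t then exp (- 1 / t) / t ^ 0 else 0"
  have "bump_alg (\<lambda>t. ?th (real (Suc k) * t + 0) * ?th (- real (Suc k) * t + real (Suc k) * \<tau>))"
    by (intro bump_alg.mult bump_alg.affine bump_alg.flat)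
  also have "(\<lambda>t. ?th (real (Suc k) * t + 0) * ?th (- real (Suc k) * t + real (Suc k) * \<tau>)) = bump \<tau> k"
  proof
    fix t
    have e: "- real (Suc k) * t + real (Suc k) * \<tau> = real (Suc k) * (\<tau> - t)" by (simp add: algebra_simps)
    show "?th (real (Suc k) * t + 0) * ?th (- real (Suc k) * t + real (Suc k) * \<tau>) = bump \<tau> k t"
      unfolding e bump_def by (auto simp: zero_less_mult_iff simp del: of_nat_Suc)
  qed
  finally show ?thesis .
qed

lemma bump_bounds: "0 \<le> bump \<tau> k x" "bump \<tau> k x \<le> 1"
  by (auto simp: bump_def intro!: mult_le_one)

lemma bump_support: "x \<notin> {0..\<tau>} \<Longrightarrow> bump \<tau> k x = 0"
  by (auto simp: bump_def)

lemma bump_limit: "(\<lambda>k. bump \<tau> k x) \<longlonglongrightarrow> indicator {0<..<\<tau>} x"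
proof (cases "0 < x \<and> x < \<tau>")
  case True
  have *: "(\<lambda>k. exp (- 1 / (real (Suc k) * y))) \<longlonglongrightarrow> 1" if "y > 0" for y :: real
  proof -
    have "(\<lambda>k. - (1 / y) * inverse (real (Suc k))) \<longlonglongrightarrow> - (1 / y) * 0"
      by (intro tendsto_mult tendsto_const LIMSEQ_inverse_real_of_nat)
    then have "(\<lambda>k. exp (- (1 / y) * inverse (real (Suc k)))) \<longlonglongrightarrow> exp 0"
      by (intro tendsto_exp) simp
    then show ?thesis by (simp add: field_simps)
  qed
  have "(\<lambda>k. exp (- 1 / (real (Suc k) * x)) * exp (- 1 / (real (Suc k) * (\<tau> - x)))) \<longlonglongrightarrow> 1 * 1"
    using True by (intro tendsto_mult *) auto
  then show ?thesis using True by (simp add: bump_def)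
qed (auto simp: bump_def)

lemma loc_integrable_mult:
  fixes f \<psi> :: "real \<Rightarrow> real"
  assumes "\<And>S. compact S \<Longrightarrow> f absolutely_integrable_on S"
    and cont: "continuous_on {a..b} \<psi>" and supp: "\<And>t. t \<notin> {a..b} \<Longrightarrow> \<psi> t = 0"
  shows "integrable lebesgue (\<lambda>t. f t * \<psi> t)"
proof -
  have "(\<lambda>t. \<psi> t * f t) absolutely_integrable_on {a..b}"
  proof (rule absolutely_integrable_bounded_measurable_product_real)
    show "\<psi> \<in> borel_measurable (lebesgue_on {a..b})"
      using cont by (intro continuous_imp_measurable_on_sets_lebesgue) auto
    show "bounded (\<psi> ` {a..b})"
      using cont by (intro compact_imp_bounded compact_continuous_image) auto
  qed (use assms(1) in auto)
  moreover have "(\<lambda>t. indicator {a..b} t *\<^sub>R (\<psi> t * f t)) = (\<lambda>t. f t * \<psi> t)"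
    using supp by (auto simp: indicator_def fun_eq_iff)
  ultimately show ?thesis by (simp only: set_integrable_def)
qed

text \<open>The difference quotient falls entirely on the smooth kernel, where it is bounded by a
  Lipschitz constant; dominated convergence then permits differentiation under the integral.\<close>

lemma mollify_deriv:
  fixes f :: "real \<Rightarrow> real"
  assumes f: "\<And>S. compact S \<Longrightarrow> f absolutely_integrable_on S"
    and \<phi>: "bump_alg \<phi>" and supp: "\<And>x. x \<notin> {0..\<tau>} \<Longrightarrow> \<phi> x = 0"
  shows "((\<lambda>s. LINT t|lebesgue. f t * \<phi> (s - t)) has_real_derivative
    (LINT t|lebesgue. f t * deriv \<phi> (s - t))) (at s)"
proof -
  have supp': "deriv \<phi> x = 0" if "x \<notin> {0..\<tau>}" for x
  proof -
    have "\<forall>\<^sub>F u in nhds x. \<phi> u = 0"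
    proof (rule eventually_mono)
      show "\<forall>\<^sub>F u in nhds x. u \<in> - {0..\<tau>}"
        using that by (intro eventually_nhds_in_open) auto
    qed (use supp in blast)
    then have "(\<phi> has_real_derivative 0) (at x)"
      by (subst DERIV_cong_ev[OF refl _ refl]) auto
    then show ?thesis by (rule DERIV_imp_deriv)
  qed
  have cont': "continuous_on S (deriv \<phi>)" for S
    by (rule bump_alg_continuous[OF bump_alg_deriv_fun[OF \<phi>]])
  have "bounded (deriv \<phi> ` {0..\<tau>})"
    by (intro compact_imp_bounded compact_continuous_image cont') auto
  then obtain B0 where B0: "\<And>x. x \<in> {0..\<tau>} \<Longrightarrow> \<bar>deriv \<phi> x\<bar> \<le> B0"
    unfolding bounded_iff by fastforce
  \<comment> \<open>For negative \<tau> the interval is empty and \<open>B0\<close> arbitrary; off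
    the support a nonnegative bound is required.\<close>
  define B where "B = max B0 0"
  have B: "\<bar>deriv \<phi> x\<bar> \<le> B" for x
    using B0[of x] supp'[of x] by (cases "x \<in> {0..\<tau>}") (auto simp: B_def)
  have lip: "\<bar>\<phi> x - \<phi> y\<bar> \<le> B * \<bar>x - y\<bar>" for x y
    using field_differentiable_bound[of UNIV \<phi> "deriv \<phi>" B x y] bump_alg_has_deriv[OF \<phi>] B by simp
  have int: "integrable lebesgue (\<lambda>t. f t * \<phi> (s - t))" for s
  proof (rule loc_integrable_mult[OF f, of "s - \<tau>" s])
    show "continuous_on {s - \<tau>..s} (\<lambda>t. \<phi> (s - t))"
      by (rule continuous_on_compose2[OF bump_alg_continuous[OF \<phi>, of UNIV]]) (auto intro!: continuous_intros)
  qed (auto intro!: supp)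
  show ?thesis
    unfolding DERIV_def tendsto_at_iff_sequentially
  proof (intro allI impI)
    fix X :: "nat \<Rightarrow> real"
    assume "\<forall>i. X i \<in> UNIV - {0}" and X: "X \<longlonglongrightarrow> 0"
    then have X0: "X i \<noteq> 0" for i by auto
    from convergent_imp_Bseq[of X] X obtain M where M: "\<And>i. \<bar>X i\<bar> \<le> M"
      by (auto simp: convergent_def Bseq_def)
    define q where "q i t = f t * ((\<phi> (s + X i - t) - \<phi> (s - t)) / X i)" for i t
    have "(\<lambda>i. LINT t|lebesgue. q i t) \<longlonglongrightarrow> (LINT t|lebesgue. f t * deriv \<phi> (s - t))"
    proof (rule integral_dominated_convergence)
      \<comment> \<open>Shifts are bounded by \<open>M\<close>, so the supports of all difference
        quotients lie in one window enlarged by \<open>M\<close> on both sides.\<close>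
      let ?w = "\<lambda>t. B * (indicator {s - \<tau> - M..s + M} t *\<^sub>R \<bar>f t\<bar>)"
      show "integrable lebesgue ?w"
        using set_integrable_abs[OF f[of "{s - \<tau> - M..s + M}"]]
        by (intro integrable_mult_right) (simp add: set_integrable_def)
      show meas: "q i \<in> borel_measurable lebesgue" for i
      proof -
        have "q i = (\<lambda>t. (f t * \<phi> (s + X i - t) - f t * \<phi> (s - t)) / X i)"
          by (auto simp: q_def fun_eq_iff algebra_simps diff_divide_distrib)
        moreover have "integrable lebesgue (\<lambda>t. (f t * \<phi> (s + X i - t) - f t * \<phi> (s - t)) / X i)"
          by (intro integrable_divide Bochner_Integration.integrable_diff int)
        ultimately show ?thesis by (simp add: borel_measurable_integrable)
      qed
      show "AE t in lebesgue. (\<lambda>i. q i t) \<longlonglongrightarrow> f t * deriv \<phi> (s - t)"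
      proof (rule AE_I2)
        fix t
        have "((\<lambda>h. (\<phi> (s - t + h) - \<phi> (s - t)) / h) \<circ> X) \<longlonglongrightarrow> deriv \<phi> (s - t)"
          using bump_alg_has_deriv[OF \<phi>, of "s - t"] X X0
          unfolding DERIV_def tendsto_at_iff_sequentially by auto
        then have "(\<lambda>i. (\<phi> (s + X i - t) - \<phi> (s - t)) / X i) \<longlonglongrightarrow> deriv \<phi> (s - t)"
          by (simp add: o_def algebra_simps)
        then show "(\<lambda>i. q i t) \<longlonglongrightarrow> f t * deriv \<phi> (s - t)"
          unfolding q_def by (intro tendsto_mult tendsto_const)
      qed
      show "AE t in lebesgue. norm (q i t) \<le> ?w t" for i
      proof (rule AE_I2)
        fix t
        show "norm (q i t) \<le> ?w t"
        proof (cases "t \<in> {s - \<tau> - M..s + M}")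
          case True
          have "\<bar>(\<phi> (s + X i - t) - \<phi> (s - t)) / X i\<bar> \<le> B"
            using lip[of "s + X i - t" "s - t"] X0[of i] by (simp add: field_simps)
          then have "\<bar>f t\<bar> * \<bar>(\<phi> (s + X i - t) - \<phi> (s - t)) / X i\<bar> \<le> \<bar>f t\<bar> * B"
            by (rule mult_left_mono) simp
          then show ?thesis using True by (simp add: q_def abs_mult mult.commute)
        next
          case False
          then have "s + X i - t \<notin> {0..\<tau>}" "s - t \<notin> {0..\<tau>}" using M[of i] by auto
          then show ?thesis using supp by (simp add: q_def B_def)
        qed
      qed
      have "integrable lebesgue (\<lambda>t. f t * deriv \<phi> (s - t))"
      proof (rule loc_integrable_mult[OF f, of "s - \<tau>" s])
        show "continuous_on {s - \<tau>..s} (\<lambda>t. deriv \<phi> (s - t))"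
          by (rule continuous_on_compose2[OF cont'[of UNIV]]) (auto intro!: continuous_intros)
      qed (auto intro!: supp')
      then show "(\<lambda>t. f t * deriv \<phi> (s - t)) \<in> borel_measurable lebesgue"
        by (rule borel_measurable_integrable)
    qed
    moreover have "(LINT t|lebesgue. q i t) = ((LINT t|lebesgue. f t * \<phi> (s + X i - t)) - (LINT t|lebesgue. f t * \<phi> (s - t))) / X i" for i
    proof -
      have "(LINT t|lebesgue. q i t) = (LINT t|lebesgue. (f t * \<phi> (s + X i - t) - f t * \<phi> (s - t)) / X i)"
        by (auto simp: q_def algebra_simps diff_divide_distrib intro!: Bochner_Integration.integral_cong)
      then show ?thesis by (simp add: Bochner_Integration.integral_diff[OF int int])
    qed
    ultimately show "((\<lambda>h. ((LINT t|lebesgue. f t * \<phi> (s + h - t)) - (LINT t|lebesgue. f t * \<phi> (s - t))) / h) \<circ> X)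
        \<longlonglongrightarrow> (LINT t|lebesgue. f t * deriv \<phi> (s - t))"
      by (simp add: o_def)
  qed
qed

section \<open>Weak solutions of linear systems are classical\<close>

lemma mollify_limit:
  fixes f :: "real \<Rightarrow> real"
  assumes f: "\<And>S. compact S \<Longrightarrow> f absolutely_integrable_on S"
  shows "(\<lambda>k. LINT t|lebesgue. f t * bump \<tau> k (s - t)) \<longlonglongrightarrow> integral {s - \<tau>..s} f"
proof -
  have int: "integrable lebesgue (\<lambda>t. f t * bump \<tau> k (s - t))" for k
  proof (rule loc_integrable_mult[OF f, of "s - \<tau>" s])
    show "continuous_on {s - \<tau>..s} (\<lambda>t. bump \<tau> k (s - t))"
      by (rule continuous_on_compose2[OF bump_alg_continuous[OF bump_alg_bump, of UNIV]]) (auto intro!: continuous_intros)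
  qed (auto intro!: bump_support)
  have abs: "f absolutely_integrable_on {s - \<tau><..<s}"
    by (rule set_integrable_subset[OF f[of "{s - \<tau>..s}"]]) auto
  have "(\<lambda>k. LINT t|lebesgue. f t * bump \<tau> k (s - t)) \<longlonglongrightarrow> (LINT t|lebesgue. indicator {s - \<tau><..<s} t *\<^sub>R f t)"
  proof (rule integral_dominated_convergence)
    show "integrable lebesgue (\<lambda>t. indicator {s - \<tau>..s} t *\<^sub>R \<bar>f t\<bar>)"
      using set_integrable_abs[OF f[of "{s - \<tau>..s}"]] by (simp add: set_integrable_def)
    show "(\<lambda>t. indicator {s - \<tau><..<s} t *\<^sub>R f t) \<in> borel_measurable lebesgue"
      using abs by (simp add: set_integrable_def borel_measurable_integrable)
    show "AE t in lebesgue. (\<lambda>k. f t * bump \<tau> k (s - t)) \<longlonglongrightarrow> indicator {s - \<tau><..<s} t *\<^sub>R f t"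
    proof (rule AE_I2)
      fix t
      have "(\<lambda>k. f t * bump \<tau> k (s - t)) \<longlonglongrightarrow> f t * indicator {0<..<\<tau>} (s - t)"
        by (intro tendsto_mult tendsto_const bump_limit)
      moreover have "f t * indicator {0<..<\<tau>} (s - t) = indicator {s - \<tau><..<s} t *\<^sub>R f t"
        by (auto simp: indicator_def)
      ultimately show "(\<lambda>k. f t * bump \<tau> k (s - t)) \<longlonglongrightarrow> indicator {s - \<tau><..<s} t *\<^sub>R f t" by simp
    qed
    show "AE t in lebesgue. norm (f t * bump \<tau> k (s - t)) \<le> indicator {s - \<tau>..s} t *\<^sub>R \<bar>f t\<bar>" for k
    proof (rule AE_I2)
      fix t
      show "norm (f t * bump \<tau> k (s - t)) \<le> indicator {s - \<tau>..s} t *\<^sub>R \<bar>f t\<bar>"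
        using bump_bounds[of \<tau> k "s - t"] bump_support[of "s - t" \<tau> k] mult_left_mono[of "bump \<tau> k (s - t)" 1 "\<bar>f t\<bar>"]
        by (cases "t \<in> {s - \<tau>..s}") (auto simp: abs_mult)
    qed
  qed (use int borel_measurable_integrable in blast)
  also have "(LINT t|lebesgue. indicator {s - \<tau><..<s} t *\<^sub>R f t) = integral {s - \<tau>..s} f"
    using set_lebesgue_integral_eq_integral(2)[OF abs]
    by (simp add: set_lebesgue_integral_def integral_open_interval_real)
  finally show ?thesis .
qed

text \<open>The bound is uniform in \<open>k\<close> and in \<open>s\<close>, as required for
  passing to the limit under the integral over \<open>s\<close>.\<close>

lemma mollify_bound:
  fixes f :: "real \<Rightarrow> real"
  assumes f: "\<And>S. compact S \<Longrightarrow> f absolutely_integrable_on S" and "s \<in> {a..b}"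
  shows "\<bar>LINT t|lebesgue. f t * bump \<tau> k (s - t)\<bar> \<le> (LINT t|lebesgue. indicator {a - \<tau>..b} t *\<^sub>R \<bar>f t\<bar>)"
proof (rule order_trans[OF integral_abs_bound integral_mono'])
  show "integrable lebesgue (\<lambda>t. indicator {a - \<tau>..b} t *\<^sub>R \<bar>f t\<bar>)"
    using set_integrable_abs[OF f[of "{a - \<tau>..b}"]] by (simp add: set_integrable_def)
  show "\<bar>f t * bump \<tau> k (s - t)\<bar> \<le> indicator {a - \<tau>..b} t *\<^sub>R \<bar>f t\<bar>" for t
  proof (cases "t \<in> {a - \<tau>..b}")
    case True
    then show ?thesis
      using bump_bounds[of \<tau> k "s - t"] mult_left_mono[of "bump \<tau> k (s - t)" 1 "\<bar>f t\<bar>"] by (simp add: abs_mult)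
  next
    case False
    then have "s - t \<notin> {0..\<tau>}" using assms(2) by auto
    then show ?thesis using bump_support by simp
  qed
qed simp

text \<open>Tested with reflected translates of \<open>bump\<close>, the weak equation says that the
  mollified functions solve the same constant-coefficient system classically. Integration over
  \<open>{s0..s1}\<close> and \<open>k \<rightarrow> \<infinity>\<close> give a relation between
  window integrals of \<open>f\<close>.\<close>

lemma weak_ode_integral_eq:
  fixes f :: "'a \<Rightarrow> real \<Rightarrow> real"
  assumes I: "finite I"
    and f: "\<And>i S. i \<in> I \<Longrightarrow> compact S \<Longrightarrow> f i absolutely_integrable_on S"
    and weak: "\<And>\<phi> i. test_function \<phi> \<Longrightarrow> i \<in> I \<Longrightarrow>
      (LINT t|lebesgue. f i t * deriv \<phi> t) = - (LINT t|lebesgue. (\<Sum>j\<in>I. a i j * f j t) * \<phi> t)"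
    and "i \<in> I" and "s0 \<le> s1"
  shows "integral {s1 - \<tau>..s1} (f i) - integral {s0 - \<tau>..s0} (f i)
    = integral {s0..s1} (\<lambda>s. \<Sum>j\<in>I. a i j * integral {s - \<tau>..s} (f j))"
proof -
  define e where "e k i s = (LINT t|lebesgue. f i t * bump \<tau> k (s - t))" for k i s
  have deriv_e: "(e k i has_real_derivative (\<Sum>j\<in>I. a i j * e k j s)) (at s)" if i: "i \<in> I" for k i s
  proof -
    let ?\<psi> = "\<lambda>t. bump \<tau> k (s - t)"
    have "bump_alg (\<lambda>t. bump \<tau> k (- 1 * t + s))"
      by (rule bump_alg.affine[OF bump_alg_bump])
    then have alg: "bump_alg ?\<psi>" by (simp add: algebra_simps)
    have test: "test_function ?\<psi>"
      by (rule bump_alg_test_function[OF alg, of "s - \<tau>" s]) (auto intro: bump_support)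
    have "(?\<psi> has_real_derivative deriv (bump \<tau> k) (s - t) * - 1) (at t)" for t
      by (rule DERIV_chain2[OF bump_alg_has_deriv[OF bump_alg_bump]]) (auto intro!: derivative_eq_intros)
    \<comment> \<open>The sign from the reflection cancels the sign in the definition of the weak
      derivative.\<close>
    then have d: "deriv ?\<psi> t = - deriv (bump \<tau> k) (s - t)" for t
      using DERIV_imp_deriv by fastforce
    have int: "integrable lebesgue (\<lambda>t. f j t * ?\<psi> t)" if "j \<in> I" for j
      using f[OF that] bump_alg_continuous[OF alg]
      by (intro loc_integrable_mult[of _ "s - \<tau>" s]) (auto intro: bump_support)
    have "(e k i has_real_derivative (LINT t|lebesgue. f i t * deriv (bump \<tau> k) (s - t))) (at s)"
      unfolding e_def by (rule mollify_deriv[OF f[OF i] bump_alg_bump bump_support])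
    also have "(LINT t|lebesgue. f i t * deriv (bump \<tau> k) (s - t)) = - (LINT t|lebesgue. f i t * deriv ?\<psi> t)"
      by (simp add: d)
    also have "\<dots> = (LINT t|lebesgue. (\<Sum>j\<in>I. a i j * (f j t * ?\<psi> t)))"
      using weak[OF test i] by (simp add: sum_distrib_right mult.assoc)
    also have "\<dots> = (\<Sum>j\<in>I. a i j * e k j s)"
      using int by (simp add: Bochner_Integration.integral_sum e_def)
    finally show ?thesis .
  qed
  have ftc: "((\<lambda>s. \<Sum>j\<in>I. a i j * e k j s) has_integral (e k i s1 - e k i s0)) {s0..s1}" for k
  proof (rule fundamental_theorem_of_calculus[OF \<open>s0 \<le> s1\<close>])
    show "(e k i has_vector_derivative (\<Sum>j\<in>I. a i j * e k j s)) (at s within {s0..s1})" for s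
      using deriv_e[OF \<open>i \<in> I\<close>, of k s]
      by (simp add: has_real_derivative_iff_has_vector_derivative has_vector_derivative_at_within)
  qed
  have "(\<lambda>k. integral {s0..s1} (\<lambda>s. \<Sum>j\<in>I. a i j * e k j s)) \<longlonglongrightarrow>
      integral {s0..s1} (\<lambda>s. \<Sum>j\<in>I. a i j * integral {s - \<tau>..s} (f j))"
  proof (rule dominated_convergence(2))
    show "(\<lambda>s. \<Sum>j\<in>I. a i j * e k j s) integrable_on {s0..s1}" for k
      using ftc by blast
    show "(\<lambda>s::real. \<Sum>j\<in>I. \<bar>a i j\<bar> * (LINT t|lebesgue. indicator {s0 - \<tau>..s1} t *\<^sub>R \<bar>f j t\<bar>)) integrable_on {s0..s1}"
      by (rule integrable_const_ivl)
    show "norm (\<Sum>j\<in>I. a i j * e k j s) \<le> (\<Sum>j\<in>I. \<bar>a i j\<bar> * (LINT t|lebesgue. indicator {s0 - \<tau>..s1} t *\<^sub>R \<bar>f j t\<bar>))"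
      if "s \<in> {s0..s1}" for k s
    proof (rule sum_norm_le)
      fix j assume "j \<in> I"
      then show "norm (a i j * e k j s) \<le> \<bar>a i j\<bar> * (LINT t|lebesgue. indicator {s0 - \<tau>..s1} t *\<^sub>R \<bar>f j t\<bar>)"
        using mollify_bound[OF f that, of j] by (simp only: real_norm_def abs_mult e_def) (intro mult_left_mono, auto)
    qed
    show "(\<lambda>k. \<Sum>j\<in>I. a i j * e k j s) \<longlonglongrightarrow> (\<Sum>j\<in>I. a i j * integral {s - \<tau>..s} (f j))" for s
      unfolding e_def by (intro tendsto_sum tendsto_mult tendsto_const mollify_limit f)
  qed
  moreover have "(\<lambda>k. integral {s0..s1} (\<lambda>s. \<Sum>j\<in>I. a i j * e k j s)) \<longlonglongrightarrow>
      integral {s1 - \<tau>..s1} (f i) - integral {s0 - \<tau>..s0} (f i)"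
    unfolding integral_unique[OF ftc] unfolding e_def
    by (intro tendsto_diff mollify_limit f \<open>i \<in> I\<close>)
  ultimately show ?thesis using LIMSEQ_unique by blast
qed

section \<open>From the integral equation to differentiable solutions\<close>

lemma primitive_deriv:
  fixes g :: "real \<Rightarrow> real"
  assumes "continuous_on {0..} g" "0 < t"
  shows "((\<lambda>u. integral {0..u} g) has_real_derivative g t) (at t)"
proof -
  have "((\<lambda>u. integral {0..u} g) has_real_derivative g t) (at t within {0..t + 1})"
    by (rule integral_has_real_derivative) (use assms in \<open>auto intro: continuous_on_subset\<close>)
  moreover have "t \<in> interior {0..t + 1}" using assms(2) by simp
  ultimately show ?thesis by (metis at_within_interior)
qed

text \<open>Averaging over an interval of length 1 expresses \<open>Q\<close> by its primitive.\<close>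

lemma continuous_additive_deriv:
  fixes Q :: "real \<Rightarrow> real"
  assumes cont: "continuous_on {0..} Q" and add: "\<And>u v. 0 \<le> u \<Longrightarrow> 0 \<le> v \<Longrightarrow> Q (u + v) = Q u + Q v" and "0 < t"
  shows "(Q has_real_derivative Q 1) (at t)"
proof -
  define J where "J u = integral {0..u} Q" for u
  have int: "Q integrable_on {a..b}" if "0 \<le> a" for a b
    by (rule integrable_continuous_interval) (use that in \<open>auto intro: continuous_on_subset[OF cont]\<close>)
  have Q: "Q u = J (u + 1) - J u - J 1" if "0 \<le> u" for u
  proof -
    have "J u + integral {u..u + 1} Q = J (u + 1)"
      unfolding J_def using that by (intro Henstock_Kurzweil_Integration.integral_combine int) auto
    moreover have "integral {u..u + 1} Q = integral {0..1} (\<lambda>v. Q (v + u))"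
      using integral_shift[of 0 u 1 Q] continuous_on_subset[OF cont, of "{u..u + 1}"] that
      by (simp add: o_def add.commute)
    moreover have "integral {0..1} (\<lambda>v. Q (v + u)) = integral {0..1} (\<lambda>v. Q v + Q u)"
      using that add by (intro integral_cong) auto
    moreover have "\<dots> = J 1 + Q u"
      using integral_add[OF int[of 0 1] integrable_const_ivl[of "Q u" 0 1]] by (simp add: J_def)
    ultimately show ?thesis by simp
  qed
  have J: "(J has_real_derivative Q u) (at u)" if "0 < u" for u
    unfolding J_def by (rule primitive_deriv[OF cont that])
  have "((\<lambda>u. J (u + 1) - J u - J 1) has_real_derivative (Q (t + 1) - Q t - 0)) (at t)"
    using J[of "t + 1"] J[of t] \<open>0 < t\<close> by (intro DERIV_diff) (auto simp: DERIV_shift)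
  moreover have "Q (t + 1) - Q t - 0 = Q 1" using add[of t 1] \<open>0 < t\<close> by simp
  moreover have "\<forall>\<^sub>F u in nhds t. J (u + 1) - J u - J 1 = Q u"
    using eventually_nhds_in_open[of "{0<..}" t] \<open>0 < t\<close> Q by (auto elim!: eventually_mono)
  ultimately show ?thesis by (subst (asm) DERIV_cong_ev[OF refl _ refl]) auto
qed

text \<open>By Henstock's lemma, the Riemann sums of \<open>\<bar>h\<bar>\<close> tend to 0.\<close>

lemma AE_zero_of_interval_integrals:
  fixes h :: "real \<Rightarrow> real"
  assumes h: "h absolutely_integrable_on {a..b}"
    and 0: "\<And>c d. a \<le> c \<Longrightarrow> c \<le> d \<Longrightarrow> d \<le> b \<Longrightarrow> integral {c..d} h = 0"
  shows "AE t in lebesgue. t \<in> {a..b} \<longrightarrow> h t = 0"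
proof -
  have hi: "h integrable_on cbox a b" using h set_lebesgue_integral_eq_integral(1) by auto
  have "((\<lambda>t. \<bar>h t\<bar>) has_integral 0) (cbox a b)"
    unfolding has_integral
  proof (intro allI impI)
    fix e :: real assume "e > 0"
    then obtain \<gamma> where \<gamma>: "gauge \<gamma>" "\<And>p. p tagged_partial_division_of cbox a b \<Longrightarrow> \<gamma> fine p \<Longrightarrow>
        (\<Sum>(x, k)\<in>p. norm (measure lborel k *\<^sub>R h x - integral k h)) < e"
      using Henstock_lemma[OF hi \<open>e > 0\<close>] by blast
    show "\<exists>\<gamma>. gauge \<gamma> \<and> (\<forall>D. D tagged_division_of cbox a b \<and> \<gamma> fine D \<longrightarrow>
        norm ((\<Sum>(x, k)\<in>D. measure lborel k *\<^sub>R \<bar>h x\<bar>) - 0) < e)"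
    proof (intro exI[of _ \<gamma>] conjI allI impI \<gamma>(1))
      fix D assume D: "D tagged_division_of cbox a b \<and> \<gamma> fine D"
      have "(\<Sum>(x, k)\<in>D. measure lborel k *\<^sub>R \<bar>h x\<bar>) = (\<Sum>(x, k)\<in>D. norm (measure lborel k *\<^sub>R h x - integral k h))"
      proof (rule sum.cong[OF refl], clarify)
        fix x k assume xk: "(x, k) \<in> D"
        obtain c d where k: "k = cbox c d" using D xk by blast
        have "k \<subseteq> cbox a b" "k \<noteq> {}" using D xk by blast+
        then have "a \<le> c" "c \<le> d" "d \<le> b" using k by auto
        then have "integral k h = 0" using 0 k by simp
        then show "measure lborel k *\<^sub>R \<bar>h x\<bar> = norm (measure lborel k *\<^sub>R h x - integral k h)"
          by (simp add: abs_mult)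
      qed
      also have "\<dots> < e" using D by (intro \<gamma>(2)) (auto simp: tagged_division_of_def)
      finally show "norm ((\<Sum>(x, k)\<in>D. measure lborel k *\<^sub>R \<bar>h x\<bar>) - 0) < e"
        by (simp add: sum_nonneg case_prod_unfold)
    qed
  qed
  then have "integral {a..b} (\<lambda>t. \<bar>h t\<bar>) = 0" by (simp add: integral_unique)
  moreover have abs: "(\<lambda>t. \<bar>h t\<bar>) absolutely_integrable_on {a..b}" by (rule set_integrable_abs[OF h])
  ultimately have "(LINT t|lebesgue. indicator {a..b} t *\<^sub>R \<bar>h t\<bar>) = 0"
    using set_lebesgue_integral_eq_integral(2)[OF abs] by (simp add: set_lebesgue_integral_def)
  then have "AE t in lebesgue. indicator {a..b} t *\<^sub>R \<bar>h t\<bar> = 0"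
    using abs by (subst (asm) integral_nonneg_eq_0_iff_AE) (auto simp: set_integrable_def)
  then show ?thesis by eventually_elim (auto simp: indicator_def)
qed

text \<open>A half-line suffices for limits at infinity. The index set is of arbitrary type, so that
  all coordinates of all nodes can be treated as one system.\<close>

lemma weak_ode_classical:
  fixes f :: "'a \<Rightarrow> real \<Rightarrow> real"
  assumes I: "finite I"
    and f: "\<And>i S. i \<in> I \<Longrightarrow> compact S \<Longrightarrow> f i absolutely_integrable_on S"
    and weak: "\<And>\<phi> i. test_function \<phi> \<Longrightarrow> i \<in> I \<Longrightarrow>
      (LINT t|lebesgue. f i t * deriv \<phi> t) = - (LINT t|lebesgue. (\<Sum>j\<in>I. a i j * f j t) * \<phi> t)"
  shows "\<exists>g. \<forall>i\<in>I. (\<forall>t>0. (g i has_real_derivative (\<Sum>j\<in>I. a i j * g j t)) (at t)) \<and>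
    (AE t in lebesgue. 0 \<le> t \<longrightarrow> f i t = g i t)"
proof -
  have fi: "f i integrable_on {c..d}" if "i \<in> I" for i c d
    using f[OF that, of "{c..d}"] set_lebesgue_integral_eq_integral(1) by auto
  \<comment> \<open>The integral equation says that \<open>Q\<close> is additive, hence linear, so that \<open>E\<close> is continuously
    differentiable; its derivative is the classical solution.\<close>
  define E where "E i t = integral {0..t} (f i)" for i t
  define G where "G i t = integral {0..t} (E i)" for i t
  define Q where "Q i t = E i t - (\<Sum>j\<in>I. a i j * G j t)" for i t
  have cont_nonneg: "continuous_on {0..} u" if "\<And>b. continuous_on {0..b} u" for u :: "real \<Rightarrow> real"
  proof -
    have "isCont u t" if "0 < t" for t
      using \<open>\<And>b. continuous_on {0..b} u\<close>[of "t + 1"] that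
      by (intro continuous_on_interior[of "{0..t + 1}"]) auto
    moreover have "continuous (at 0 within {0..}) u"
    proof -
      have "continuous (at 0 within {0..1}) u"
        using \<open>\<And>b. continuous_on {0..b} u\<close>[of 1] by (simp add: continuous_on_eq_continuous_within)
      then show ?thesis by (simp add: at_within_Icc_at_right at_within_Ici_at_right)
    qed
    ultimately show ?thesis
      unfolding continuous_on_eq_continuous_within
      by (metis atLeast_iff continuous_at_imp_continuous_at_within order_le_less)
  qed
  have contE: "continuous_on {0..} (E i)" if "i \<in> I" for i
    unfolding E_def[abs_def] by (intro cont_nonneg indefinite_integral_continuous_1 fi that)
  have contG: "continuous_on {0..} (G i)" if "i \<in> I" for i
    unfolding G_def[abs_def]
    by (intro cont_nonneg indefinite_integral_continuous_1 integrable_continuous_interval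
        continuous_on_subset[OF contE[OF that]]) auto
  have E_diff: "integral {c..d} (f i) = E i d - E i c" if "i \<in> I" "0 \<le> c" "c \<le> d" for i c d
    using Henstock_Kurzweil_Integration.integral_combine[OF that(2,3) fi[OF that(1)]] by (simp add: E_def)
  have Q_add: "Q i (u + v) = Q i u + Q i v" if i: "i \<in> I" and uv: "0 \<le> u" "0 \<le> v" for i u v
  proof -
    have G_int: "integral {v..u + v} (\<lambda>s. integral {s - v..s} (f j)) = (G j (u + v) - G j v) - G j u"
      if j: "j \<in> I" for j
    proof -
      have Ei: "E j integrable_on {c..d}" if "0 \<le> c" for c d
        using that by (intro integrable_continuous_interval continuous_on_subset[OF contE[OF j]]) auto
      have "integral {v..u + v} (\<lambda>s. integral {s - v..s} (f j)) = integral {v..u + v} (\<lambda>s. E j s - E j (s - v))"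
        using uv by (intro integral_cong E_diff j) auto
      also have "\<dots> = integral {v..u + v} (E j) - integral {v..u + v} (\<lambda>s. E j (s - v))"
      proof (intro integral_diff Ei uv integrable_continuous_interval)
        show "continuous_on {v..u + v} (\<lambda>s. E j (s - v))"
          by (rule continuous_on_compose2[OF contE[OF j]]) (auto intro!: continuous_intros)
      qed
      also have "integral {v..u + v} (\<lambda>s. E j (s - v)) = G j u"
        using integral_shift[of v "- v" "u + v" "E j"] continuous_on_subset[OF contE[OF j], of "{0..u}"]
        by (simp add: o_def G_def)
      also have "integral {v..u + v} (E j) = G j (u + v) - G j v"
        using Henstock_Kurzweil_Integration.integral_combine[of 0 v "u + v" "E j"] Ei uv by (simp add: G_def)
      finally show ?thesis .
    qed
    \<comment> \<open>With \<tau> = \<open>v\<close>, \<open>s0 = v\<close> and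
      \<open>s1 = u + v\<close> the two windows are \<open>{u..u + v}\<close> and
      \<open>{0..v}\<close>, so the left side of the integral equation is the defect of additivity
      of \<open>E\<close>. The right side is the same defect for the combination of the
      \<open>G j\<close>.\<close>
    have "(E i (u + v) - E i u) - E i v = integral {v..u + v} (\<lambda>s. \<Sum>j\<in>I. a i j * integral {s - v..s} (f j))"
      using weak_ode_integral_eq[OF I f weak i, of v "u + v" v] uv E_diff[OF i, of u "u + v"]
      by (simp add: E_def)
    also have "\<dots> = (\<Sum>j\<in>I. a i j * ((G j (u + v) - G j v) - G j u))"
    proof (subst integral_sum[OF I])
      show "(\<lambda>s. a i j * integral {s - v..s} (f j)) integrable_on {v..u + v}" if j: "j \<in> I" for j
      proof -
        have "continuous_on {v..u + v} (\<lambda>s. a i j * (E j s - E j (s - v)))"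
          using uv by (intro continuous_intros continuous_on_subset[OF contE[OF j]]
            continuous_on_compose2[OF contE[OF j], of _ "\<lambda>s. s - v"]) auto
        then have "continuous_on {v..u + v} (\<lambda>s. a i j * integral {s - v..s} (f j))"
          by (rule continuous_on_eq) (use uv E_diff[OF j] in auto)
        then show ?thesis by (rule integrable_continuous_interval)
      qed
    qed (simp add: G_int)
    finally show ?thesis
      by (simp add: Q_def algebra_simps sum.distrib sum_subtractf)
  qed
  have contQ: "continuous_on {0..} (Q i)" if "i \<in> I" for i
    unfolding Q_def[abs_def] by (intro continuous_intros contE contG that)
  define g where "g i t = Q i 1 + (\<Sum>j\<in>I. a i j * E j t)" for i t
  have derivE: "(E i has_real_derivative g i t) (at t)" if "i \<in> I" "0 < t" for i t
  proof -
    have "(G j has_real_derivative E j t) (at t)" if "j \<in> I" for j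
      unfolding G_def[abs_def] by (rule primitive_deriv[OF contE[OF that] \<open>0 < t\<close>])
    moreover have "(Q i has_real_derivative Q i 1) (at t)"
      using that by (intro continuous_additive_deriv contQ Q_add)
    ultimately have "((\<lambda>t. Q i t + (\<Sum>j\<in>I. a i j * G j t)) has_real_derivative g i t) (at t)"
      unfolding g_def by (intro DERIV_add DERIV_sum DERIV_cmult) auto
    then show ?thesis by (simp add: Q_def)
  qed
  have derivg: "(g i has_real_derivative (\<Sum>j\<in>I. a i j * g j t)) (at t)" if "i \<in> I" "0 < t" for i t
  proof -
    have "((\<lambda>t. Q i 1 + (\<Sum>j\<in>I. a i j * E j t)) has_real_derivative (0 + (\<Sum>j\<in>I. a i j * g j t))) (at t)"
      by (intro DERIV_add DERIV_const DERIV_sum DERIV_cmult derivE that)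
    then show ?thesis by (simp add: g_def[abs_def])
  qed
  have contg: "continuous_on {0..} (g i)" for i
    unfolding g_def[abs_def] by (intro continuous_intros contE)
  have "AE t in lebesgue. 0 \<le> t \<longrightarrow> f i t = g i t" if i: "i \<in> I" for i
  proof -
    \<comment> \<open>Both functions have the primitive \<open>E i\<close>, so their difference has
      integral 0 over every interval; countably many bounded intervals cover the half-line.\<close>
    have "AE t in lebesgue. t \<in> {0..real N} \<longrightarrow> f i t - g i t = 0" for N
    proof (rule AE_zero_of_interval_integrals)
      have gabs: "g i absolutely_integrable_on {0..real N}"
        by (intro absolutely_integrable_continuous_real continuous_on_subset[OF contg]) auto
      show "(\<lambda>t. f i t - g i t) absolutely_integrable_on {0..real N}"
        by (intro set_integral_diff(1) f i gabs) auto
      fix c d :: real assume cd: "0 \<le> c" "c \<le> d"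
      have "(g i has_integral (E i d - E i c)) {c..d}"
      proof (rule fundamental_theorem_of_calculus_interior[OF cd(2)])
        show "continuous_on {c..d} (E i)"
          using cd by (intro continuous_on_subset[OF contE[OF i]]) auto
        show "(E i has_vector_derivative g i x) (at x)" if "x \<in> {c<..<d}" for x
          using derivE[OF i, of x] that cd by (simp add: has_real_derivative_iff_has_vector_derivative)
      qed
      then show "integral {c..d} (\<lambda>t. f i t - g i t) = 0"
        using integral_diff[OF fi[OF i], of "g i" c d] E_diff[OF i cd] by (auto simp: integral_unique)
    qed
    then have "AE t in lebesgue. \<forall>N. t \<in> {0..real N} \<longrightarrow> f i t - g i t = 0"
      unfolding AE_all_countable by blast
    then show ?thesis
    proof eventually_elim
      case (elim t)
      then show ?case using real_arch_simple[of t] by fastforce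
    qed
  qed
  then show ?thesis using derivg by blast
qed

section \<open>Signals\<close>

lemma test_function_props:
  assumes "test_function \<phi>"
  obtains a b where "\<And>t. t \<notin> {a..b} \<Longrightarrow> \<phi> t = 0" "\<And>t. t \<notin> {a..b} \<Longrightarrow> deriv \<phi> t = 0"
    "\<And>t. (\<phi> has_real_derivative deriv \<phi> t) (at t)"
    "\<And>S. continuous_on S \<phi>" "\<And>S. continuous_on S (deriv \<phi>)"
proof -
  have d: "((deriv ^^ k) \<phi>) differentiable (at t)" for k t
    using assms by (simp add: test_function_def)
  have 1: "(\<phi> has_real_derivative deriv \<phi> t) (at t)" for t
    using d[of 0 t] by (simp add: DERIV_deriv_iff_real_differentiable)
  have cont: "continuous_on S \<phi>" for S
    using DERIV_isCont[OF 1] by (simp add: continuous_at_imp_continuous_on)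
  have cont': "continuous_on S (deriv \<phi>)" for S
    using d[of 1] by (intro continuous_at_imp_continuous_on) (auto intro: differentiable_imp_continuous_within)
  let ?S = "closure {t. \<phi> t \<noteq> 0}"
  have "bounded ?S" using assms by (simp add: test_function_def compact_imp_bounded)
  then obtain c where "?S \<subseteq> cbox (- c) c"
    using bounded_subset_cbox_symmetric by blast
  then obtain a b where ab: "?S \<subseteq> {a..b}" by (metis box_real(2))
  have 0: "\<phi> t = 0" if "t \<notin> ?S" for t
    using that closure_subset[of "{t. \<phi> t \<noteq> 0}"] by blast
  have "deriv \<phi> t = 0" if "t \<notin> ?S" for t
  proof -
    have "\<forall>\<^sub>F u in nhds t. u \<in> - ?S" using that by (intro eventually_nhds_in_open) auto
    then have "\<forall>\<^sub>F u in nhds t. \<phi> u = 0" by (rule eventually_mono) (use 0 in blast)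
    then have "(\<phi> has_real_derivative 0) (at t)"
      by (subst DERIV_cong_ev[OF refl _ refl]) auto
    then show ?thesis by (rule DERIV_imp_deriv)
  qed
  then show ?thesis using that[of a b] 0 1 cont cont' ab by blast
qed

lemma L1_loc_carrier: "f \<in> L1_loc k \<Longrightarrow> f t \<in> carrier_vec k"
  by (simp add: L1_loc_def)

lemma L1_loc_component:
  "f \<in> L1_loc k \<Longrightarrow> i < k \<Longrightarrow> compact S \<Longrightarrow> (\<lambda>t. f t $ i) absolutely_integrable_on S"
  by (simp add: L1_loc_def)

lemma L1_loc_continuous:
  fixes f :: "real \<Rightarrow> real vec"
  assumes "\<And>t. f t \<in> carrier_vec k" "\<And>i. i < k \<Longrightarrow> continuous_on UNIV (\<lambda>t. f t $ i)"
  shows "f \<in> L1_loc k"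
proof -
  have "(\<lambda>t. f t $ i) absolutely_integrable_on S" if i: "i < k" and S: "compact S" for i S
  proof -
    obtain c where "S \<subseteq> cbox (- c) c"
      using bounded_subset_cbox_symmetric[OF compact_imp_bounded[OF S]] by blast
    then obtain a b where ab: "S \<subseteq> {a..b}" by (metis box_real(2))
    have "(\<lambda>t. f t $ i) absolutely_integrable_on {a..b}"
      by (intro absolutely_integrable_continuous_real continuous_on_subset[OF assms(2)[OF i]]) auto
    then show ?thesis
      by (rule set_integrable_subset) (use S ab in \<open>auto intro: lmeasurable_compact fmeasurableD\<close>)
  qed
  then show ?thesis using assms(1) by (simp add: L1_loc_def)
qed

lemma L1_loc_zero: "(\<lambda>t. 0\<^sub>v k) \<in> L1_loc k"
  by (rule L1_loc_continuous) auto

lemma L1_loc_diff: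
  fixes f g :: "real \<Rightarrow> real vec"
  assumes "f \<in> L1_loc k" "g \<in> L1_loc k"
  shows "(\<lambda>t. f t - g t) \<in> L1_loc k"
proof -
  have "(\<lambda>t. (f t - g t) $ i) = (\<lambda>t. f t $ i - g t $ i)" if "i < k" for i
  proof
    show "(f t - g t) $ i = f t $ i - g t $ i" for t
      using L1_loc_carrier[OF assms(2), of t] that by simp
  qed
  then show ?thesis
    using assms by (auto simp: L1_loc_def intro: set_integral_diff(1))
qed

lemma L1_loc_integrable_mult:
  fixes f :: "real \<Rightarrow> real vec" and \<psi> :: "real \<Rightarrow> real"
  assumes "f \<in> L1_loc k" "i < k" "continuous_on {a..b} \<psi>" "\<And>t. t \<notin> {a..b} \<Longrightarrow> \<psi> t = 0"
  shows "integrable lebesgue (\<lambda>t. f t $ i * \<psi> t)"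
  using L1_loc_component[OF assms(1,2)] assms(3,4) by (rule loc_integrable_mult)

lemma L1_loc_measurable:
  fixes f :: "real \<Rightarrow> real vec"
  assumes "f \<in> L1_loc k" "i < k"
  shows "(\<lambda>t. f t $ i) \<in> borel_measurable lebesgue"
proof (rule borel_measurable_LIMSEQ_real)
  show "(\<lambda>t. indicator {- real N..real N} t *\<^sub>R f t $ i) \<in> borel_measurable lebesgue" for N
    using L1_loc_component[OF assms, of "{- real N..real N}"]
    by (simp add: set_integrable_def borel_measurable_integrable)
  show "(\<lambda>N. indicator {- real N..real N} t *\<^sub>R f t $ i) \<longlonglongrightarrow> f t $ i" for t
  proof (rule tendsto_eventually)
    obtain N0 where "\<bar>t\<bar> \<le> real N0" using real_arch_simple by blast
    then have "t \<in> {- real N..real N}" if "N \<ge> N0" for N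
      using that by (auto simp: abs_le_iff)
    then show "\<forall>\<^sub>F N in sequentially. indicator {- real N..real N} t *\<^sub>R f t $ i = f t $ i"
      unfolding eventually_sequentially by (intro exI[of _ N0]) simp
  qed
qed

lemma has_weak_deriv_diff:
  fixes f f' g g' :: "real \<Rightarrow> real vec"
  assumes "has_weak_deriv k f f'" "has_weak_deriv k g g'"
  shows "has_weak_deriv k (\<lambda>t. f t - g t) (\<lambda>t. f' t - g' t)"
proof -
  have L: "f \<in> L1_loc k" "f' \<in> L1_loc k" "g \<in> L1_loc k" "g' \<in> L1_loc k"
    using assms by (auto simp: has_weak_deriv_def)
  have "(LINT t|lebesgue. (f t - g t) $ i * deriv \<phi> t) = - (LINT t|lebesgue. (f' t - g' t) $ i * \<phi> t)"
    if \<phi>: "test_function \<phi>" and i: "i < k" for \<phi> i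
  proof -
    obtain a b where ab: "\<And>t. t \<notin> {a..b} \<Longrightarrow> \<phi> t = 0" "\<And>t. t \<notin> {a..b} \<Longrightarrow> deriv \<phi> t = 0"
      "\<And>S. continuous_on S \<phi>" "\<And>S. continuous_on S (deriv \<phi>)"
      using test_function_props[OF \<phi>] by metis
    have int: "integrable lebesgue (\<lambda>t. h t $ i * \<phi> t)" "integrable lebesgue (\<lambda>t. h t $ i * deriv \<phi> t)"
      if "h \<in> L1_loc k" for h :: "real \<Rightarrow> real vec"
      using L1_loc_integrable_mult[OF that i ab(3) ab(1)] L1_loc_integrable_mult[OF that i ab(4) ab(2)] by auto
    have idx: "(h t - h' t) $ i = h t $ i - h' t $ i" if "h' \<in> L1_loc k" for h h' :: "real \<Rightarrow> real vec" and t
      using L1_loc_carrier[OF that, of t] i by auto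
    have "(LINT t|lebesgue. (f t - g t) $ i * deriv \<phi> t)
        = (LINT t|lebesgue. f t $ i * deriv \<phi> t) - (LINT t|lebesgue. g t $ i * deriv \<phi> t)"
      by (simp add: idx[OF L(3)] left_diff_distrib Bochner_Integration.integral_diff[OF int(2)[OF L(1)] int(2)[OF L(3)]])
    also have "\<dots> = - (LINT t|lebesgue. f' t $ i * \<phi> t) + (LINT t|lebesgue. g' t $ i * \<phi> t)"
      using assms \<phi> i by (simp add: has_weak_deriv_def)
    also have "\<dots> = - (LINT t|lebesgue. (f' t - g' t) $ i * \<phi> t)"
      by (simp add: idx[OF L(4)] left_diff_distrib Bochner_Integration.integral_diff[OF int(1)[OF L(2)] int(1)[OF L(4)]])
    finally show ?thesis .
  qed
  then show ?thesis using L1_loc_diff L by (simp add: has_weak_deriv_def)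
qed

lemma has_weak_deriv_classical:
  fixes f g :: "real \<Rightarrow> real vec"
  assumes f: "\<And>t. f t \<in> carrier_vec k" and g: "\<And>t. g t \<in> carrier_vec k"
    and deriv: "\<And>i t. i < k \<Longrightarrow> ((\<lambda>t. f t $ i) has_real_derivative g t $ i) (at t)"
    and cont: "\<And>i. i < k \<Longrightarrow> continuous_on UNIV (\<lambda>t. g t $ i)"
  shows "has_weak_deriv k f g"
proof -
  have contf: "continuous_on UNIV (\<lambda>t. f t $ i)" if "i < k" for i
    using DERIV_isCont[OF deriv[OF that]] by (simp add: continuous_at_imp_continuous_on)
  have L: "f \<in> L1_loc k" "g \<in> L1_loc k"
    using f g contf cont by (auto intro: L1_loc_continuous)
  have "(LINT t|lebesgue. f t $ i * deriv \<phi> t) = - (LINT t|lebesgue. g t $ i * \<phi> t)"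
    if \<phi>: "test_function \<phi>" and i: "i < k" for \<phi> i
  proof -
    obtain a' b' where ab': "\<And>t. t \<notin> {a'..b'} \<Longrightarrow> \<phi> t = 0" "\<And>t. t \<notin> {a'..b'} \<Longrightarrow> deriv \<phi> t = 0"
      "\<And>t. (\<phi> has_real_derivative deriv \<phi> t) (at t)"
      "\<And>S. continuous_on S \<phi>" "\<And>S. continuous_on S (deriv \<phi>)"
      using test_function_props[OF \<phi>] by metis
    \<comment> \<open>The margin 1 places the end points outside the supporting interval, where
      \<phi> vanishes, and gives \<open>a \<le> b\<close> even if that interval is empty.\<close>
    define a b where "a = min a' b' - 1" and "b = max a' b' + 1"
    have ab: "\<And>t. t \<notin> {a..b} \<Longrightarrow> \<phi> t = 0" "\<And>t. t \<notin> {a..b} \<Longrightarrow> deriv \<phi> t = 0" "a \<le> b" "\<phi> a = 0" "\<phi> b = 0"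
    proof -
      show "\<phi> t = 0" "deriv \<phi> t = 0" if "t \<notin> {a..b}" for t
      proof -
        have "t \<notin> {a'..b'}"
          using that by (auto simp: a_def b_def min_def max_def split: if_splits)
        then show "\<phi> t = 0" "deriv \<phi> t = 0" by (fact ab'(1), fact ab'(2))
      qed
      have "a \<notin> {a'..b'}" "b \<notin> {a'..b'}" by (auto simp: a_def b_def min_def max_def)
      then show "\<phi> a = 0" "\<phi> b = 0" using ab'(1) by blast+
      show "a \<le> b" by (simp add: a_def b_def)
    qed
    have int: "integrable lebesgue (\<lambda>t. f t $ i * deriv \<phi> t)" "integrable lebesgue (\<lambda>t. g t $ i * \<phi> t)"
      by (rule L1_loc_integrable_mult[OF L(1) i ab'(5) ab(2)], assumption)
         (rule L1_loc_integrable_mult[OF L(2) i ab'(4) ab(1)], assumption)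
    let ?h = "\<lambda>t. f t $ i * deriv \<phi> t + g t $ i * \<phi> t"
    have inth: "integrable lebesgue ?h" by (intro Bochner_Integration.integrable_add int)
    have "(?h has_integral (f b $ i * \<phi> b - f a $ i * \<phi> a)) {a..b}"
    proof (rule fundamental_theorem_of_calculus[OF ab(3)])
      fix t
      have "((\<lambda>t. f t $ i * \<phi> t) has_real_derivative ?h t) (at t)"
        using DERIV_mult[OF deriv[OF i] ab'(3), of t] by (simp add: algebra_simps)
      then show "((\<lambda>t. f t $ i * \<phi> t) has_vector_derivative ?h t) (at t within {a..b})"
        by (simp add: has_real_derivative_iff_has_vector_derivative has_vector_derivative_at_within)
    qed
    then have "(?h has_integral 0) {a..b}" using ab by simp
    then have "(?h has_integral 0) UNIV"
      by (rule has_integral_on_superset) (use ab in auto)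
    moreover have "(?h has_integral (LINT t|lebesgue. ?h t)) UNIV"
      using has_integral_integral_lebesgue[OF inth] .
    ultimately have "(LINT t|lebesgue. ?h t) = 0" by (rule has_integral_unique[symmetric])
    then show ?thesis using Bochner_Integration.integral_add[OF int] by simp
  qed
  then show ?thesis using L by (simp add: has_weak_deriv_def)
qed

lemma has_weak_deriv_zero: "has_weak_deriv k (\<lambda>t. 0\<^sub>v k) (\<lambda>t. 0\<^sub>v k)"
  by (rule has_weak_deriv_classical) auto

section \<open>Essential limits at infinity\<close>

lemma ess_tendsto_zero_exp_bound:
  assumes z: "z \<in> L1_loc r" and bnd: "AE t in lebesgue. 1 \<le> t \<longrightarrow> eucl_norm (z t) \<le> c * exp (- d * t)"
    and "0 \<le> c" "0 < d"
  shows "ess_tendsto_zero z"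
proof -
  let ?F = "\<lambda>t. esssup (restrict_space lebesgue {t..}) (\<lambda>s. ereal (eucl_norm (z s)))"
  have dim: "dim_vec (z s) = r" for s using L1_loc_carrier[OF z, of s] by auto
  have "(\<lambda>s. \<Sum>i<r. (z s $ i)\<^sup>2) \<in> borel_measurable lebesgue"
    by (intro borel_measurable_sum borel_measurable_power L1_loc_measurable[OF z]) auto
  then have "(\<lambda>s. ereal (eucl_norm (z s))) \<in> borel_measurable lebesgue"
    unfolding eucl_norm_def dim L2_set_def by simp
  then have meas: "(\<lambda>s. ereal (eucl_norm (z s))) \<in> borel_measurable (restrict_space lebesgue {t..})" for t
    by (rule measurable_restrict_space1)
  \<comment> \<open>The essential supremum of the constant 0 is 0 only on a space of positive
    measure, hence the interval of length 1 inside the half-line.\<close>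
  have lower: "0 \<le> ?F t" for t
  proof -
    have "esssup (restrict_space lebesgue {t..}) (\<lambda>s. 0::ereal) = 0"
    proof (rule esssup_const)
      have "emeasure lborel {t..t + 1} \<le> emeasure lborel {t..}" by (rule emeasure_mono) auto
      then show "emeasure (restrict_space lebesgue {t..}) (space (restrict_space lebesgue {t..})) \<noteq> 0"
        by (auto simp: space_restrict_space emeasure_restrict_space)
    qed
    moreover have "esssup (restrict_space lebesgue {t..}) (\<lambda>s. 0::ereal) \<le> ?F t"
      by (rule esssup_mono) (auto simp: eucl_norm_def)
    ultimately show ?thesis by simp
  qed
  have upper: "?F t \<le> ereal (c * exp (- d * t))" if "1 \<le> t" for t
  proof (rule esssup_I[OF meas])
    have "AE s in lebesgue. s \<in> {t..} \<longrightarrow> ereal (eucl_norm (z s)) \<le> ereal (c * exp (- d * t))"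
      using bnd
    proof eventually_elim
      case (elim s)
      show ?case
      proof
        assume s: "s \<in> {t..}"
        then have "eucl_norm (z s) \<le> c * exp (- d * s)" using elim that by simp
        also have "\<dots> \<le> c * exp (- d * t)"
          using s assms(3,4) by (intro mult_left_mono) auto
        finally show "ereal (eucl_norm (z s)) \<le> ereal (c * exp (- d * t))" by simp
      qed
    qed
    then show "AE s in restrict_space lebesgue {t..}. ereal (eucl_norm (z s)) \<le> ereal (c * exp (- d * t))"
      by (subst AE_restrict_space_iff) auto
  qed
  have "((\<lambda>t. c * exp (- d * t)) \<longlongrightarrow> 0) at_top"
    using \<open>0 < d\<close> by real_asymp
  then have "((\<lambda>t. ereal (c * exp (- d * t))) \<longlongrightarrow> ereal 0) at_top"
    by (rule tendsto_ereal)
  then have "(?F \<longlongrightarrow> ereal 0) at_top"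
  proof (rule tendsto_sandwich[rotated 3])
    show "((\<lambda>_. 0::ereal) \<longlongrightarrow> ereal 0) at_top" by (simp add: zero_ereal_def)
    show "\<forall>\<^sub>F t in at_top. 0 \<le> ?F t" using lower by simp
    show "\<forall>\<^sub>F t in at_top. ?F t \<le> ereal (c * exp (- d * t))"
      using upper unfolding eventually_at_top_linorder by blast
  qed
  then show ?thesis by (simp add: ess_tendsto_zero_def zero_ereal_def)
qed

text \<open>An essential bound on a continuous function holds everywhere, because the set where it
  fails is open and null.\<close>

lemma ess_tendsto_zero_continuous:
  assumes z: "ess_tendsto_zero z" and cont: "continuous_on UNIV (\<lambda>t. eucl_norm (z t))"
  shows "((\<lambda>t. eucl_norm (z t)) \<longlongrightarrow> 0) at_top"
proof (rule tendstoI)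
  fix e :: real assume "e > 0"
  then have "\<forall>\<^sub>F t in at_top. esssup (restrict_space lebesgue {t..}) (\<lambda>s. ereal (eucl_norm (z s))) < ereal (e / 2)"
    using z unfolding ess_tendsto_zero_def by (intro order_tendstoD(2)) auto
  then obtain t where t: "esssup (restrict_space lebesgue {t..}) (\<lambda>s. ereal (eucl_norm (z s))) < ereal (e / 2)"
    by (auto dest: eventually_happens)
  have "AE s in restrict_space lebesgue {t..}. eucl_norm (z s) \<le> e / 2"
    using esssup_AE[of "\<lambda>s. ereal (eucl_norm (z s))" "restrict_space lebesgue {t..}"]
  proof eventually_elim
    case (elim s)
    then have "ereal (eucl_norm (z s)) < ereal (e / 2)" using t by (rule le_less_trans)
    then show ?case by simp
  qed
  then have ae: "AE s in lebesgue. s \<in> {t..} \<longrightarrow> eucl_norm (z s) \<le> e / 2"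
    by (subst (asm) AE_restrict_space_iff) auto
  \<comment> \<open>The open half-line keeps the exceptional set open; this costs only the point
    \<open>t\<close>.\<close>
  let ?U = "{t<..} \<inter> {s. e / 2 < eucl_norm (z s)}"
  have "open {s. e / 2 < eucl_norm (z s)}"
    using cont by (intro open_Collect_less) auto
  then have "open ?U" by (intro open_Int) auto
  moreover have "negligible ?U"
  proof -
    have "AE s in lebesgue. s \<notin> ?U" using ae by eventually_elim auto
    moreover have "?U \<in> sets lebesgue" using \<open>open ?U\<close> by (simp add: lebesgue_openin borel_open)
    ultimately show ?thesis by (simp add: negligible_iff_null_sets AE_iff_null_sets)
  qed
  ultimately have "?U = {}" using open_not_negligible by blast
  then have "eucl_norm (z s) \<le> e / 2" if "t < s" for s using that by force
  moreover have "0 \<le> eucl_norm (z s)" for s by (simp add: eucl_norm_def)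
  ultimately have "\<forall>s>t. dist (eucl_norm (z s)) 0 < e"
    using \<open>e > 0\<close> by (force simp: dist_real_def)
  then show "\<forall>\<^sub>F t in at_top. dist (eucl_norm (z t)) 0 < e"
    by (auto simp: eventually_at_top_dense)
qed

section \<open>Consensus and the network Lyapunov function\<close>

text \<open>Orientation is dropped since disagreement is symmetric in the two nodes; both
  connectivity hypotheses then give the same statement.\<close>

definition neighbours :: "nat \<Rightarrow> real mat \<Rightarrow> (nat \<times> nat) set" where
  "neighbours l \<Gamma> = {(i, j). i < l \<and> j < l \<and> (\<Gamma> $$ (i, j) = 1 \<or> \<Gamma> $$ (j, i) = 1)}"

lemma connected_neighbours:
  assumes "strongly_connected (comm_graph l \<Gamma>) \<or> Digraph_Component.connected (comm_graph l \<Gamma>)"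
    and "u < l" "v < l"
  shows "(u, v) \<in> (neighbours l \<Gamma>)\<^sup>*"
proof -
  have *: "(u, v) \<in> rtrancl_on S R \<Longrightarrow> R \<subseteq> R' \<Longrightarrow> (u, v) \<in> R'\<^sup>*" for S and R R' :: "(nat \<times> nat) set"
    by (induction rule: rtrancl_on.induct) (auto intro: rtrancl_into_rtrancl)
  show ?thesis
    using assms(1)
  proof
    assume "strongly_connected (comm_graph l \<Gamma>)"
    then have "(u, v) \<in> rtrancl_on (verts (comm_graph l \<Gamma>)) (arcs_ends (comm_graph l \<Gamma>))"
      using assms(2,3) by (simp add: strongly_connected_def reachable_def comm_graph_def)
    then show ?thesis
      by (rule *) (auto simp: comm_graph_def arcs_ends_def arc_to_ends_def neighbours_def)
  next
    assume "Digraph_Component.connected (comm_graph l \<Gamma>)"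
    then have "(u, v) \<in> rtrancl_on (verts (with_proj (mk_symmetric (comm_graph l \<Gamma>))))
        (arcs_ends (with_proj (mk_symmetric (comm_graph l \<Gamma>))))"
      using assms(2,3)
      by (simp add: Digraph_Component.connected_def strongly_connected_def reachable_def comm_graph_def mk_symmetric_def)
    then show ?thesis
      by (rule *) (auto simp: comm_graph_def mk_symmetric_def arcs_ends_def arc_to_ends_def neighbours_def)
  qed
qed

text \<open>A discrete Poincare inequality, by induction along paths between two nodes. The constant
  depends on the graph alone, so it can be fixed before the form and the errors are known.\<close>

lemma disagreement_bound:
  assumes \<Gamma>: "\<forall>i<l. \<forall>j<l. \<Gamma> $$ (i, j) \<in> {0, 1}"
    and conn: "\<And>u v. u < l \<Longrightarrow> v < l \<Longrightarrow> (u, v) \<in> (neighbours l \<Gamma>)\<^sup>*"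
  shows "\<exists>\<Lambda>\<ge>0. \<forall>q e. psd_form n q \<longrightarrow>
    (\<Sum>i<l. \<Sum>j<l. q (e i - e j) (e i - e j)) \<le> \<Lambda> * (\<Sum>i<l. \<Sum>j<l. \<Gamma> $$ (i, j) * q (e i - e j) (e i - e j))"
proof -
  define S where "S q e = (\<Sum>i<l. \<Sum>j<l. \<Gamma> $$ (i, j) * q (e i - e j) (e i - e j))"
    for q :: "(nat \<Rightarrow> real) \<Rightarrow> (nat \<Rightarrow> real) \<Rightarrow> real" and e
  have term_le: "\<Gamma> $$ (i, j) * q (e i - e j) (e i - e j) \<le> S q e" if "psd_form n q" "i < l" "j < l" for q e i j
  proof -
    have nonneg: "0 \<le> \<Gamma> $$ (i, j) * q (e i - e j) (e i - e j)" if "i < l" "j < l" for i j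
      using \<Gamma> that psd_nonneg[OF \<open>psd_form n q\<close>] by force
    have "\<Gamma> $$ (i, j) * q (e i - e j) (e i - e j) \<le> (\<Sum>j<l. \<Gamma> $$ (i, j) * q (e i - e j) (e i - e j))"
      using that nonneg by (intro member_le_sum) auto
    also have "\<dots> \<le> S q e"
      unfolding S_def using that nonneg
      by (intro member_le_sum[where f = "\<lambda>i. \<Sum>j<l. \<Gamma> $$ (i, j) * q (e i - e j) (e i - e j)"]) (auto intro!: sum_nonneg)
    finally show ?thesis .
  qed
  have "\<exists>c\<ge>0. \<forall>q e. psd_form n q \<longrightarrow> q (e u - e v) (e u - e v) \<le> c * S q e"
    if "(u, v) \<in> (neighbours l \<Gamma>)\<^sup>*" for u v
    using that
  proof (induction rule: rtrancl_induct)
    case base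
    have "q (e u - e u) (e u - e u) = 0" if "psd_form n q" for q and e :: "nat \<Rightarrow> nat \<Rightarrow> real"
      unfolding diff_self by (rule psd_zero(1)[OF that])
    then show ?case by (intro exI[of _ 0]) (metis mult_zero_left order_refl)
  next
    case (step v w)
    then obtain c where c: "c \<ge> 0" "\<And>q e. psd_form n q \<Longrightarrow> q (e u - e v) (e u - e v) \<le> c * S q e" by blast
    \<comment> \<open>Doubling comes from \<open>psd_add_le\<close>; the \<open>+ 2\<close> is the
      contribution of the new edge.\<close>
    have "q (e u - e w) (e u - e w) \<le> (2 * c + 2) * S q e" if q: "psd_form n q" for q e
    proof -
      have "q (e v - e w) (e v - e w) \<le> S q e"
        using step.hyps(2) term_le[OF q, of v w e] term_le[OF q, of w v e] psd_diff_commute[OF q, of "e v" "e w"]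
        by (auto simp: neighbours_def)
      moreover have "q ((e u - e v) + (e v - e w)) ((e u - e v) + (e v - e w))
          \<le> 2 * q (e u - e v) (e u - e v) + 2 * q (e v - e w) (e v - e w)"
        by (rule psd_add_le[OF q])
      ultimately show ?thesis using c(2)[OF q, of e] by (simp add: algebra_simps)
    qed
    moreover have "0 \<le> 2 * c + 2" using c(1) by simp
    ultimately show ?case by blast
  qed
  then have "\<forall>u v. \<exists>c\<ge>0. u < l \<longrightarrow> v < l \<longrightarrow> (\<forall>q e. psd_form n q \<longrightarrow> q (e u - e v) (e u - e v) \<le> c * S q e)"
    using conn by (metis order_refl)
  then obtain c where c: "\<And>u v. 0 \<le> c u v" "\<And>u v q e. u < l \<Longrightarrow> v < l \<Longrightarrow> psd_form n q \<Longrightarrow>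
      q (e u - e v) (e u - e v) \<le> c u v * S q e" by metis
  have "(\<Sum>i<l. \<Sum>j<l. q (e i - e j) (e i - e j)) \<le> (\<Sum>i<l. \<Sum>j<l. c i j) * S q e" if "psd_form n q" for q e
    unfolding sum_distrib_right using c(2) that by (intro sum_mono) auto
  moreover have "0 \<le> (\<Sum>i<l. \<Sum>j<l. c i j)" by (intro sum_nonneg c)
  ultimately show ?thesis unfolding S_def by blast
qed

text \<open>By polarisation, \<open>2 * q (e i) (e j - e i)\<close> is
  \<open>q (e j) (e j) - q (e i) (e i)\<close> minus the disagreement. After summation the first two
  terms carry column and row sums of \<open>\<Gamma>\<close>, which balance makes cancel.\<close>

lemma balanced_coupling:
  assumes bal: "balanced_graph l \<Gamma>" and q: "psd_form n q"
  shows "(\<Sum>i<l. 2 * q (e i) (\<Sum>j<l. \<Gamma> $$ (i, j) *\<^sub>R (e j - e i)))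
    = - (\<Sum>i<l. \<Sum>j<l. \<Gamma> $$ (i, j) * q (e i - e j) (e i - e j))"
proof -
  have "2 * q (e i) (\<Sum>j<l. \<Gamma> $$ (i, j) *\<^sub>R (e j - e i))
      = (\<Sum>j<l. \<Gamma> $$ (i, j) * q (e j) (e j)) - (\<Sum>j<l. \<Gamma> $$ (i, j)) * q (e i) (e i)
        - (\<Sum>j<l. \<Gamma> $$ (i, j) * q (e i - e j) (e i - e j))" for i
  proof -
    have "2 * q (e i) (\<Sum>j<l. \<Gamma> $$ (i, j) *\<^sub>R (e j - e i)) = (\<Sum>j<l. \<Gamma> $$ (i, j) * (2 * q (e i) (e j - e i)))"
      by (simp only: linear_sum[OF psd_linear_right[OF q]] psd_scaleR[OF q] sum_distrib_left mult.left_commute)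
    also have "\<dots> = (\<Sum>j<l. \<Gamma> $$ (i, j) * q (e j) (e j) - \<Gamma> $$ (i, j) * q (e i) (e i)
        - \<Gamma> $$ (i, j) * q (e i - e j) (e i - e j))"
    proof (rule sum.cong[OF refl])
      fix j
      have "2 * q (e i) (e j - e i) = q (e j) (e j) - q (e i) (e i) - q (e i - e j) (e i - e j)"
        using psd_commute[OF q, of "e j" "e i"] by (simp only: psd_diff[OF q]) simp
      then show "\<Gamma> $$ (i, j) * (2 * q (e i) (e j - e i)) = \<Gamma> $$ (i, j) * q (e j) (e j)
          - \<Gamma> $$ (i, j) * q (e i) (e i) - \<Gamma> $$ (i, j) * q (e i - e j) (e i - e j)"
        by (simp only: right_diff_distrib)
    qed
    finally show ?thesis by (simp add: sum_subtractf sum_distrib_right)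
  qed
  then have "(\<Sum>i<l. 2 * q (e i) (\<Sum>j<l. \<Gamma> $$ (i, j) *\<^sub>R (e j - e i)))
      = (\<Sum>i<l. \<Sum>j<l. \<Gamma> $$ (i, j) * q (e j) (e j)) - (\<Sum>i<l. (\<Sum>j<l. \<Gamma> $$ (i, j)) * q (e i) (e i))
        - (\<Sum>i<l. \<Sum>j<l. \<Gamma> $$ (i, j) * q (e i - e j) (e i - e j))"
    by (simp add: sum_subtractf)
  also have "(\<Sum>i<l. \<Sum>j<l. \<Gamma> $$ (i, j) * q (e j) (e j)) = (\<Sum>j<l. (\<Sum>i<l. \<Gamma> $$ (i, j)) * q (e j) (e j))"
    by (subst sum.swap) (simp add: sum_distrib_right)
  also have "\<dots> = (\<Sum>i<l. (\<Sum>j<l. \<Gamma> $$ (i, j)) * q (e i) (e i))"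
    using bal by (simp add: balanced_graph_def)
  finally show ?thesis by (simp only: diff_self diff_0)
qed

text \<open>Riesz representation for a degenerate form: the kernel condition takes over the role of
  definiteness. It yields the columns of the gains.\<close>

lemma psd_represent:
  assumes q: "psd_form n q" and ker: "\<And>x. q x x = 0 \<Longrightarrow> dot n c x = 0"
  shows "\<exists>v. \<forall>x. q v x = dot n c x"
proof -
  have row: "dot n (\<lambda>i. q (unit_fun j) (unit_fun i)) x = q (unit_fun j) x" for j x
    by (subst (2) psd_commute[OF q], subst psd_expand[OF q])
       (simp add: dot_def psd_commute[OF q, of "unit_fun j"] mult.commute)
  have "\<exists>v. \<forall>i<n. c i = (\<Sum>j<n. v j * q (unit_fun j) (unit_fun i))"
  proof (rule dual_span[where f = "\<lambda>j i. q (unit_fun j) (unit_fun i)"])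
    fix x assume "\<forall>j\<in>{..<n}. dot n (\<lambda>i. q (unit_fun j) (unit_fun i)) x = 0"
    then have "q x x = 0" by (subst psd_expand[OF q]) (simp add: row)
    then show "dot n c x = 0" by (rule ker)
  qed simp
  then obtain v where v: "\<And>i. i < n \<Longrightarrow> c i = (\<Sum>j<n. v j * q (unit_fun j) (unit_fun i))" by blast
  have "q v x = dot n c x" for x
  proof -
    have "q v x = (\<Sum>j<n. v j * dot n (\<lambda>i. q (unit_fun j) (unit_fun i)) x)"
      unfolding row by (rule psd_expand[OF q])
    also have "\<dots> = (\<Sum>i<n. (\<Sum>j<n. v j * q (unit_fun j) (unit_fun i)) * x i)"
      unfolding dot_def sum_distrib_left sum_distrib_right by (subst sum.swap) (simp add: mult.assoc)
    also have "\<dots> = dot n c x" by (simp add: dot_def v)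
    finally show ?thesis .
  qed
  then show ?thesis by blast
qed

text \<open>Node \<open>i\<close> needs the full output term \<open>qc (e i)\<close> but injects
  only \<open>ql i (e i)\<close>. Replacing \<open>e i\<close> by \<open>e j\<close> in the
  \<open>j\<close>-th output costs a disagreement term and leaves \<open>O'\<close>, once for each
  of the \<open>l\<close> nodes; hence \<open>real l\<close> in \<open>v\<close> and the threshold
  for \<open>g\<close>.\<close>

lemma network_lyapunov:
  fixes c :: "nat \<Rightarrow> nat \<Rightarrow> nat \<Rightarrow> real"
  assumes X: "psd_form n X" and "0 \<le> \<kappa>" "0 \<le> \<beta>"
    and qc: "\<And>x. qc x = (\<Sum>i<l. \<Sum>k<p i. (dot n (c i k) x)\<^sup>2)"
    and lyap: "\<And>x. 2 * X x (mat_act n a x) \<le> - \<epsilon> * X x x + \<kappa> * qc x"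
    and qc_le: "\<And>x. qc x \<le> \<beta> * X x x"
    and v: "\<And>i k x. i < l \<Longrightarrow> k < p i \<Longrightarrow> X (v i k) x = \<kappa> * real l * dot n (c i k) x"
    and bal: "balanced_graph l \<Gamma>"
    and \<Lambda>: "0 \<le> \<Lambda>" "\<And>e. (\<Sum>i<l. \<Sum>j<l. X (e i - e j) (e i - e j))
        \<le> \<Lambda> * (\<Sum>i<l. \<Sum>j<l. \<Gamma> $$ (i, j) * X (e i - e j) (e i - e j))"
    and \<Gamma>: "\<And>i j. i < l \<Longrightarrow> j < l \<Longrightarrow> 0 \<le> \<Gamma> $$ (i, j)"
    and g: "2 * \<kappa> * \<beta> * \<Lambda> \<le> g"
  shows "(\<Sum>i<l. 2 * X (e i) (mat_act n a (e i) - (\<Sum>k<p i. dot n (c i k) (e i) *\<^sub>R v i k)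
      + g *\<^sub>R (\<Sum>j<l. \<Gamma> $$ (i, j) *\<^sub>R (e j - e i)))) \<le> - \<epsilon> * (\<Sum>i<l. X (e i) (e i))"
proof -
  define ql where "ql j x = (\<Sum>k<p j. (dot n (c j k) x)\<^sup>2)" for j x
  define D where "D = (\<Sum>i<l. \<Sum>j<l. X (e i - e j) (e i - e j))"
  define S where "S = (\<Sum>i<l. \<Sum>j<l. \<Gamma> $$ (i, j) * X (e i - e j) (e i - e j))"
  define O' where "O' = (\<Sum>j<l. ql j (e j))"
  have S0: "0 \<le> S"
    unfolding S_def using \<Gamma> psd_nonneg[OF X] by (intro sum_nonneg mult_nonneg_nonneg) auto
  have ql0: "0 \<le> ql j x" for j x unfolding ql_def by (intro sum_nonneg) auto
  \<comment> \<open>The price of evaluating output \<open>j\<close> at another node's error; it is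
    finite because \<open>qc\<close> is dominated by \<open>X\<close>.\<close>
  have ql_le: "ql j x \<le> 2 * ql j y + 2 * \<beta> * X (x - y) (x - y)" if "j < l" for j x y
  proof -
    have "ql j x \<le> (\<Sum>k<p j. 2 * (dot n (c j k) y)\<^sup>2 + 2 * (dot n (c j k) (x - y))\<^sup>2)"
      unfolding ql_def
    proof (rule sum_mono)
      fix k
      have "dot n (c j k) x = dot n (c j k) y + dot n (c j k) (x - y)"
        by (simp add: linear_diff[OF linear_dot])
      then show "(dot n (c j k) x)\<^sup>2 \<le> 2 * (dot n (c j k) y)\<^sup>2 + 2 * (dot n (c j k) (x - y))\<^sup>2"
        using sum_squares_bound[of "dot n (c j k) y" "dot n (c j k) (x - y)"] by (simp add: power2_sum)
    qed
    also have "\<dots> = 2 * ql j y + 2 * ql j (x - y)"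
      by (simp add: ql_def sum.distrib sum_distrib_left)
    also have "ql j (x - y) \<le> qc (x - y)"
      using that ql0 member_le_sum[of j "{..<l}" "\<lambda>j. ql j (x - y)"] by (simp add: qc ql_def)
    also have "\<dots> \<le> \<beta> * X (x - y) (x - y)" by (rule qc_le)
    finally show ?thesis by simp
  qed
  have "2 * X (e i) (mat_act n a (e i)) \<le> - \<epsilon> * X (e i) (e i)
      + \<kappa> * (2 * O' + 2 * \<beta> * (\<Sum>j<l. X (e i - e j) (e i - e j)))" for i
  proof -
    have "qc (e i) = (\<Sum>j<l. ql j (e i))" by (simp add: qc ql_def)
    also have "\<dots> \<le> (\<Sum>j<l. 2 * ql j (e j) + 2 * \<beta> * X (e i - e j) (e i - e j))"
      using ql_le by (intro sum_mono) auto
    also have "\<dots> = 2 * O' + 2 * \<beta> * (\<Sum>j<l. X (e i - e j) (e i - e j))"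
      by (simp add: O'_def sum.distrib sum_distrib_left)
    finally have "\<kappa> * qc (e i) \<le> \<kappa> * (2 * O' + 2 * \<beta> * (\<Sum>j<l. X (e i - e j) (e i - e j)))"
      using \<open>0 \<le> \<kappa>\<close> by (rule mult_left_mono)
    then show ?thesis using lyap[of "e i"] by simp
  qed
  then have "(\<Sum>i<l. 2 * X (e i) (mat_act n a (e i)))
      \<le> (\<Sum>i<l. - \<epsilon> * X (e i) (e i) + \<kappa> * (2 * O' + 2 * \<beta> * (\<Sum>j<l. X (e i - e j) (e i - e j))))"
    by (intro sum_mono) auto
  also have "\<dots> = - \<epsilon> * (\<Sum>i<l. X (e i) (e i)) + 2 * \<kappa> * real l * O' + 2 * \<kappa> * \<beta> * D"
    by (simp add: D_def sum.distrib sum_subtractf sum_negf sum_distrib_left algebra_simps)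
  finally have 1: "(\<Sum>i<l. 2 * X (e i) (mat_act n a (e i)))
      \<le> - \<epsilon> * (\<Sum>i<l. X (e i) (e i)) + 2 * \<kappa> * real l * O' + 2 * \<kappa> * \<beta> * D" .
  have "X (e i) (\<Sum>k<p i. dot n (c i k) (e i) *\<^sub>R v i k) = \<kappa> * real l * ql i (e i)" if "i < l" for i
    using that v
    by (simp add: linear_sum[OF psd_linear_right[OF X]] psd_scaleR[OF X] psd_commute[OF X, of "e i"]
        ql_def sum_distrib_left power2_eq_square algebra_simps)
  then have 2: "(\<Sum>i<l. 2 * X (e i) (\<Sum>k<p i. dot n (c i k) (e i) *\<^sub>R v i k)) = 2 * \<kappa> * real l * O'"
    by (simp add: O'_def sum_distrib_left mult.assoc)
  have 3: "(\<Sum>i<l. 2 * X (e i) (\<Sum>j<l. \<Gamma> $$ (i, j) *\<^sub>R (e j - e i))) = - S"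
    unfolding S_def by (rule balanced_coupling[OF bal X])
  \<comment> \<open>The total disagreement is reduced to that along arcs, which the coupling damps
    with strength \<open>g\<close>.\<close>
  have "2 * \<kappa> * \<beta> * D \<le> 2 * \<kappa> * \<beta> * (\<Lambda> * S)"
    using \<Lambda>(2)[of e] \<open>0 \<le> \<kappa>\<close> \<open>0 \<le> \<beta>\<close> unfolding D_def S_def by (intro mult_left_mono) auto
  also have "\<dots> \<le> g * S"
    using mult_right_mono[OF g S0] by (simp add: mult.assoc)
  finally have 4: "2 * \<kappa> * \<beta> * D \<le> g * S" .
  have "(\<Sum>i<l. 2 * X (e i) (mat_act n a (e i) - (\<Sum>k<p i. dot n (c i k) (e i) *\<^sub>R v i k)
      + g *\<^sub>R (\<Sum>j<l. \<Gamma> $$ (i, j) *\<^sub>R (e j - e i))))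
    = (\<Sum>i<l. 2 * X (e i) (mat_act n a (e i)) - 2 * X (e i) (\<Sum>k<p i. dot n (c i k) (e i) *\<^sub>R v i k)
      + g * (2 * X (e i) (\<Sum>j<l. \<Gamma> $$ (i, j) *\<^sub>R (e j - e i))))"
    by (intro sum.cong refl) (simp only: psd_add[OF X] psd_diff[OF X] psd_scaleR[OF X], simp add: algebra_simps)
  also have "\<dots> = (\<Sum>i<l. 2 * X (e i) (mat_act n a (e i))) - 2 * \<kappa> * real l * O' + g * - S"
    by (simp only: sum.distrib sum_subtractf 2 3[symmetric] sum_distrib_left)
  also have "\<dots> \<le> - \<epsilon> * (\<Sum>i<l. X (e i) (e i))" using 1 4 by simp
  finally show ?thesis .
qed

text \<open>Gronwall with an integrating factor. The reference time is 1 because differentiability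
  is available for positive times only.\<close>

lemma exponential_decay:
  fixes V V' :: "real \<Rightarrow> real"
  assumes "\<And>t. 0 < t \<Longrightarrow> (V has_real_derivative V' t) (at t)"
    and "\<And>t. 0 < t \<Longrightarrow> V' t \<le> - \<epsilon> * V t" and "1 \<le> t"
  shows "V t \<le> V 1 * exp \<epsilon> * exp (- \<epsilon> * t)"
proof -
  have "V t * exp (\<epsilon> * t) \<le> V 1 * exp (\<epsilon> * 1)"
  proof (rule DERIV_nonpos_imp_nonincreasing[OF \<open>1 \<le> t\<close>])
    fix s :: real assume "1 \<le> s" "s \<le> t"
    then have s: "0 < s" by simp
    have "((\<lambda>t. V t * exp (\<epsilon> * t)) has_real_derivative (V' s + \<epsilon> * V s) * exp (\<epsilon> * s)) (at s)"
      using assms(1)[OF s] by (auto intro!: derivative_eq_intros simp: algebra_simps)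
    moreover have "(V' s + \<epsilon> * V s) * exp (\<epsilon> * s) \<le> 0"
      using assms(2)[OF s] by (intro mult_nonpos_nonneg) auto
    ultimately show "\<exists>y. ((\<lambda>t. V t * exp (\<epsilon> * t)) has_real_derivative y) (at s) \<and> y \<le> 0" by blast
  qed
  then show ?thesis by (simp add: exp_minus field_simps)
qed

section \<open>Detectability and solutions of the system\<close>

lemma mult_mat_vec_entry:
  fixes A :: "real mat"
  assumes "A \<in> carrier_mat m n" "x \<in> carrier_vec n" "i < m"
  shows "(A *\<^sub>v x) $ i = (\<Sum>j<n. A $$ (i, j) * x $ j)"
  using assms by (simp add: scalar_prod_def lessThan_atLeast0)

lemma eucl_norm_eqI:
  assumes "dim_vec v = dim_vec v'" "\<And>i. i < dim_vec v' \<Longrightarrow> \<bar>v $ i\<bar> = \<bar>v' $ i\<bar>"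
  shows "eucl_norm v = eucl_norm v'"
proof -
  have "(v $ i)\<^sup>2 = (v' $ i)\<^sup>2" if "i < dim_vec v'" for i
    using assms(2)[OF that] by (simp add: power2_eq_iff abs_eq_iff)
  then show ?thesis using assms(1) by (simp add: eucl_norm_def L2_set_def)
qed

lemma stack_mats_carrier:
  assumes "\<forall>i<l. M i \<in> carrier_mat (p i) k"
  shows "stack_mats l k M \<in> carrier_mat (\<Sum>i<l. p i) k"
proof -
  have "length (concat (map (\<lambda>i. rows (M i)) [0..<l])) = (\<Sum>i<l. p i)"
    using assms by (induction l) (auto simp: length_concat)
  then show ?thesis unfolding stack_mats_def by (metis mat_of_rows_carrier(1))
qed

text \<open>Detectability concerns pairs of states with equal outputs, so equality is what has to
  pass between the stacked and the separate outputs.\<close>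

lemma stack_mats_mult_eq_iff:
  fixes x x' :: "real vec"
  assumes M: "\<forall>i<l. M i \<in> carrier_mat (p i) k" and x: "x \<in> carrier_vec k" "x' \<in> carrier_vec k"
  shows "stack_mats l k M *\<^sub>v x = stack_mats l k M *\<^sub>v x' \<longleftrightarrow> (\<forall>i<l. M i *\<^sub>v x = M i *\<^sub>v x')"
proof -
  let ?rs = "concat (map (\<lambda>i. rows (M i)) [0..<l])"
  have rs: "v \<in> carrier_vec k" if "v \<in> set ?rs" for v
    using that M by (auto simp: rows_def)
  have dim: "dim_row (stack_mats l k M) = length ?rs" by (simp add: stack_mats_def)
  have row: "row (stack_mats l k M) q = ?rs ! q" if "q < length ?rs" for q
    unfolding stack_mats_def using that rs[OF nth_mem[OF that]] by (intro mat_of_rows_row) auto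
  have mult_eq: "N *\<^sub>v x = N *\<^sub>v x' \<longleftrightarrow> (\<forall>q<dim_row N. row N q \<bullet> x = row N q \<bullet> x')" for N :: "real mat"
    by (auto simp: vec_eq_iff mult_mat_vec_def)
  have "stack_mats l k M *\<^sub>v x = stack_mats l k M *\<^sub>v x' \<longleftrightarrow> (\<forall>q<length ?rs. (?rs ! q) \<bullet> x = (?rs ! q) \<bullet> x')"
    unfolding mult_eq dim using row by simp
  also have "\<dots> \<longleftrightarrow> (\<forall>v\<in>set ?rs. v \<bullet> x = v \<bullet> x')"
    by (simp only: all_set_conv_all_nth)
  also have "\<dots> \<longleftrightarrow> (\<forall>i<l. \<forall>j<dim_row (M i). row (M i) j \<bullet> x = row (M i) j \<bullet> x')"
    by (auto simp: rows_def)
  also have "\<dots> \<longleftrightarrow> (\<forall>i<l. M i *\<^sub>v x = M i *\<^sub>v x')"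
    unfolding mult_eq ..
  finally show ?thesis .
qed

text \<open>The difference of the two plant solutions is itself a solution with zero input and
  output. With these data the estimator admits the zero solution, so omniscience forces the
  difference of the \<open>z\<close> to vanish asymptotically.\<close>

lemma detectable_of_estimator:
  fixes A B K \<Gamma> :: "real mat" and C D :: "nat \<Rightarrow> real mat"
  assumes "0 < l"
    and A: "A \<in> carrier_mat n n" and B: "B \<in> carrier_mat n m"
    and C: "\<forall>i<l. C i \<in> carrier_mat (p i) n" and D: "\<forall>i<l. D i \<in> carrier_mat (p i) m"
    and K: "K \<in> carrier_mat r n"
    and \<Gamma>: "\<forall>i<l. \<forall>j<l. \<Gamma> $$ (i, j) \<in> {0, 1}"
    and est: "\<forall>i<l. N i \<in> carrier_mat (ls i) (ls i) \<and> H i \<in> carrier_mat (ls i) m \<and>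
               L i \<in> carrier_mat (ls i) (p i) \<and> M i \<in> carrier_mat (ls i) (ls i) \<and>
               R i \<in> carrier_mat r (ls i)"
    and ls: "\<forall>i<l. \<forall>j<l. \<Gamma> $$ (i, j) = 1 \<longrightarrow> ls i = ls j"
    and omn: "achieves_omniscience l A B C D K \<Gamma> g ls N H L M R"
  shows "jointly_partially_detectable l A B C D K"
  unfolding jointly_partially_detectable_def partially_detectable_def
proof (intro allI impI)
  let ?C = "stack_mats l (dim_row A) C" and ?D = "stack_mats l (dim_col B) D"
  fix x1 x2 u y z1 z2
  assume sol1: "lti_solution A B ?C ?D K x1 u y z1" and sol2: "lti_solution A B ?C ?D K x2 u y z2"
  have dims: "dim_row A = n" "dim_col B = m" "dim_row K = r" using A B K by auto
  have x12: "x1 \<in> L1_loc n" "x2 \<in> L1_loc n" and u: "u \<in> L1_loc m" and z12: "z1 \<in> L1_loc r" "z2 \<in> L1_loc r"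
    using sol1 sol2 by (auto simp: lti_solution_def dims)
  have cx: "x1 t \<in> carrier_vec n" "x2 t \<in> carrier_vec n" and cu: "u t \<in> carrier_vec m"
    and cz: "z1 t \<in> carrier_vec r" "z2 t \<in> carrier_vec r" for t
    using L1_loc_carrier x12 u z12 by auto
  have cC: "?C \<in> carrier_mat (\<Sum>i<l. p i) n" and cD: "?D \<in> carrier_mat (\<Sum>i<l. p i) m"
    using stack_mats_carrier[OF C] stack_mats_carrier[OF D] by (auto simp: dims)
  have ae: "AE t in lebesgue. y t = ?C *\<^sub>v x1 t + ?D *\<^sub>v u t" "AE t in lebesgue. y t = ?C *\<^sub>v x2 t + ?D *\<^sub>v u t"
    "AE t in lebesgue. z1 t = K *\<^sub>v x1 t" "AE t in lebesgue. z2 t = K *\<^sub>v x2 t"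
    using sol1 sol2 by (auto simp: lti_solution_def)
  define x where "x t = x1 t - x2 t" for t
  define z where "z t = z1 t - z2 t" for t
  have dist: "distributed_solution l A B C D K x (\<lambda>t. 0\<^sub>v m) (\<lambda>i t. 0\<^sub>v (p i)) z"
    unfolding distributed_solution_def
  proof (intro conjI allI impI)
    show "x \<in> L1_loc (dim_row A)" unfolding x_def[abs_def] dims by (rule L1_loc_diff[OF x12])
    show "z \<in> L1_loc (dim_row K)" unfolding z_def[abs_def] dims by (rule L1_loc_diff[OF z12])
    show "(\<lambda>t. 0\<^sub>v m) \<in> L1_loc (dim_col B)" unfolding dims by (rule L1_loc_zero)
    show "(\<lambda>t. 0\<^sub>v (p i)) \<in> L1_loc (dim_row (C i))" if "i < l" for i
      using C that L1_loc_zero by auto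
    have "has_weak_deriv n x (\<lambda>t. (A *\<^sub>v x1 t + B *\<^sub>v u t) - (A *\<^sub>v x2 t + B *\<^sub>v u t))"
      unfolding x_def[abs_def] using sol1 sol2 by (intro has_weak_deriv_diff) (auto simp: lti_solution_def dims)
    moreover have "(A *\<^sub>v x1 t + B *\<^sub>v u t) - (A *\<^sub>v x2 t + B *\<^sub>v u t) = A *\<^sub>v x t + B *\<^sub>v 0\<^sub>v m" for t
      unfolding x_def mult_minus_distrib_mat_vec[OF A cx] using A B cx[of t] cu[of t]
      by (intro eq_vecI) auto
    ultimately show "has_weak_deriv (dim_row A) x (\<lambda>t. A *\<^sub>v x t + B *\<^sub>v 0\<^sub>v m)" by (simp add: dims)
    have "AE t in lebesgue. \<forall>i<l. C i *\<^sub>v x1 t = C i *\<^sub>v x2 t"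
      using ae(1,2)
    proof eventually_elim
      case (elim t)
      then have "?C *\<^sub>v x1 t + ?D *\<^sub>v u t = ?C *\<^sub>v x2 t + ?D *\<^sub>v u t" by simp
      then have eq: "(?C *\<^sub>v x1 t + ?D *\<^sub>v u t) - ?D *\<^sub>v u t = (?C *\<^sub>v x2 t + ?D *\<^sub>v u t) - ?D *\<^sub>v u t" by simp
      have cancel: "(v + w) - w = v" if "v \<in> carrier_vec q" "w \<in> carrier_vec q" for v w :: "real vec" and q
        using that by (intro eq_vecI) auto
      have "?C *\<^sub>v x1 t = ?C *\<^sub>v x2 t"
        using eq cancel[OF mult_mat_vec_carrier[OF cC cx(1)] mult_mat_vec_carrier[OF cD cu]]
          cancel[OF mult_mat_vec_carrier[OF cC cx(2)] mult_mat_vec_carrier[OF cD cu]] by simp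
      then show ?case using stack_mats_mult_eq_iff[OF C cx] by (simp add: dims)
    qed
    then show "AE t in lebesgue. 0\<^sub>v (p i) = C i *\<^sub>v x t + D i *\<^sub>v 0\<^sub>v m" if i: "i < l" for i
    proof eventually_elim
      case (elim t)
      have Ci: "C i \<in> carrier_mat (p i) n" and Di: "D i \<in> carrier_mat (p i) m" using C D i by auto
      show ?case
        unfolding x_def mult_minus_distrib_mat_vec[OF Ci cx] using elim i Ci Di
        by (intro eq_vecI) auto
    qed
    show "AE t in lebesgue. z t = K *\<^sub>v x t"
      using ae(3,4)
    proof eventually_elim
      case (elim t)
      then show ?case unfolding z_def x_def mult_minus_distrib_mat_vec[OF K cx] by simp
    qed
  qed
  have "estimator_solution l \<Gamma> g ls N H L M R (\<lambda>i t. 0\<^sub>v (ls i)) (\<lambda>t. 0\<^sub>v m) (\<lambda>i t. 0\<^sub>v (p i)) (\<lambda>i t. 0\<^sub>v r)"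
    unfolding estimator_solution_def
  proof (intro allI impI conjI)
    fix i assume i: "i < l"
    have e: "N i \<in> carrier_mat (ls i) (ls i)" "H i \<in> carrier_mat (ls i) m" "L i \<in> carrier_mat (ls i) (p i)"
      "M i \<in> carrier_mat (ls i) (ls i)" "R i \<in> carrier_mat r (ls i)"
      using est i by auto
    have "coupling l \<Gamma> ls (\<lambda>i t. 0\<^sub>v (ls i)) i t = 0\<^sub>v (ls i)" for t
    proof (rule eq_vecI)
      fix k assume "k < dim_vec (0\<^sub>v (ls i) :: real vec)"
      then have k: "k < ls i" by simp
      \<comment> \<open>Along an arc the dimensions coincide and both entries are 0; otherwise the
        index may be out of range and the entry unspecified, but it is multiplied by 0.\<close>
      have 0: "\<Gamma> $$ (i, j) * (0\<^sub>v (ls j) $ k - 0\<^sub>v (ls i) $ k) = 0" if "j < l" for j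
        using \<Gamma> ls i that k by (cases "\<Gamma> $$ (i, j) = 1") auto
      have "(\<Sum>j<l. \<Gamma> $$ (i, j) * (0\<^sub>v (ls j) $ k - 0\<^sub>v (ls i) $ k)) = 0"
        by (intro sum.neutral ballI 0) simp
      then show "coupling l \<Gamma> ls (\<lambda>i t. 0\<^sub>v (ls i)) i t $ k = 0\<^sub>v (ls i) $ k"
        using k by (simp add: coupling_def)
    qed (simp add: coupling_def)
    then have "N i *\<^sub>v 0\<^sub>v (ls i) + H i *\<^sub>v 0\<^sub>v m + L i *\<^sub>v 0\<^sub>v (p i)
        + g \<cdot>\<^sub>v (M i *\<^sub>v coupling l \<Gamma> ls (\<lambda>i t. 0\<^sub>v (ls i)) i t) = 0\<^sub>v (ls i)" for t
      using e by auto
    then show "has_weak_deriv (ls i) (\<lambda>t. 0\<^sub>v (ls i)) (\<lambda>t. N i *\<^sub>v 0\<^sub>v (ls i) + H i *\<^sub>v 0\<^sub>v m + L i *\<^sub>v 0\<^sub>v (p i)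
        + g \<cdot>\<^sub>v (M i *\<^sub>v coupling l \<Gamma> ls (\<lambda>i t. 0\<^sub>v (ls i)) i t))"
      by (simp add: has_weak_deriv_zero)
    show "AE t in lebesgue. 0\<^sub>v r = R i *\<^sub>v 0\<^sub>v (ls i)" using e by (intro AE_I2) auto
  qed (use est L1_loc_zero in auto)
  then have "ess_tendsto_zero (\<lambda>t. 0\<^sub>v r - z t)"
    using omn dist \<open>0 < l\<close> unfolding achieves_omniscience_def by blast
  moreover have "eucl_norm (0\<^sub>v r - z t) = eucl_norm (z1 t - z2 t)" for t
    unfolding z_def using cz[of t] by (intro eucl_norm_eqI) auto
  ultimately show "ess_tendsto_zero (\<lambda>t. z1 t - z2 t)" by (simp add: ess_tendsto_zero_def)
qed

text \<open>The flow from \<open>x0\<close> and the zero solution share input 0 and output 0, so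
  detectability applies to this pair; continuity upgrades the essential limit to an ordinary
  one.\<close>

lemma unobservable_decay:
  fixes A B K :: "real mat" and C D :: "nat \<Rightarrow> real mat"
  assumes A: "A \<in> carrier_mat n n" and B: "B \<in> carrier_mat n m"
    and C: "\<forall>i<l. C i \<in> carrier_mat (p i) n" and D: "\<forall>i<l. D i \<in> carrier_mat (p i) m"
    and K: "K \<in> carrier_mat r n"
    and det: "jointly_partially_detectable l A B C D K"
    and flow0: "\<And>t i k. i < l \<Longrightarrow> k < p i \<Longrightarrow> dot n (\<lambda>j. C i $$ (k, j)) (flow n (\<lambda>i j. A $$ (i, j)) t x0) = 0"
  shows "((\<lambda>t. \<Sum>b<r. (dot n (\<lambda>j. K $$ (b, j)) (flow n (\<lambda>i j. A $$ (i, j)) t x0))\<^sup>2) \<longlongrightarrow> 0) at_top"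
proof -
  let ?a = "\<lambda>i j. A $$ (i, j)"
  let ?C = "stack_mats l (dim_row A) C" and ?D = "stack_mats l (dim_col B) D"
  have dims: "dim_row A = n" "dim_col B = m" "dim_row K = r" using A B K by auto
  have cC: "?C \<in> carrier_mat (\<Sum>i<l. p i) n" and cD: "?D \<in> carrier_mat (\<Sum>i<l. p i) m"
    using stack_mats_carrier[OF C] stack_mats_carrier[OF D] by (auto simp: dims)
  define x where "x t = vec n (flow n ?a t x0)" for t
  have cx: "x t \<in> carrier_vec n" for t by (simp add: x_def)
  have entry: "(M *\<^sub>v x t) $ b = dot n (\<lambda>j. M $$ (b, j)) (flow n ?a t x0)"
    if "M \<in> carrier_mat q n" "b < q" for M q b t
    using mult_mat_vec_entry[OF that(1) cx that(2)] by (simp add: dot_def x_def)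
  have cont_flow: "continuous_on UNIV (\<lambda>t. flow n ?a t x0 j)" for j
    using DERIV_isCont[OF flow_deriv] by (simp add: continuous_at_imp_continuous_on)
  have cont: "continuous_on UNIV (\<lambda>t. dot n c (flow n ?a t x0))" for c
    unfolding dot_def by (intro continuous_intros cont_flow)
  have xL: "x \<in> L1_loc n"
    by (rule L1_loc_continuous[OF cx]) (simp add: x_def cont_flow)
  have zL: "(\<lambda>t. K *\<^sub>v x t) \<in> L1_loc r"
  proof (rule L1_loc_continuous)
    show "K *\<^sub>v x t \<in> carrier_vec r" for t using K cx by auto
    show "continuous_on UNIV (\<lambda>t. (K *\<^sub>v x t) $ i)" if "i < r" for i
      using cont by (simp only: entry[OF K that])
  qed
  have Ax: "(A *\<^sub>v x t) $ i = mat_act n ?a (flow n ?a t x0) i" if "i < n" for i t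
    using that by (simp add: entry[OF A] mat_act_def dot_def)
  have "has_weak_deriv n x (\<lambda>t. A *\<^sub>v x t)"
  proof (rule has_weak_deriv_classical[OF cx])
    show "A *\<^sub>v x t \<in> carrier_vec n" for t using A cx by auto
    show "((\<lambda>t. x t $ i) has_real_derivative (A *\<^sub>v x t) $ i) (at t)" if "i < n" for i t
    proof -
      have "(\<lambda>t. x t $ i) = (\<lambda>t. flow n ?a t x0 i)" using that by (simp add: x_def)
      then show ?thesis unfolding Ax[OF that] by (simp only: flow_deriv)
    qed
    show "continuous_on UNIV (\<lambda>t. (A *\<^sub>v x t) $ i)" if "i < n" for i
      using cont by (simp only: entry[OF A that])
  qed
  moreover have "A *\<^sub>v x t + B *\<^sub>v 0\<^sub>v m = A *\<^sub>v x t" for t using A B by (intro eq_vecI) auto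
  ultimately have wx: "has_weak_deriv n x (\<lambda>t. A *\<^sub>v x t + B *\<^sub>v 0\<^sub>v m)" by simp
  have Cx0: "?C *\<^sub>v x t = ?C *\<^sub>v 0\<^sub>v n" for t
  proof -
    have "C i *\<^sub>v x t = C i *\<^sub>v 0\<^sub>v n" if i: "i < l" for i
    proof (rule eq_vecI)
      have Ci: "C i \<in> carrier_mat (p i) n" using C i by simp
      then show "dim_vec (C i *\<^sub>v x t) = dim_vec (C i *\<^sub>v 0\<^sub>v n)" by simp
      fix k assume "k < dim_vec (C i *\<^sub>v 0\<^sub>v n)"
      then have k: "k < p i" using Ci by simp
      then show "(C i *\<^sub>v x t) $ k = (C i *\<^sub>v 0\<^sub>v n) $ k"
        using entry[OF Ci k] flow0[OF i k] Ci by simp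
    qed
    then show ?thesis using stack_mats_mult_eq_iff[OF C cx, of "0\<^sub>v n"] by (simp add: dims)
  qed
  have 0: "?C *\<^sub>v 0\<^sub>v n + ?D *\<^sub>v 0\<^sub>v m = 0\<^sub>v (\<Sum>i<l. p i)" using cC cD by auto
  have sol1: "lti_solution A B ?C ?D K x (\<lambda>t. 0\<^sub>v m) (\<lambda>t. 0\<^sub>v (\<Sum>i<l. p i)) (\<lambda>t. K *\<^sub>v x t)"
    using cC cD xL zL wx L1_loc_zero by (auto simp: lti_solution_def dims Cx0[unfolded dims] 0[unfolded dims])
  have "A *\<^sub>v 0\<^sub>v n + B *\<^sub>v 0\<^sub>v m = 0\<^sub>v n" "K *\<^sub>v 0\<^sub>v n = 0\<^sub>v r" using A B K by auto
  then have sol2: "lti_solution A B ?C ?D K (\<lambda>t. 0\<^sub>v n) (\<lambda>t. 0\<^sub>v m) (\<lambda>t. 0\<^sub>v (\<Sum>i<l. p i)) (\<lambda>t. 0\<^sub>v r)"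
    using cC cD has_weak_deriv_zero L1_loc_zero by (auto simp: lti_solution_def dims 0[unfolded dims])
  have ess: "ess_tendsto_zero (\<lambda>t. K *\<^sub>v x t - 0\<^sub>v r)"
    using det sol1 sol2 unfolding jointly_partially_detectable_def partially_detectable_def by blast
  have norm: "eucl_norm (K *\<^sub>v x t - 0\<^sub>v r) = sqrt (\<Sum>b<r. (dot n (\<lambda>j. K $$ (b, j)) (flow n ?a t x0))\<^sup>2)" for t
  proof -
    have "(K *\<^sub>v x t - 0\<^sub>v r) $ b = dot n (\<lambda>j. K $$ (b, j)) (flow n ?a t x0)" if "b < r" for b
      using that entry[OF K that, of t] by (simp del: index_mult_mat_vec)
    then show ?thesis by (simp add: eucl_norm_def L2_set_def)
  qed
  have "((\<lambda>t. eucl_norm (K *\<^sub>v x t - 0\<^sub>v r)) \<longlongrightarrow> 0) at_top"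
    by (rule ess_tendsto_zero_continuous[OF ess]) (auto simp: norm intro!: continuous_intros cont)
  then have "((\<lambda>t. (eucl_norm (K *\<^sub>v x t - 0\<^sub>v r))\<^sup>2) \<longlongrightarrow> 0\<^sup>2) at_top" by (rule tendsto_power)
  then show ?thesis by (simp add: norm sum_nonneg)
qed

section \<open>Error dynamics\<close>

text \<open>Links the algebraic condition on powers in \<open>lyapunov_form\<close> with the
  condition on trajectories in \<open>unobservable_decay\<close>, by summing the power
  series.\<close>

lemma dot_flow_eq_0:
  assumes "\<And>k. dot n c ((mat_act n a ^^ k) x) = 0"
  shows "dot n c (flow n a t x) = 0"
proof -
  have "(\<lambda>k. \<Sum>i<n. c i * ((mat_act n a ^^ k) x i / fact k * t ^ k)) sums (\<Sum>i<n. c i * flow n a t x i)"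
    by (intro sums_sum sums_mult flow_sums)
  moreover have "(\<Sum>i<n. c i * ((mat_act n a ^^ k) x i / fact k * t ^ k)) = 0" for k
  proof -
    have "(\<Sum>i<n. c i * ((mat_act n a ^^ k) x i / fact k * t ^ k)) = t ^ k / fact k * dot n c ((mat_act n a ^^ k) x)"
      by (simp add: dot_def sum_distrib_left algebra_simps)
    then show ?thesis using assms by simp
  qed
  ultimately show ?thesis using sums_unique2[OF _ sums_zero] by (simp add: dot_def)
qed

text \<open>The closed-loop vector field of the errors \<open>e i\<close>, estimate minus state;
  \<open>v i k\<close> is column \<open>k\<close> of the gain of node \<open>i\<close>.\<close>

definition error_rhs :: "nat \<Rightarrow> nat \<Rightarrow> (nat \<Rightarrow> nat) \<Rightarrow> (nat \<Rightarrow> nat \<Rightarrow> real) \<Rightarrow> (nat \<Rightarrow> nat \<Rightarrow> nat \<Rightarrow> real) \<Rightarrow>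
    (nat \<Rightarrow> nat \<Rightarrow> nat \<Rightarrow> real) \<Rightarrow> real mat \<Rightarrow> real \<Rightarrow> (nat \<Rightarrow> nat \<Rightarrow> real) \<Rightarrow> nat \<Rightarrow> nat \<Rightarrow> real" where
  "error_rhs l n p a c v \<Gamma> g e i = mat_act n a (e i) - (\<Sum>k<p i. dot n (c i k) (e i) *\<^sub>R v i k)
      + g *\<^sub>R (\<Sum>j<l. \<Gamma> $$ (i, j) *\<^sub>R (e j - e i))"

lemma error_rhs_apply:
  assumes "k < n"
  shows "error_rhs l n p a c v \<Gamma> g e i k = (\<Sum>k'<n. a k k' * e i k')
    - (\<Sum>q<p i. dot n (c i q) (e i) * v i q k) + g * (\<Sum>j<l. \<Gamma> $$ (i, j) * (e j k - e i k))"
  using assms by (simp add: error_rhs_def mat_act_def sum_fun_apply)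

text \<open>Brings the coupled errors into the scalar form required by
  \<open>weak_ode_classical\<close>, with pairs of node and coordinate as indices.\<close>

lemma error_rhs_coefficients:
  "\<exists>cf. \<forall>i<l. \<forall>k<n. \<forall>h. error_rhs l n p a c v \<Gamma> g (\<lambda>i k. h (i, k)) i k
    = (\<Sum>q\<in>{..<l} \<times> {..<n}. cf (i, k) q * h q)"
proof -
  \<comment> \<open>The diagonal blocks are those of \<open>A - L C\<close> at node
    \<open>i\<close>; the second summand is \<open>- g\<close> times the graph Laplacian acting on
    each coordinate separately.\<close>
  define cf where "cf = (\<lambda>(i, k) (j, k').
      (if j = i then a k k' - (\<Sum>q<p i. v i q k * c i q k') else 0)
      + (if k' = k then g * (\<Gamma> $$ (i, j) - (if j = i then \<Sum>m<l. \<Gamma> $$ (i, m) else 0)) else 0))"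
  have "error_rhs l n p a c v \<Gamma> g (\<lambda>i k. h (i, k)) i k = (\<Sum>q\<in>{..<l} \<times> {..<n}. cf (i, k) q * h q)"
    if i: "i < l" and k: "k < n" for i k h
  proof -
    have "(\<Sum>q\<in>{..<l} \<times> {..<n}. cf (i, k) q * h q) = (\<Sum>j<l. \<Sum>k'<n. cf (i, k) (j, k') * h (j, k'))"
      by (simp add: sum.cartesian_product case_prod_unfold)
    also have "\<dots> = (\<Sum>j<l. if j = i then \<Sum>k'<n. (a k k' - (\<Sum>q<p i. v i q k * c i q k')) * h (i, k') else 0)
        + (\<Sum>j<l. \<Sum>k'<n. if k' = k then g * (\<Gamma> $$ (i, j) - (if j = i then \<Sum>m<l. \<Gamma> $$ (i, m) else 0)) * h (j, k) else 0)"
      unfolding sum.distrib[symmetric]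
    proof (rule sum.cong[OF refl])
      fix j
      have "(if j = i then \<Sum>k'<n. (a k k' - (\<Sum>q<p i. v i q k * c i q k')) * h (i, k') else 0)
        = (\<Sum>k'<n. if j = i then (a k k' - (\<Sum>q<p i. v i q k * c i q k')) * h (j, k') else 0)"
        by simp
      then show "(\<Sum>k'<n. cf (i, k) (j, k') * h (j, k')) =
        (if j = i then \<Sum>k'<n. (a k k' - (\<Sum>q<p i. v i q k * c i q k')) * h (i, k') else 0) +
        (\<Sum>k'<n. if k' = k then g * (\<Gamma> $$ (i, j) - (if j = i then \<Sum>m<l. \<Gamma> $$ (i, m) else 0)) * h (j, k) else 0)"
        by (simp only:, unfold sum.distrib[symmetric], intro sum.cong refl) (auto simp: cf_def algebra_simps)
    qed
    also have "(\<Sum>j<l. if j = i then \<Sum>k'<n. (a k k' - (\<Sum>q<p i. v i q k * c i q k')) * h (i, k') else 0)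
        = (\<Sum>k'<n. (a k k' - (\<Sum>q<p i. v i q k * c i q k')) * h (i, k'))"
      using i by simp
    also have "\<dots> = (\<Sum>k'<n. a k k' * h (i, k')) - (\<Sum>q<p i. dot n (c i q) (\<lambda>k. h (i, k)) * v i q k)"
    proof -
      have "(\<Sum>k'<n. (\<Sum>q<p i. v i q k * c i q k') * h (i, k')) = (\<Sum>q<p i. dot n (c i q) (\<lambda>k. h (i, k)) * v i q k)"
        unfolding dot_def sum_distrib_right by (subst sum.swap) (simp add: algebra_simps)
      then show ?thesis by (simp add: left_diff_distrib sum_subtractf)
    qed
    also have "(\<Sum>j<l. \<Sum>k'<n. if k' = k then g * (\<Gamma> $$ (i, j) - (if j = i then \<Sum>m<l. \<Gamma> $$ (i, m) else 0)) * h (j, k) else 0)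
        = (\<Sum>j<l. g * (\<Gamma> $$ (i, j) - (if j = i then \<Sum>m<l. \<Gamma> $$ (i, m) else 0)) * h (j, k))"
      using k by simp
    also have "\<dots> = (\<Sum>j<l. g * (\<Gamma> $$ (i, j) * h (j, k)) - (if j = i then g * (\<Sum>m<l. \<Gamma> $$ (i, m)) * h (i, k) else 0))"
      by (intro sum.cong refl) (auto simp: algebra_simps)
    also have "\<dots> = g * (\<Sum>j<l. \<Gamma> $$ (i, j) * (h (j, k) - h (i, k)))"
      using i by (simp add: sum_subtractf right_diff_distrib sum_distrib_left sum_distrib_right mult.assoc)
    finally show ?thesis using error_rhs_apply[OF k, where e="\<lambda>i k. h (i, k)"] by simp
  qed
  then show ?thesis by blast
qed

text \<open>The input drops out: the term \<open>L D u\<close> contained in \<open>L y\<close>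
  compensates the correction in \<open>B - L D\<close>. The coupling is unaffected by subtracting
  \<open>x\<close> from all estimates.\<close>

lemma error_dynamics:
  fixes A B C D L \<Gamma> :: "real mat" and w :: "nat \<Rightarrow> real vec" and x u y coup :: "real vec"
  assumes A: "A \<in> carrier_mat n n" and B: "B \<in> carrier_mat n m"
    and C: "C \<in> carrier_mat q n" and D: "D \<in> carrier_mat q m"
    and L: "L = mat n (p i) (\<lambda>(s, q). v i q s)" and q: "q = p i"
    and w: "\<And>j. j < l \<Longrightarrow> w j \<in> carrier_vec n" and i: "i < l" and x: "x \<in> carrier_vec n" and u: "u \<in> carrier_vec m"
    and y: "y = C *\<^sub>v x + D *\<^sub>v u" and k: "k < n"
    and coup: "coup = vec n (\<lambda>k. \<Sum>j<l. \<Gamma> $$ (i, j) * (w j $ k - w i $ k))"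
    and c: "\<And>s k. s < q \<Longrightarrow> k < n \<Longrightarrow> c i s k = C $$ (s, k)"
  shows "(((A - L * C) *\<^sub>v w i + (B - L * D) *\<^sub>v u + L *\<^sub>v y + g \<cdot>\<^sub>v (1\<^sub>m n *\<^sub>v coup)) - (A *\<^sub>v x + B *\<^sub>v u)) $ k
    = error_rhs l n p (\<lambda>i j. A $$ (i, j)) c v \<Gamma> g (\<lambda>j k. w j $ k - x $ k) i k"
proof -
  have Lc: "L \<in> carrier_mat n q" by (simp add: L q)
  have wi: "w i \<in> carrier_vec n" using w i by simp
  have coupc: "coup \<in> carrier_vec n" by (simp add: coup)
  have 1: "(A - L * C) *\<^sub>v w i = A *\<^sub>v w i - L *\<^sub>v (C *\<^sub>v w i)"
    using A Lc C wi by (simp add: minus_mult_distrib_mat_vec[of _ n n] assoc_mult_mat_vec[of _ n q _ n])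
  have 2: "(B - L * D) *\<^sub>v u = B *\<^sub>v u - L *\<^sub>v (D *\<^sub>v u)"
    using B Lc D u by (simp add: minus_mult_distrib_mat_vec[of _ n m] assoc_mult_mat_vec[of _ n q _ m])
  have 3: "L *\<^sub>v y = L *\<^sub>v (C *\<^sub>v x) + L *\<^sub>v (D *\<^sub>v u)"
    unfolding y by (rule mult_add_distrib_mat_vec[OF Lc mult_mat_vec_carrier[OF C x] mult_mat_vec_carrier[OF D u]])
  have 4: "1\<^sub>m n *\<^sub>v coup = coup" using coupc by simp
  have car: "A *\<^sub>v w i \<in> carrier_vec n" "L *\<^sub>v (C *\<^sub>v w i) \<in> carrier_vec n" "B *\<^sub>v u \<in> carrier_vec n"
    "L *\<^sub>v (D *\<^sub>v u) \<in> carrier_vec n" "L *\<^sub>v (C *\<^sub>v x) \<in> carrier_vec n" "A *\<^sub>v x \<in> carrier_vec n"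
    using A Lc C B D wi x u by (blast intro: mult_mat_vec_carrier)+
  \<comment> \<open>\<open>b1\<close> stands for \<open>B u\<close> and \<open>b2\<close> for
    \<open>L D u\<close>, the two vectors that cancel.\<close>
  have split: "((((a1 - a2) + (b1 - b2)) + (a3 + b2)) + g \<cdot>\<^sub>v coup - (a4 + b1)) $ k
      = (a1 $ k - a4 $ k) - (a2 $ k - a3 $ k) + g * coup $ k"
    if "a1 \<in> carrier_vec n" "a2 \<in> carrier_vec n" "b1 \<in> carrier_vec n" "b2 \<in> carrier_vec n"
      "a3 \<in> carrier_vec n" "a4 \<in> carrier_vec n" for a1 a2 a3 a4 b1 b2 :: "real vec"
    using that coupc k by simp
  have LC: "(L *\<^sub>v (C *\<^sub>v x')) $ k = (\<Sum>s<q. dot n (c i s) (\<lambda>k. x' $ k) * v i s k)" if x': "x' \<in> carrier_vec n" for x'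
  proof -
    have "(C *\<^sub>v x') $ s = dot n (c i s) (\<lambda>k. x' $ k)" if "s < q" for s
      using mult_mat_vec_entry[OF C x' that] c[OF that] by (simp add: dot_def)
    then show ?thesis
      using mult_mat_vec_entry[OF Lc mult_mat_vec_carrier[OF C x'] k] k
      by (simp add: L q[symmetric] mult.commute del: index_mult_mat_vec)
  qed
  have dot_diff: "dot n (c i s) (\<lambda>k. w i $ k - x $ k) = dot n (c i s) (\<lambda>k. w i $ k) - dot n (c i s) (\<lambda>k. x $ k)" for s
    by (simp add: dot_def right_diff_distrib sum_subtractf)
  show ?thesis
    unfolding 1 2 3 4 split[OF car(1,2,3,4,5,6)] LC[OF wi] LC[OF x] error_rhs_apply[OF k]
      mult_mat_vec_entry[OF A wi k] mult_mat_vec_entry[OF A x k]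
    using k by (simp add: dot_diff coup q[symmetric] right_diff_distrib left_diff_distrib sum_subtractf)
qed

lemma undirected_balanced:
  assumes "\<Gamma> \<in> carrier_mat l l" "transpose_mat \<Gamma> = \<Gamma>"
  shows "balanced_graph l \<Gamma>"
proof -
  have "\<Gamma> $$ (i, j) = \<Gamma> $$ (j, i)" if "i < l" "j < l" for i j
    using that assms index_transpose_mat(1)[of i \<Gamma> j] by auto
  then show ?thesis by (simp add: balanced_graph_def)
qed

text \<open>The output equation holds only almost everywhere, so the right-hand side of the error
  system does too; the integrals against test functions are the same.\<close>

lemma weak_error_equation:
  fixes w x rw rx :: "real \<Rightarrow> real vec" and F :: "real \<Rightarrow> real"
  assumes w: "has_weak_deriv n w rw" and x: "has_weak_deriv n x rx" and k: "k < n"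
    and F: "AE t in lebesgue. (rw t - rx t) $ k = F t" and Fm: "F \<in> borel_measurable lebesgue"
    and \<phi>: "test_function \<phi>"
  shows "(LINT t|lebesgue. (w t $ k - x t $ k) * deriv \<phi> t) = - (LINT t|lebesgue. F t * \<phi> t)"
proof -
  have d: "has_weak_deriv n (\<lambda>t. w t - x t) (\<lambda>t. rw t - rx t)" by (rule has_weak_deriv_diff[OF w x])
  have xc: "x t \<in> carrier_vec n" for t using x L1_loc_carrier by (auto simp: has_weak_deriv_def)
  have "continuous_on UNIV \<phi>" using test_function_props[OF \<phi>] by metis
  then have \<phi>m: "\<phi> \<in> borel_measurable lebesgue"
    by (intro measurable_completion) (simp add: borel_measurable_continuous_onI)
  have rm: "(\<lambda>t. (rw t - rx t) $ k) \<in> borel_measurable lebesgue"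
    using d k by (intro L1_loc_measurable) (auto simp: has_weak_deriv_def)
  have "(LINT t|lebesgue. (w t $ k - x t $ k) * deriv \<phi> t) = (LINT t|lebesgue. (w t - x t) $ k * deriv \<phi> t)"
  proof (rule Bochner_Integration.integral_cong[OF refl])
    show "(w t $ k - x t $ k) * deriv \<phi> t = (w t - x t) $ k * deriv \<phi> t" for t
      using xc[of t] k by simp
  qed
  also have "\<dots> = - (LINT t|lebesgue. (rw t - rx t) $ k * \<phi> t)"
    using d \<phi> k by (simp add: has_weak_deriv_def)
  also have "(LINT t|lebesgue. (rw t - rx t) $ k * \<phi> t) = (LINT t|lebesgue. F t * \<phi> t)"
  proof (rule integral_cong_AE)
    show "AE t in lebesgue. (rw t - rx t) $ k * \<phi> t = F t * \<phi> t"
      using F by eventually_elim simp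
  qed (intro borel_measurable_times rm Fm \<phi>m)+
  finally show ?thesis .
qed

text \<open>Balance enters through \<open>network_lyapunov\<close>, connectivity through
  \<open>disagreement_bound\<close>, and detectability through the form \<open>X\<close>, from which
  both the gains and the coupling strength are computed.\<close>

lemma estimator_of_detectable:
  fixes A B K \<Gamma> :: "real mat" and C D :: "nat \<Rightarrow> real mat"
  assumes A: "A \<in> carrier_mat n n" and B: "B \<in> carrier_mat n m"
    and C: "\<forall>i<l. C i \<in> carrier_mat (p i) n" and D: "\<forall>i<l. D i \<in> carrier_mat (p i) m"
    and K: "K \<in> carrier_mat r n"
    and \<Gamma>: "\<forall>i<l. \<forall>j<l. \<Gamma> $$ (i, j) \<in> {0, 1}"
    and bal: "balanced_graph l \<Gamma>"
    and conn: "strongly_connected (comm_graph l \<Gamma>) \<or> Digraph_Component.connected (comm_graph l \<Gamma>)"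
    and det: "jointly_partially_detectable l A B C D K"
  shows "\<exists>g L. 0 < g \<and> (\<forall>i<l. L i \<in> carrier_mat n (p i)) \<and>
    achieves_omniscience l A B C D K \<Gamma> g (\<lambda>_. n) (\<lambda>i. A - L i * C i) (\<lambda>i. B - L i * D i) L (\<lambda>_. 1\<^sub>m n) (\<lambda>_. K)"
proof -
  let ?a = "\<lambda>i j. A $$ (i, j)"
  define c where "c i k = (\<lambda>j. C i $$ (k, j))" for i k
  define kr where "kr b = (\<lambda>j. K $$ (b, j))" for b
  define qc where "qc x y = (\<Sum>i<l. \<Sum>k<p i. dot n (c i k) x * dot n (c i k) y)" for x y
  define qk where "qk x y = (\<Sum>b<r. dot n (kr b) x * dot n (kr b) y)" for x y
  have qc: "psd_form n qc" and qk: "psd_form n qk"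
    unfolding qc_def[abs_def] qk_def[abs_def] by (intro psd_form_sum psd_form_square)+
  have qc0: "dot n (c i k) x = 0" if "qc x x = 0" "i < l" "k < p i" for x i k
  proof -
    have "\<forall>i\<in>{..<l}. (\<Sum>k<p i. dot n (c i k) x * dot n (c i k) x) = 0"
      using that(1) unfolding qc_def by (subst (asm) sum_nonneg_eq_0_iff) (auto intro!: sum_nonneg)
    then have "(\<Sum>k<p i. dot n (c i k) x * dot n (c i k) x) = 0" using that(2) by blast
    then have "\<forall>k\<in>{..<p i}. dot n (c i k) x * dot n (c i k) x = 0"
      by (subst (asm) sum_nonneg_eq_0_iff) auto
    then show ?thesis using that(3) by simp
  qed
  have "((\<lambda>t. qk (flow n ?a t x) (flow n ?a t x)) \<longlongrightarrow> 0) at_top"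
    if "\<And>k. qc ((mat_act n ?a ^^ k) x) ((mat_act n ?a ^^ k) x) = 0" for x
  proof -
    have "((\<lambda>t. \<Sum>b<r. (dot n (\<lambda>j. K $$ (b, j)) (flow n ?a t x))\<^sup>2) \<longlongrightarrow> 0) at_top"
      using qc0[OF that] by (intro unobservable_decay[OF A B C D K det] dot_flow_eq_0) (auto simp: c_def)
    then show ?thesis by (simp add: qk_def kr_def power2_eq_square)
  qed
  then obtain X \<epsilon> \<kappa> \<beta> where X: "psd_form n X" "0 < \<epsilon>" "0 \<le> \<kappa>" "0 \<le> \<beta>"
    and lyap: "\<And>x. 2 * X x (mat_act n ?a x) \<le> - \<epsilon> * X x x + \<kappa> * qc x x"
    and qc_le: "\<And>x. qc x x \<le> \<beta> * X x x" and qk_le: "\<And>x. qk x x \<le> \<beta> * X x x"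
    using lyapunov_form[OF qc qk, of ?a] by blast
  have "\<exists>v. \<forall>x. X v x = \<kappa> * real l * dot n (c i k) x" if "i < l" "k < p i" for i k
  proof -
    have *: "dot n (\<lambda>j. \<kappa> * real l * c i k j) x = \<kappa> * real l * dot n (c i k) x" for x
      by (simp add: dot_def sum_distrib_left mult.assoc)
    \<comment> \<open>Domination of \<open>qc\<close> by \<open>X\<close> puts the kernel of
      \<open>X\<close> inside that of every output row, which makes the gain equation
      solvable.\<close>
    have "dot n (\<lambda>j. \<kappa> * real l * c i k j) x = 0" if "X x x = 0" for x
      using qc0[of x, OF _ \<open>i < l\<close> \<open>k < p i\<close>] qc_le[of x] psd_nonneg[OF qc, of x] that unfolding * by simp
    then obtain v where "\<forall>x. X v x = dot n (\<lambda>j. \<kappa> * real l * c i k j) x"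
      using psd_represent[OF X(1)] by blast
    then show ?thesis unfolding * by blast
  qed
  then obtain v where v: "\<And>i k x. i < l \<Longrightarrow> k < p i \<Longrightarrow> X (v i k) x = \<kappa> * real l * dot n (c i k) x"
    by metis
  obtain \<Lambda> where \<Lambda>: "0 \<le> \<Lambda>" "\<And>e. (\<Sum>i<l. \<Sum>j<l. X (e i - e j) (e i - e j))
        \<le> \<Lambda> * (\<Sum>i<l. \<Sum>j<l. \<Gamma> $$ (i, j) * X (e i - e j) (e i - e j))"
    using disagreement_bound[OF \<Gamma> connected_neighbours[OF conn], of n] X(1) by blast
  \<comment> \<open>The \<open>+ 1\<close> keeps the coupling strength positive when the product is
    0.\<close>
  define g where "g = 2 * \<kappa> * \<beta> * \<Lambda> + 1"
  have g: "0 < g" using X \<Lambda>(1) by (simp add: g_def add_nonneg_pos)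
  define L where "L i = mat n (p i) (\<lambda>(s, q). v i q s)" for i
  let ?F = "error_rhs l n p ?a c v \<Gamma> g"
  have decrease: "(\<Sum>i<l. 2 * X (e i) (?F e i)) \<le> - \<epsilon> * (\<Sum>i<l. X (e i) (e i))" for e
    unfolding error_rhs_def
  proof (rule network_lyapunov[where qc = "\<lambda>x. qc x x", OF X(1,3,4) _ lyap qc_le v bal \<Lambda>])
    show "qc x x = (\<Sum>i<l. \<Sum>k<p i. (dot n (c i k) x)\<^sup>2)" for x
      by (simp add: qc_def power2_eq_square)
    show "0 \<le> \<Gamma> $$ (i, j)" if "i < l" "j < l" for i j using \<Gamma> that by force
  qed (simp_all add: g_def)
  have "achieves_omniscience l A B C D K \<Gamma> g (\<lambda>_. n) (\<lambda>i. A - L i * C i) (\<lambda>i. B - L i * D i) L (\<lambda>_. 1\<^sub>m n) (\<lambda>_. K)"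
    unfolding achieves_omniscience_def
  proof (intro allI impI)
    fix x u y z w zh i0
    assume sys: "distributed_solution l A B C D K x u y z"
      and est: "estimator_solution l \<Gamma> g (\<lambda>_. n) (\<lambda>i. A - L i * C i) (\<lambda>i. B - L i * D i) L (\<lambda>_. 1\<^sub>m n) (\<lambda>_. K) w u y zh"
      and i0: "i0 < l"
    have dims: "dim_row A = n" "dim_col B = m" "dim_row K = r" using A B K by auto
    have cx: "x t \<in> carrier_vec n" and cu: "u t \<in> carrier_vec m" for t
      using sys L1_loc_carrier by (auto simp: distributed_solution_def dims)
    have wL: "w i \<in> L1_loc n" if "i < l" for i using est that by (simp add: estimator_solution_def)
    have cw: "w i t \<in> carrier_vec n" if "i < l" for i t using wL[OF that] L1_loc_carrier by auto
    have xL: "x \<in> L1_loc n" using sys by (simp add: distributed_solution_def dims)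
    define f where "f = (\<lambda>(i, k) t. w i t $ k - x t $ k)"
    let ?I = "{..<l} \<times> {..<n}"
    obtain cf where cf: "\<And>i k h. i < l \<Longrightarrow> k < n \<Longrightarrow>
        ?F (\<lambda>i k. h (i, k)) i k = (\<Sum>q\<in>?I. cf (i, k) q * h q)"
      using error_rhs_coefficients[of l n p ?a c v \<Gamma> g] by blast
    have f_loc: "f q absolutely_integrable_on S" if "q \<in> ?I" "compact S" for q S
      using that L1_loc_component[OF wL] L1_loc_component[OF xL]
      by (auto simp: f_def intro!: set_integral_diff(1))
    have f_meas: "f q \<in> borel_measurable lebesgue" if "q \<in> ?I" for q
      using that L1_loc_measurable[OF wL] L1_loc_measurable[OF xL] by (auto simp: f_def intro!: borel_measurable_diff)
    have weak: "(LINT t|lebesgue. f q t * deriv \<phi> t) = - (LINT t|lebesgue. (\<Sum>q'\<in>?I. cf q q' * f q' t) * \<phi> t)"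
      if \<phi>: "test_function \<phi>" and q: "q \<in> ?I" for \<phi> q
    proof -
      obtain i k where ik: "q = (i, k)" "i < l" "k < n" using q by auto
      have Ci: "C i \<in> carrier_mat (p i) n" and Di: "D i \<in> carrier_mat (p i) m" using C D ik by auto
      let ?rw = "\<lambda>t. (A - L i * C i) *\<^sub>v w i t + (B - L i * D i) *\<^sub>v u t + L i *\<^sub>v y i t
          + g \<cdot>\<^sub>v (1\<^sub>m n *\<^sub>v coupling l \<Gamma> (\<lambda>_. n) w i t)"
      let ?rx = "\<lambda>t. A *\<^sub>v x t + B *\<^sub>v u t"
      have hw: "has_weak_deriv n (w i) ?rw" using est ik by (simp add: estimator_solution_def)
      have hx: "has_weak_deriv n x ?rx" using sys by (simp add: distributed_solution_def dims)
      have "AE t in lebesgue. y i t = C i *\<^sub>v x t + D i *\<^sub>v u t"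
        using sys ik by (simp add: distributed_solution_def)
      then have "AE t in lebesgue. (?rw t - ?rx t) $ k = (\<Sum>q'\<in>?I. cf q q' * f q' t)"
      proof eventually_elim
        case (elim t)
        have "(?rw t - ?rx t) $ k = ?F (\<lambda>j k. w j t $ k - x t $ k) i k"
          by (rule error_dynamics[where w="\<lambda>j. w j t" and i=i and p=p and v=v,
                OF A B Ci Di L_def refl cw ik(2) cx cu elim ik(3)])
             (auto simp: coupling_def c_def)
        also have "\<dots> = (\<Sum>q'\<in>?I. cf q q' * f q' t)"
          using cf[OF ik(2,3), of "\<lambda>q. f q t"] by (simp add: f_def ik(1))
        finally show ?case .
      qed
      moreover have "(\<lambda>t. \<Sum>q'\<in>?I. cf q q' * f q' t) \<in> borel_measurable lebesgue"
        by (intro borel_measurable_sum borel_measurable_times borel_measurable_const f_meas)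
      ultimately show ?thesis
        using weak_error_equation[OF hw hx ik(3) _ _ \<phi>] by (simp add: f_def ik(1))
    qed
    obtain G where G: "\<And>q t. q \<in> ?I \<Longrightarrow> 0 < t \<Longrightarrow> (G q has_real_derivative (\<Sum>q'\<in>?I. cf q q' * G q' t)) (at t)"
      and G_ae: "\<And>q. q \<in> ?I \<Longrightarrow> AE t in lebesgue. 0 \<le> t \<longrightarrow> f q t = G q t"
      using weak_ode_classical[of ?I f cf, OF _ f_loc weak] by auto
    \<comment> \<open>These classical errors equal the given ones almost everywhere for
      \<open>t \<ge> 0\<close>; unlike the given ones, they make \<open>V\<close>
      differentiable.\<close>
    define e where "e = (\<lambda>t i k. G (i, k) t)"
    have e_deriv: "((\<lambda>t. e t i k) has_real_derivative ?F (e t) i k) (at t)" if "i < l" "k < n" "0 < t" for i k t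
      using G[of "(i, k)" t] cf[of i k "\<lambda>q. G q t"] that by (simp add: e_def)
    define V where "V t = (\<Sum>i<l. X (e t i) (e t i))" for t
    have V0: "0 \<le> V t" for t unfolding V_def by (intro sum_nonneg psd_nonneg[OF X(1)])
    have V_deriv: "(V has_real_derivative (\<Sum>i<l. 2 * X (e t i) (?F (e t) i))) (at t)" if "0 < t" for t
      unfolding V_def[abs_def]
    proof (rule DERIV_sum)
      fix i assume "i \<in> {..<l}"
      then have "((\<lambda>t. X (e t i) (e t i)) has_real_derivative
          X (?F (e t) i) (e t i) + X (e t i) (?F (e t) i)) (at t)"
        using that by (intro psd_deriv[OF X(1)] e_deriv) auto
      then show "((\<lambda>t. X (e t i) (e t i)) has_real_derivative 2 * X (e t i) (?F (e t) i)) (at t)"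
        by (simp add: psd_commute[OF X(1), of "?F (e t) i"])
    qed
    have V_decay: "V t \<le> V 1 * exp \<epsilon> * exp (- \<epsilon> * t)" if "1 \<le> t" for t
    proof (rule exponential_decay[OF V_deriv _ that])
      show "(\<Sum>i<l. 2 * X (e s i) (?F (e s) i)) \<le> - \<epsilon> * V s" for s
        unfolding V_def by (rule decrease)
    qed
    \<comment> \<open>\<open>qk\<close> is the square of the norm, so a square root is taken and the
      rate \<epsilon> is halved.\<close>
    define c0 where "c0 = sqrt (\<beta> * (V 1 * exp \<epsilon>))"
    have zhL: "zh i0 \<in> L1_loc r" and zL: "z \<in> L1_loc r"
      using sys est i0 by (auto simp: distributed_solution_def estimator_solution_def dims)
    show "ess_tendsto_zero (\<lambda>t. zh i0 t - z t)"
    proof (rule ess_tendsto_zero_exp_bound[OF L1_loc_diff[OF zhL zL]])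
      have "AE t in lebesgue. zh i0 t = K *\<^sub>v w i0 t" "AE t in lebesgue. z t = K *\<^sub>v x t"
        using sys est i0 by (auto simp: distributed_solution_def estimator_solution_def)
      moreover have "AE t in lebesgue. \<forall>q\<in>?I. 0 \<le> t \<longrightarrow> f q t = G q t"
        using G_ae by (intro eventually_ball_finite) auto
      ultimately show "AE t in lebesgue. 1 \<le> t \<longrightarrow> eucl_norm (zh i0 t - z t) \<le> c0 * exp (- (\<epsilon> / 2) * t)"
      proof eventually_elim
        case (elim t)
        show ?case
        proof
          assume t: "1 \<le> t"
          have "(zh i0 t - z t) $ b = dot n (kr b) (e t i0)" if b: "b < r" for b
          proof -
            have "(zh i0 t - z t) $ b = (K *\<^sub>v w i0 t) $ b - (K *\<^sub>v x t) $ b"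
              using K b by (simp add: elim(1,2))
            also have "\<dots> = (\<Sum>k<n. K $$ (b, k) * (w i0 t $ k - x t $ k))"
              unfolding mult_mat_vec_entry[OF K cw[OF i0] b] mult_mat_vec_entry[OF K cx b]
              by (simp add: right_diff_distrib sum_subtractf)
            also have "\<dots> = dot n (kr b) (e t i0)"
              using elim(3) t i0 by (auto simp: dot_def kr_def e_def f_def intro!: sum.cong)
            finally show ?thesis .
          qed
          moreover have "dim_vec (zh i0 t - z t) = r" using L1_loc_carrier[OF zL, of t] by simp
          ultimately have "eucl_norm (zh i0 t - z t) = sqrt (qk (e t i0) (e t i0))"
            by (simp add: eucl_norm_def L2_set_def qk_def power2_eq_square)
          also have "\<dots> \<le> sqrt (\<beta> * (V 1 * exp \<epsilon>) * exp (- \<epsilon> * t))"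
          proof (rule real_sqrt_le_mono)
            have "qk (e t i0) (e t i0) \<le> \<beta> * X (e t i0) (e t i0)" by (rule qk_le)
            also have "\<dots> \<le> \<beta> * V t"
              unfolding V_def using X(4) i0 psd_nonneg[OF X(1)]
              by (intro mult_left_mono member_le_sum[of i0 _ "\<lambda>i. X (e t i) (e t i)"]) auto
            also have "\<dots> \<le> \<beta> * (V 1 * exp \<epsilon> * exp (- \<epsilon> * t))"
              using X(4) V_decay[OF t] by (rule mult_left_mono[rotated])
            finally show "qk (e t i0) (e t i0) \<le> \<beta> * (V 1 * exp \<epsilon>) * exp (- \<epsilon> * t)" by (simp add: mult.assoc)
          qed
          also have "\<dots> = c0 * sqrt (exp (- \<epsilon> * t))" by (simp add: c0_def real_sqrt_mult)
          also have "exp (- \<epsilon> * t) = (exp (- (\<epsilon> / 2) * t))\<^sup>2"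
            by (simp add: power2_eq_square flip: exp_add)
          finally show "eucl_norm (zh i0 t - z t) \<le> c0 * exp (- (\<epsilon> / 2) * t)" by simp
        qed
      qed
      show "0 \<le> c0" using X(4) V0[of 1] by (simp add: c0_def)
      show "0 < \<epsilon> / 2" using X(2) by simp
    qed
  qed
  then show ?thesis using g by (intro exI[of _ g] exI[of _ L]) (simp add: L_def)
qed

theorem theorem17:
  fixes l n m r :: nat and p :: "nat \<Rightarrow> nat"
    and A B K \<Gamma> :: "real mat" and C D :: "nat \<Rightarrow> real mat"
  assumes "l > 0" and "n > 0" and "m > 0" and "r > 0" and "\<forall>i<l. p i > 0"
    and "A \<in> carrier_mat n n" and "B \<in> carrier_mat n m"
    and "\<forall>i<l. C i \<in> carrier_mat (p i) n" and "\<forall>i<l. D i \<in> carrier_mat (p i) m"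
    and "K \<in> carrier_mat r n"
    and "\<Gamma> \<in> carrier_mat l l" and "\<forall>i<l. \<forall>j<l. \<Gamma> $$ (i, j) \<in> {0, 1}"
    and "(balanced_graph l \<Gamma> \<and> strongly_connected (comm_graph l \<Gamma>)) \<or>
         (transpose_mat \<Gamma> = \<Gamma> \<and> Digraph_Component.connected (comm_graph l \<Gamma>))"
  shows "(\<exists>(g :: real) (ls :: nat \<Rightarrow> nat) N H L M R.
            g > 0 \<and>
            (\<forall>i<l. N i \<in> carrier_mat (ls i) (ls i) \<and> H i \<in> carrier_mat (ls i) m \<and>
               L i \<in> carrier_mat (ls i) (p i) \<and> M i \<in> carrier_mat (ls i) (ls i) \<and>
               R i \<in> carrier_mat r (ls i)) \<and>
            (\<forall>i<l. \<forall>j<l. \<Gamma> $$ (i, j) = 1 \<longrightarrow> ls i = ls j) \<and>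
            achieves_omniscience l A B C D K \<Gamma> g ls N H L M R)
         \<longleftrightarrow> jointly_partially_detectable l A B C D K"
proof
  assume "\<exists>(g :: real) (ls :: nat \<Rightarrow> nat) N H L M R.
            g > 0 \<and>
            (\<forall>i<l. N i \<in> carrier_mat (ls i) (ls i) \<and> H i \<in> carrier_mat (ls i) m \<and>
               L i \<in> carrier_mat (ls i) (p i) \<and> M i \<in> carrier_mat (ls i) (ls i) \<and>
               R i \<in> carrier_mat r (ls i)) \<and>
            (\<forall>i<l. \<forall>j<l. \<Gamma> $$ (i, j) = 1 \<longrightarrow> ls i = ls j) \<and>
            achieves_omniscience l A B C D K \<Gamma> g ls N H L M R"
  then show "jointly_partially_detectable l A B C D K"
    using detectable_of_estimator[OF assms(1,6-10,12)] by blast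
next
  assume det: "jointly_partially_detectable l A B C D K"
  \<comment> \<open>Symmetry implies balance, so both alternatives for the graph lead to the same
    pair of facts.\<close>
  have "balanced_graph l \<Gamma>" "strongly_connected (comm_graph l \<Gamma>) \<or> Digraph_Component.connected (comm_graph l \<Gamma>)"
    using assms(13) undirected_balanced[OF assms(11)] by auto
  then obtain g L where gL: "0 < g" "\<forall>i<l. L i \<in> carrier_mat n (p i)"
      "achieves_omniscience l A B C D K \<Gamma> g (\<lambda>_. n) (\<lambda>i. A - L i * C i) (\<lambda>i. B - L i * D i) L (\<lambda>_. 1\<^sub>m n) (\<lambda>_. K)"
    using estimator_of_detectable[OF assms(6-10,12) _ _ det] by blast
  have "\<forall>i<l. A - L i * C i \<in> carrier_mat n n \<and> B - L i * D i \<in> carrier_mat n m \<and> L i \<in> carrier_mat n (p i) \<and>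
      (1\<^sub>m n :: real mat) \<in> carrier_mat n n \<and> K \<in> carrier_mat r n"
    using gL(2) assms(6-10) by (auto intro!: minus_carrier_mat mult_carrier_mat)
  then show "\<exists>(g :: real) (ls :: nat \<Rightarrow> nat) N H L M R.
            g > 0 \<and>
            (\<forall>i<l. N i \<in> carrier_mat (ls i) (ls i) \<and> H i \<in> carrier_mat (ls i) m \<and>
               L i \<in> carrier_mat (ls i) (p i) \<and> M i \<in> carrier_mat (ls i) (ls i) \<and>
               R i \<in> carrier_mat r (ls i)) \<and>
            (\<forall>i<l. \<forall>j<l. \<Gamma> $$ (i, j) = 1 \<longrightarrow> ls i = ls j) \<and>
            achieves_omniscience l A B C D K \<Gamma> g ls N H L M R"
    using gL(1,3)
    by (intro exI[of _ g] exI[of _ "\<lambda>_. n"] exI[of _ "\<lambda>i. A - L i * C i"] exI[of _ "\<lambda>i. B - L i * D i"]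
        exI[of _ L] exI[of _ "\<lambda>_. 1\<^sub>m n"] exI[of _ "\<lambda>_. K"]) simp
qed

end
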